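(* A set $E\subset\mathbb{R}$ has the quasisymmetric extension property in $\mathbb{R}$ if and only if it is relatively connected.
   Context: Quasisymmetry: a map $f:(X,d)\to(Y,d')$ between metric spaces, which is a homeomorphism onto its image, is quasisymmetric if there is a homeomorphism $\eta:[0,\infty)\to[0,\infty)$ such that for all $x,a,b\in X$ with $x\neq b$, $\frac{d'(f(x),f(a))}{d'(f(x),f(b))}\le\eta\left(\frac{d(x,a)}{d(x,b)}\right)$. Quasisymmetric extension property: a subset $E$ of a metric space $X$ has the quasisymmetric extension property in $X$ if every quasisymmetric mapping $f:E\to X$ that can be extended to a homeomorphism of $X$ onto $X$ can also be extended to a quasisymmetric homeomorphism of $X$ onto $X$. Relative connectedness: a metric space $X$ is $M$-relatively connected, $M>1$, if for every $x\in X$ and $r>0$ with $\overline{B}(x,r)\neq X$, either $\overline{B}(x,r)=\{x\}$ or $\overline{B}(x,r)\setminus B(x,r/M)\neq\emptyset$, where $B(x,r)$ and $\overline{B}(x,r)$ are the open ball $\{d(\cdot,x)<r\}$ and the closed ball $\{d(\cdot,x)\le r\}$ in $X$. It is relatively connected if it is $M$-relatively connected for some $M$. A subset $E\subset\mathbb{R}$ is regarded as a metric space with the Euclidean metric. *)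

theory Defs
  imports "HOL-Analysis.Analysis"
begin

text \<open>
  Subsets of a metric space are regarded as metric spaces with the restricted metric.
  A map defined on a subset \<open>E\<close> is a total function of which only the values on \<open>E\<close> matter.
\<close>

definition quasisymmetric_on ::
  "'a::metric_space set \<Rightarrow> ('a \<Rightarrow> 'b::metric_space) \<Rightarrow> bool" where
  "quasisymmetric_on E f \<longleftrightarrow>
     (\<exists>g. homeomorphism E (f ` E) f g) \<and>
     (\<exists>(\<eta>::real \<Rightarrow> real) \<theta>. homeomorphism {0..} {0..} \<eta> \<theta> \<and>
        (\<forall>x\<in>E. \<forall>a\<in>E. \<forall>b\<in>E. x \<noteq> b \<longrightarrow>
           dist (f x) (f a) / dist (f x) (f b) \<le> \<eta> (dist x a / dist x b)))"

text \<open>The ambient space \<open>X\<close> is the whole type \<open>'a\<close>.\<close>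

definition quasisymmetric_extension_property :: "'a::metric_space set \<Rightarrow> bool" where
  "quasisymmetric_extension_property E \<longleftrightarrow>
     (\<forall>f::'a \<Rightarrow> 'a.
        quasisymmetric_on E f \<and>
        (\<exists>F G. homeomorphism UNIV UNIV F G \<and> (\<forall>x\<in>E. F x = f x)) \<longrightarrow>
        (\<exists>F G. homeomorphism UNIV UNIV F G \<and> quasisymmetric_on UNIV F \<and> (\<forall>x\<in>E. F x = f x)))"

text \<open>The balls of the subspace \<open>E\<close> are the traces on \<open>E\<close> of the ambient balls.\<close>

definition M_relatively_connected :: "real \<Rightarrow> 'a::metric_space set \<Rightarrow> bool" where
  "M_relatively_connected M E \<longleftrightarrow> M > 1 \<and>
     (\<forall>x\<in>E. \<forall>r>0. cball x r \<inter> E \<noteq> E \<longrightarrow>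
        cball x r \<inter> E = {x} \<or> (cball x r \<inter> E) - (ball x (r / M) \<inter> E) \<noteq> {})"

definition relatively_connected :: "'a::metric_space set \<Rightarrow> bool" where
  "relatively_connected E \<longleftrightarrow> (\<exists>M. M_relatively_connected M E)"

end

theory Submission
  imports Defs
begin

text \<open>
  Both directions rest on a dichotomy: quasisymmetric maps of a relatively connected set distort
  ratios of distances by at most a power, and so do quasisymmetric maps of the line, whereas a set
  with arbitrarily wide relative gaps carries quasisymmetric maps with arbitrarily bad distortion.

  \<^bold>\<open>Relatively connected sets have the extension property.\<close>  In a relatively connected set
  any two scales at a point are joined by a chain of points whose distances grow geometrically, and
  applying quasisymmetry along the chain turns an arbitrary \<open>\<eta>\<close> into a two-sided power bound
  (\<open>relatively_connected_power_quasisymmetric\<close>). This bound passes to the closure, so \<open>E\<close> may be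
  assumed closed, and after a reflection \<open>f\<close> is increasing. The size of \<open>f\<close> near \<open>x \<in> E\<close> at scale
  \<open>r\<close> is measured by
  \<open>scale x r = sup {\<bar>f y - f x\<bar> min (u\<^sup>a) (u\<^sup>b) | y \<in> E, y \<noteq> x}\<close> with \<open>u = r / \<bar>y - x\<bar>\<close>.
  Being a supremum of functions of \<open>r\<close> that grow at least like \<open>r\<^sup>a\<close> and at most like \<open>r\<^sup>b\<close>, it
  grows in this way too, for all \<open>r > 0\<close>, even at scales at which \<open>E\<close> has no points; by the power
  bound it agrees with \<open>\<bar>f z - f x\<bar>\<close> up to a constant when \<open>r = \<bar>z - x\<bar>\<close> and \<open>z \<in> E\<close>, and it is
  insensitive to moving \<open>x\<close> within distance \<open>r\<close> (\<open>scale_shift\<close>). On a bounded gap \<open>(\<alpha>, \<beta>)\<close> of \<open>E\<close> the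
  extension divides \<open>[f \<alpha>, f \<beta>]\<close> in the ratio \<open>scale \<alpha> (z - \<alpha>) : scale \<beta> (\<beta> - z)\<close>, and on an
  unbounded gap it is \<open>f\<close> at the endpoint plus or minus \<open>scale\<close>. Then
  \<open>\<bar>F z - f e\<bar>\<close> is comparable with \<open>scale e \<bar>z - e\<bar>\<close> for all \<open>e \<in> E\<close> and all \<open>z\<close>
  (\<open>extend_compare\<close>), and inside a gap \<open>F\<close> inherits the regular growth of \<open>scale\<close> (\<open>extend_near\<close>).
  Together these give \<open>F (x + h) - F x \<approx> F x - F (x - h)\<close> for all \<open>x\<close> and \<open>h\<close>, which for an
  increasing function of the line is equivalent to quasisymmetry
  (\<open>quasisymmetric_if_symmetric_triples\<close>).

  \<^bold>\<open>The extension property forces relative connectedness.\<close>  If \<open>E\<close> is not relatively connected,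
  there are balls \<open>B\<^sub>n\<close> around points \<open>x\<^sub>n\<close> of \<open>E\<close> such that the part of \<open>E\<close> in \<open>B\<^sub>n\<close> has at least
  two points and is separated from the rest of \<open>E\<close> by an annulus whose ratio of radii is \<open>K\<^sub>n\<^sup>2\<close>,
  where \<open>K\<^sub>n\<close> tends to infinity as fast as desired. Shrink each \<open>B\<^sub>n\<close> by a factor \<open>\<lambda>\<^sub>n \<le> 1\<close>,
  simultaneously for all \<open>n\<close>, by integrating the product of the factors. For \<open>y\<close> and \<open>z\<close> in \<open>E\<close> the
  distance \<open>\<bar>y - z\<bar>\<close> is multiplied, up to a factor 2, by the product of the \<open>\<lambda>\<^sub>n\<close> over the \<open>n\<close> for
  which \<open>B\<^sub>n\<close> contains both points, because the balls that contain exactly one of them, or lie between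
  them, are tiny compared with \<open>\<bar>y - z\<bar>\<close> (\<open>dist_mass_bounds\<close>). Hence a ratio \<open>\<bar>y - a\<bar> / \<bar>y - b\<bar>\<close> is
  increased by the factor \<open>1 / \<lambda>\<^sub>n\<close> only if \<open>B\<^sub>n\<close> separates \<open>y, b\<close> from \<open>a\<close>, and then the ratio is at least of the
  order of \<open>K\<^sub>n\<close>. So ratios at most \<open>T\<close> meet only finitely many factors, and the map is
  quasisymmetric on \<open>E\<close> for \<^emph>\<open>every\<close> choice of the \<open>\<lambda>\<^sub>n\<close> (\<open>stretch_quasisymmetric\<close>). Choosing
  \<open>\<lambda>\<^sub>n\<close> small enough violates the power growth that a quasisymmetric extension would have
  (\<open>quasisymmetric_power_growth\<close>).
\<close>

section \<open>Criteria for quasisymmetry\<close>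

text \<open>
  Averaging over \<open>[t, 2t]\<close> makes a monotone function continuous without spoiling monotonicity or the
  limit 0 at 0, and can only increase it; adding the identity makes it strictly increasing and
  unbounded.
\<close>

lemma homeomorphism_majorant:
  fixes g :: "real \<Rightarrow> real"
  assumes mono: "\<And>s t. 0 \<le> s \<Longrightarrow> s \<le> t \<Longrightarrow> g s \<le> g t"
    and nonneg: "\<And>t. 0 \<le> t \<Longrightarrow> 0 \<le> g t"
    and small: "\<And>e. e > 0 \<Longrightarrow> \<exists>d>0. g d \<le> e"
  shows "\<exists>\<eta> \<theta>. homeomorphism {0..} {0..} \<eta> \<theta> \<and> (\<forall>t\<ge>0. g t \<le> \<eta> t)"
proof -
  define K where "K = (\<lambda>t. integral {1..2} (\<lambda>s. g (t * s)))"
  define \<eta> where "\<eta> = (\<lambda>t. t + K t)"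
  have int: "(\<lambda>s. g (t * s)) integrable_on {1..2}" if "t \<ge> 0" for t
    by (rule integrable_on_mono_on) (auto simp: mono_on_def intro!: mono mult_left_mono that mult_nonneg_nonneg)
  have K_mono: "K s \<le> K t" if "0 \<le> s" "s \<le> t" for s t
    unfolding K_def using that by (intro integral_le int) (auto intro!: mono mult_right_mono)
  have K_ge: "g t \<le> K t" if "0 \<le> t" for t
  proof -
    have "integral {1..2::real} (\<lambda>_. g t) \<le> K t"
      unfolding K_def using that
      by (intro integral_le int) (auto intro!: mono simp: mult_le_cancel_left1)
    then show ?thesis by simp
  qed
  have K_le: "K t \<le> g (2 * t)" if "0 \<le> t" for t
  proof -
    have "K t \<le> integral {1..2::real} (\<lambda>_. g (2 * t))"
      unfolding K_def using that
      by (intro integral_le int) (auto intro!: mono mult_left_mono simp: mult.commute[of 2])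
    then show ?thesis by simp
  qed
  have g0: "g 0 = 0"
  proof -
    have "g 0 \<le> e" if "e > 0" for e
      using small[OF that] mono[of 0] by (meson dual_order.trans less_imp_le order_refl)
    then show ?thesis using nonneg[of 0] by (meson dual_order.antisym field_le_epsilon order_refl le_cases not_le dense_ge)
  qed
  have K0: "K 0 = 0" by (simp add: K_def g0)
  have K_nonneg: "0 \<le> K t" if "0 \<le> t" for t using K_ge nonneg that by (meson order_trans)
  have gint: "g integrable_on {0..b}" for b
    by (rule integrable_on_mono_on) (auto simp: mono_on_def intro!: mono)
  \<comment> \<open>After the substitution the average is visibly a continuous function of the endpoints.\<close>
  have K_eq: "K t = (integral {0..2*t} g - integral {0..t} g) / t" if "t > 0" for t
  proof -
    have "g integrable_on {t..2*t}"
      by (rule integrable_on_subinterval[OF gint[of "2*t"]]) (use that in auto)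
    then have "(g has_integral integral {t..2*t} g) (cbox t (2*t))" by auto
    from has_integral_affinity'[OF this that, of 0]
    have "((\<lambda>x. g (t * x)) has_integral integral {t..2*t} g / t) {1..2}"
      using that by (simp add: divide_simps)
    then have "K t = integral {t..2*t} g / t" unfolding K_def by (rule integral_unique)
    moreover have "integral {0..t} g + integral {t..2*t} g = integral {0..2*t} g"
      by (rule Henstock_Kurzweil_Integration.integral_combine) (use that gint in auto)
    ultimately show ?thesis by (simp add: algebra_simps)
  qed
  have "isCont K t" if "t > 0" for t :: real
  proof -
    let ?G = "\<lambda>t. integral {0..t} g"
    have G: "isCont ?G u" if "u > 0" for u
    proof -
      have "continuous_on {0..u+1} ?G" by (rule indefinite_integral_continuous_1[OF gint])
      then have "continuous_on {0<..<u+1} ?G" by (rule continuous_on_subset) auto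
      then show ?thesis using that by (simp add: continuous_on_eq_continuous_at)
    qed
    have "isCont (\<lambda>t. (?G (2*t) - ?G t) / t) t"
      using that by (intro continuous_intros isCont_o2[where g="?G" and f="\<lambda>t. 2*t"] G) auto
    moreover have "eventually (\<lambda>s. K s = (?G (2 * s) - ?G s) / s) (nhds t)"
      using eventually_nhds_in_open[of "{0<..}" t] that
      by (auto elim!: eventually_mono intro: K_eq)
    ultimately show ?thesis by (simp add: isCont_cong)
  qed
  moreover have "continuous (at 0 within {0..}) K"
    unfolding continuous_within_eps_delta
  proof (intro allI impI)
    fix e :: real assume "e > 0"
    then obtain d where d: "d > 0" "g d \<le> e / 2" using small[of "e/2"] by auto
    show "\<exists>d>0. \<forall>x'\<in>{0..}. dist x' 0 < d \<longrightarrow> dist (K x') (K 0) < e"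
    proof (intro exI[of _ "d/2"] conjI ballI impI)
      fix t :: real assume t: "t \<in> {0..}" "dist t 0 < d / 2"
      then have "K t \<le> g d" using K_le[of t] mono[of "2*t" d] by (auto simp: dist_real_def)
      with d \<open>e > 0\<close> K_nonneg[of t] t show "dist (K t) (K 0) < e" by (auto simp: dist_real_def K0)
    qed (use d in auto)
  qed
  ultimately have "continuous_on {0..} K"
    unfolding continuous_on_eq_continuous_within
    by (metis atLeast_iff continuous_at_imp_continuous_at_within less_eq_real_def)
  then have cont: "continuous_on {0..} \<eta>" unfolding \<eta>_def by (intro continuous_intros)
  have smono: "\<eta> s < \<eta> t" if "0 \<le> s" "s < t" for s t
    using that K_mono[of s t] by (auto simp: \<eta>_def)
  have inj: "inj_on \<eta> {0..}"
    by (rule linorder_inj_onI) (use smono in \<open>auto simp: less_imp_neq\<close>)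
  have "t \<in> \<eta> ` {0..}" if "t \<ge> 0" for t
  proof -
    have "\<exists>x\<ge>0. x \<le> t \<and> \<eta> x = t"
      by (rule IVT') (use that K0 K_nonneg continuous_on_subset[OF cont] in \<open>auto simp: \<eta>_def\<close>)
    then show ?thesis by auto
  qed
  then have im: "\<eta> ` {0..} = {0..}" by (auto simp: \<eta>_def K_nonneg)
  have "\<exists>\<theta>. homeomorphism {0..} {0..} \<eta> \<theta>"
    by (rule homeomorphism_into_1d[OF _ cont im inj]) (simp add: convex_imp_path_connected)
  moreover have "g t \<le> \<eta> t" if "t \<ge> 0" for t using K_ge[OF that] that by (simp add: \<eta>_def)
  ultimately show ?thesis by blast
qed

text \<open>
  The control function may be replaced by two soft conditions: the distortion of bounded ratios is
  bounded, and small ratios stay small. The optimal control function is then finite, monotone and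
  tends to 0 at 0, so it has a homeomorphic majorant.
\<close>

lemma quasisymmetric_onI:
  fixes f :: "'a::metric_space \<Rightarrow> 'b::metric_space"
  assumes hom: "homeomorphism E (f ` E) f h"
    and bounded: "\<And>T. T > 0 \<Longrightarrow> \<exists>B. \<forall>x\<in>E. \<forall>a\<in>E. \<forall>b\<in>E. x \<noteq> b \<longrightarrow> dist x a \<le> T * dist x b
                    \<longrightarrow> dist (f x) (f a) \<le> B * dist (f x) (f b)"
    and small: "\<And>e. e > 0 \<Longrightarrow> \<exists>d>0. \<forall>x\<in>E. \<forall>a\<in>E. \<forall>b\<in>E. x \<noteq> b \<longrightarrow> dist x a \<le> d * dist x b
                    \<longrightarrow> dist (f x) (f a) \<le> e * dist (f x) (f b)"
  shows "quasisymmetric_on E f"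
proof -
  define R where "R = (\<lambda>t. insert 0 {dist (f x) (f a) / dist (f x) (f b) | x a b.
      x \<in> E \<and> a \<in> E \<and> b \<in> E \<and> x \<noteq> b \<and> dist x a \<le> t * dist x b})"
  define g where "g = (\<lambda>t. Sup (R t))"
  have pos: "dist (f x) (f b) > 0" if "x \<in> E" "b \<in> E" "x \<noteq> b" for x b
    using that hom by (metis homeomorphism_apply1 zero_less_dist_iff)
  have mono_R: "R s \<subseteq> R t" if "s \<le> t" for s t
    unfolding R_def using that by (auto, metis mult_right_mono order_trans zero_le_dist)
  have bdd: "bdd_above (R t)" for t
  proof -
    obtain B where B: "\<forall>x\<in>E. \<forall>a\<in>E. \<forall>b\<in>E. x \<noteq> b \<longrightarrow> dist x a \<le> max t 1 * dist x b
                    \<longrightarrow> dist (f x) (f a) \<le> B * dist (f x) (f b)"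
      using bounded[of "max t 1"] by (auto simp: less_max_iff_disj)
    have "bdd_above (R (max t 1))"
    proof (rule bdd_aboveI[of _ "max 0 B"])
      fix v assume "v \<in> R (max t 1)"
      then consider "v = 0" | x a b where "x \<in> E" "a \<in> E" "b \<in> E" "x \<noteq> b"
        "dist x a \<le> max t 1 * dist x b" "v = dist (f x) (f a) / dist (f x) (f b)"
        unfolding R_def by blast
      then show "v \<le> max 0 B"
      proof cases
        case 2
        then have "v \<le> B" using B pos[OF 2(1,3,4)] by (simp add: pos_divide_le_eq)
        then show ?thesis by simp
      qed simp
    qed
    then show ?thesis using mono_R[of t "max t 1"] by (meson bdd_above_mono max.cobounded1)
  qed
  have g_nonneg: "0 \<le> g t" for t
    unfolding g_def by (rule cSup_upper[OF _ bdd]) (simp add: R_def)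
  have g_mono: "g s \<le> g t" if "s \<le> t" for s t
    unfolding g_def by (rule cSup_subset_mono[OF _ bdd mono_R[OF that]]) (simp add: R_def)
  have g_small: "\<exists>d>0. g d \<le> e" if e: "e > 0" for e
  proof -
    obtain d where d: "d > 0" "\<forall>x\<in>E. \<forall>a\<in>E. \<forall>b\<in>E. x \<noteq> b \<longrightarrow> dist x a \<le> d * dist x b
                    \<longrightarrow> dist (f x) (f a) \<le> e * dist (f x) (f b)"
      using small[OF e] by auto
    have "g d \<le> e" unfolding g_def
    proof (rule cSup_least)
      fix v assume "v \<in> R d"
      then consider "v = 0" | x a b where "x \<in> E" "a \<in> E" "b \<in> E" "x \<noteq> b"
        "dist x a \<le> d * dist x b" "v = dist (f x) (f a) / dist (f x) (f b)"
        unfolding R_def by blast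
      then show "v \<le> e"
      proof cases
        case 2
        then show ?thesis using d(2) pos[OF 2(1,3,4)] by (simp add: pos_divide_le_eq)
      qed (use e in simp)
    qed (simp add: R_def)
    then show ?thesis using d by auto
  qed
  obtain \<eta> \<theta> where \<eta>: "homeomorphism {0..} {0..} \<eta> \<theta>" "\<forall>t\<ge>0. g t \<le> \<eta> t"
    using homeomorphism_majorant[of g] g_nonneg g_mono g_small by metis
  have "dist (f x) (f a) / dist (f x) (f b) \<le> \<eta> (dist x a / dist x b)"
    if "x \<in> E" "a \<in> E" "b \<in> E" "x \<noteq> b" for x a b
  proof -
    have "dist (f x) (f a) / dist (f x) (f b) \<le> g (dist x a / dist x b)"
      unfolding g_def
    proof (rule cSup_upper[OF _ bdd])
      have "dist x a \<le> dist x a / dist x b * dist x b" using that by simp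
      then show "dist (f x) (f a) / dist (f x) (f b) \<in> R (dist x a / dist x b)"
        unfolding R_def using that by blast
    qed
    then show ?thesis using \<eta>(2) by (meson order_trans zero_le_divide_iff zero_le_dist)
  qed
  then show ?thesis unfolding quasisymmetric_on_def using hom \<eta>(1) by blast
qed

text \<open>
  A zero \<open>c > 0\<close> of a nonnegative function is an interior minimum, which an injective continuous
  function does not have.
\<close>

lemma homeomorphism_atLeast_0_at_0:
  fixes \<eta> :: "real \<Rightarrow> real"
  assumes "homeomorphism {0..} {0..} \<eta> \<theta>"
  shows "\<eta> 0 = 0"
proof (rule ccontr)
  assume ne: "\<eta> 0 \<noteq> 0"
  from assms have cont: "continuous_on {0..} \<eta>" and im: "\<eta> ` {0..} = {0..}"
    and inj: "inj_on \<eta> {0..}"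
    by (auto simp: homeomorphism_def intro: inj_on_inverseI)
  obtain c where c: "c \<ge> 0" "\<eta> c = 0" using im by (metis atLeast_iff imageE order_refl)
  with ne have "0 < c" by (metis less_eq_real_def)
  have "(\<eta> 0 < \<eta> c \<and> \<eta> c < \<eta> (c + 1)) \<or> (\<eta> (c + 1) < \<eta> c \<and> \<eta> c < \<eta> 0)"
    by (rule continuous_inj_imp_mono)
       (use \<open>0 < c\<close> in \<open>auto intro: continuous_on_subset[OF cont] inj_on_subset[OF inj]\<close>)
  moreover have "\<eta> 0 \<ge> 0" "\<eta> (c + 1) \<ge> 0" using im c by force+
  ultimately show False using c by auto
qed

lemma quasisymmetric_on_injective:
  assumes "quasisymmetric_on E f" "x \<in> E" "y \<in> E" "x \<noteq> y"
  shows "dist (f x) (f y) > 0"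
  using assms unfolding quasisymmetric_on_def by (metis homeomorphism_apply1 zero_less_dist_iff)

lemma quasisymmetric_on_bounded_ratio:
  assumes qs: "quasisymmetric_on E f"
  obtains B where "B \<ge> 1"
    and "\<And>x a b. x \<in> E \<Longrightarrow> a \<in> E \<Longrightarrow> b \<in> E \<Longrightarrow> x \<noteq> b \<Longrightarrow> dist x a \<le> T * dist x b
                    \<Longrightarrow> dist (f x) (f a) \<le> B * dist (f x) (f b)"
proof -
  obtain \<eta> \<theta> where \<eta>: "homeomorphism {0..} {0..} \<eta> \<theta>"
    "\<And>x a b. x \<in> E \<Longrightarrow> a \<in> E \<Longrightarrow> b \<in> E \<Longrightarrow> x \<noteq> b \<Longrightarrow>
      dist (f x) (f a) / dist (f x) (f b) \<le> \<eta> (dist x a / dist x b)"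
    using qs unfolding quasisymmetric_on_def by metis
  have "compact (\<eta> ` {0..max T 0})"
    by (intro compact_continuous_image continuous_on_subset[OF homeomorphism_cont1[OF \<eta>(1)]]) auto
  then obtain B where B: "\<And>t. 0 \<le> t \<Longrightarrow> t \<le> max T 0 \<Longrightarrow> \<eta> t \<le> B"
    by (metis atLeastAtMost_iff bounded_imp_bdd_above bdd_above.unfold compact_imp_bounded imageI)
  show ?thesis
  proof (rule that[of "max 1 B"])
    fix x a b assume *: "x \<in> E" "a \<in> E" "b \<in> E" "x \<noteq> b" "dist x a \<le> T * dist x b"
    have "dist x a \<le> max T 0 * dist x b"
      using *(5) mult_right_mono[of T "max T 0" "dist x b"]
      by (metis max.cobounded1 order_trans zero_le_dist)
    with * have le: "dist x a / dist x b \<le> max T 0" by (simp add: pos_divide_le_eq)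
    have "dist (f x) (f a) / dist (f x) (f b) \<le> \<eta> (dist x a / dist x b)" by (intro \<eta> *)
    also have "\<dots> \<le> B" using le by (intro B) auto
    also have "\<dots> \<le> max 1 B" by simp
    finally show "dist (f x) (f a) \<le> max 1 B * dist (f x) (f b)"
      using quasisymmetric_on_injective[OF qs *(1,3,4)] by (simp add: divide_simps)
  qed simp
qed

lemma quasisymmetric_on_small_ratio:
  assumes qs: "quasisymmetric_on E f" and "e > 0"
  obtains d where "d > 0"
    and "\<And>x a b. x \<in> E \<Longrightarrow> a \<in> E \<Longrightarrow> b \<in> E \<Longrightarrow> x \<noteq> b \<Longrightarrow> dist x a \<le> d * dist x b
                    \<Longrightarrow> dist (f x) (f a) \<le> e * dist (f x) (f b)"
proof -
  obtain \<eta> \<theta> where \<eta>: "homeomorphism {0..} {0..} \<eta> \<theta>"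
    "\<And>x a b. x \<in> E \<Longrightarrow> a \<in> E \<Longrightarrow> b \<in> E \<Longrightarrow> x \<noteq> b \<Longrightarrow>
      dist (f x) (f a) / dist (f x) (f b) \<le> \<eta> (dist x a / dist x b)"
    using qs unfolding quasisymmetric_on_def by metis
  have "continuous (at 0 within {0..}) \<eta>"
    using homeomorphism_cont1[OF \<eta>(1)] by (simp add: continuous_on_eq_continuous_within)
  then obtain d where d: "d > 0" "\<And>t. t \<ge> 0 \<Longrightarrow> t < d \<Longrightarrow> \<bar>\<eta> t\<bar> < e"
    using \<open>e > 0\<close> homeomorphism_atLeast_0_at_0[OF \<eta>(1)]
    unfolding continuous_within_eps_delta by (auto simp: dist_real_def)
  show ?thesis
  proof (rule that[of "d/2"])
    fix x a b assume *: "x \<in> E" "a \<in> E" "b \<in> E" "x \<noteq> b" "dist x a \<le> d/2 * dist x b"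
    have "0 < d * dist x b" using * d(1) by simp
    then have "dist x a < d * dist x b" using *(5) by linarith
    then have "dist x a / dist x b < d" using * by (simp add: pos_divide_less_eq)
    then have "\<eta> (dist x a / dist x b) \<le> e" using d(2)[of "dist x a / dist x b"] by auto
    with \<eta>(2)[OF *(1-4)] have "dist (f x) (f a) / dist (f x) (f b) \<le> e" by simp
    then show "dist (f x) (f a) \<le> e * dist (f x) (f b)"
      using quasisymmetric_on_injective[OF qs *(1,3,4)] by (simp add: divide_simps)
  qed (use d in auto)
qed

text \<open>
  The criterion of Beurling and Ahlfors. Doubling the distance from \<open>x\<close> multiplies the increment of
  \<open>F\<close> at least by \<open>q = 1 + 1 / C > 1\<close> and at most by \<open>1 + C\<close>, and iteration gives the bounds for
  small and for bounded ratios. The same geometric growth makes \<open>F\<close> continuous and surjective.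
\<close>

lemma quasisymmetric_if_symmetric_triples:
  fixes F :: "real \<Rightarrow> real"
  assumes mono: "strict_mono F"
    and triples: "\<And>x h. \<bar>F (x + h) - F x\<bar> \<le> C * \<bar>F x - F (x - h)\<bar>"
  shows "(\<exists>G. homeomorphism UNIV UNIV F G) \<and> quasisymmetric_on UNIV F"
proof -
  have ne: "F x \<noteq> F y" if "x \<noteq> y" for x y using mono that by (metis strict_mono_eq)
  have sgn: "\<bar>F (x + u) - F x\<bar> \<le> \<bar>F (x + v) - F x\<bar>" if "0 \<le> u \<and> u \<le> v \<or> v \<le> u \<and> u \<le> 0" for x u v
    using that strict_mono_leD[OF mono, of x "x+u"] strict_mono_leD[OF mono, of "x+u" "x+v"]
      strict_mono_leD[OF mono, of "x+u" "x"] strict_mono_leD[OF mono, of "x+v" "x+u"] by auto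
  have C: "C \<ge> 1"
  proof -
    define p q where "p = F 1 - F 0" and "q = F 0 - F (-1)"
    have "p > 0" "q > 0" unfolding p_def q_def using mono by (auto simp: strict_mono_less)
    have "p \<le> C * q" "q \<le> C * p"
      using triples[of 0 1] triples[of 0 "-1"] \<open>p > 0\<close> \<open>q > 0\<close> by (auto simp: p_def q_def)
    then show ?thesis
    proof (cases "p \<le> q")
      case True
      with \<open>q \<le> C * p\<close> have "p \<le> C * p" by linarith
      then show ?thesis using \<open>p > 0\<close> by simp
    next
      case False
      with \<open>p \<le> C * q\<close> have "q \<le> C * q" by linarith
      then show ?thesis using \<open>q > 0\<close> by simp
    qed
  qed
  have near: "\<bar>F (x + u) - F x\<bar> \<le> C * \<bar>F (x + v) - F x\<bar>" if "\<bar>u\<bar> \<le> \<bar>v\<bar>" for x u v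
  proof (cases "u * v \<ge> 0")
    case True
    then have "\<bar>F (x + u) - F x\<bar> \<le> \<bar>F (x + v) - F x\<bar>"
      using that by (intro sgn) (auto simp: zero_le_mult_iff)
    also have "\<dots> \<le> C * \<bar>F (x + v) - F x\<bar>" using C by (simp add: mult_le_cancel_right1)
    finally show ?thesis .
  next
    case False
    then have "\<bar>F (x + u) - F x\<bar> \<le> \<bar>F (x + - v) - F x\<bar>"
      using that by (intro sgn) (auto simp: mult_less_0_iff not_le)
    also have "\<dots> \<le> C * \<bar>F (x + v) - F x\<bar>" using triples[of x "- v"] by (simp add: abs_minus_commute)
    finally show ?thesis .
  qed
  have add: "\<bar>F (x + 2 * h) - F x\<bar> = \<bar>F (x + 2 * h) - F (x + h)\<bar> + \<bar>F (x + h) - F x\<bar>" for x h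
    using strict_mono_less_eq[OF mono, of "x + 2 * h" "x + h"] strict_mono_less_eq[OF mono, of "x + h" x]
      strict_mono_less_eq[OF mono, of "x + h" "x + 2 * h"] strict_mono_less_eq[OF mono, of x "x + h"]
    by (cases "h \<ge> 0") auto
  define q where "q = 1 + 1 / C"
  have q: "q > 1" using C by (simp add: q_def)
  have grow: "q * \<bar>F (x + h) - F x\<bar> \<le> \<bar>F (x + 2 * h) - F x\<bar>" for x h
  proof -
    have "\<bar>F (x + h) - F x\<bar> \<le> C * \<bar>F (x + 2 * h) - F (x + h)\<bar>"
      using triples[of "x + h" "- h"] by (simp add: algebra_simps abs_minus_commute)
    then show ?thesis using C add[of x h] by (simp add: q_def field_simps)
  qed
  have upper: "\<bar>F (x + 2 * h) - F x\<bar> \<le> (1 + C) * \<bar>F (x + h) - F x\<bar>" for x h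
    using triples[of "x + h" "h"] add[of x h] by (simp add: algebra_simps)
  have grow_pow: "q ^ n * \<bar>F (x + h) - F x\<bar> \<le> \<bar>F (x + 2 ^ n * h) - F x\<bar>" for n x h
  proof (induction n)
    case (Suc n)
    have "q ^ Suc n * \<bar>F (x + h) - F x\<bar> \<le> q * \<bar>F (x + 2 ^ n * h) - F x\<bar>"
      using mult_left_mono[OF Suc.IH, of q] q by (simp add: mult_ac)
    also have "\<dots> \<le> \<bar>F (x + 2 ^ Suc n * h) - F x\<bar>" using grow[of x "2 ^ n * h"] by (simp add: mult_ac)
    finally show ?case .
  qed simp
  have upper_pow: "\<bar>F (x + 2 ^ n * h) - F x\<bar> \<le> (1 + C) ^ n * \<bar>F (x + h) - F x\<bar>" for n x h
  proof (induction n)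
    case (Suc n)
    have "\<bar>F (x + 2 ^ Suc n * h) - F x\<bar> \<le> (1 + C) * \<bar>F (x + 2 ^ n * h) - F x\<bar>"
      using upper[of x "2 ^ n * h"] by (simp add: mult_ac)
    also have "\<dots> \<le> (1 + C) ^ Suc n * \<bar>F (x + h) - F x\<bar>"
      using mult_left_mono[OF Suc.IH, of "1 + C"] C by (simp add: mult_ac)
    finally show ?case .
  qed simp
  have small: "\<bar>F (x + u) - F x\<bar> \<le> C / q ^ n * \<bar>F (x + v) - F x\<bar>" if "2 ^ n * \<bar>u\<bar> \<le> \<bar>v\<bar>" for n x u v
  proof -
    have "q ^ n * \<bar>F (x + u) - F x\<bar> \<le> C * \<bar>F (x + v) - F x\<bar>"
      using grow_pow[of n x u] near[of "2 ^ n * u" v x] that by (simp add: abs_mult)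
    then show ?thesis using q by (simp add: field_simps)
  qed
  have small_const: "\<exists>n. C / q ^ n * M \<le> e" if "e > 0" "M \<ge> 0" for M e
  proof -
    obtain n where "C * M / e < q ^ n" using real_arch_pow[OF q] by blast
    then show ?thesis using that q by (intro exI[of _ n]) (simp add: field_simps)
  qed
  have "isCont F x" for x
    unfolding continuous_at_eps_delta
  proof (intro allI impI)
    fix e :: real assume "e > 0"
    then obtain n where n: "C / q ^ n * \<bar>F (x + 1) - F x\<bar> \<le> e / 2"
      using small_const[of "e/2" "\<bar>F (x + 1) - F x\<bar>"] by auto
    show "\<exists>d>0. \<forall>y. dist y x < d \<longrightarrow> dist (F y) (F x) < e"
    proof (intro exI[of _ "1 / 2 ^ n"] conjI allI impI)
      fix y assume "dist y x < 1 / 2 ^ n"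
      then have "2 ^ n * \<bar>y - x\<bar> \<le> \<bar>1\<bar>" by (simp add: dist_real_def field_simps)
      from small[OF this, of x] have "\<bar>F (x + (y - x)) - F x\<bar> \<le> e / 2" using n by (rule order_trans)
      then have "\<bar>F y - F x\<bar> \<le> e / 2" by simp
      then show "dist (F y) (F x) < e" using \<open>e > 0\<close> unfolding dist_real_def by linarith
    qed simp
  qed
  then have cont: "continuous_on UNIV F" by (simp add: continuous_on_eq_continuous_at)
  have "surj F"
  proof -
    have "\<exists>x. F x = y" for y
    proof -
      define m where "m = min \<bar>F 1 - F 0\<bar> \<bar>F (-1) - F 0\<bar>"
      have "m > 0" using ne[of 1 0] ne[of "-1" 0] by (simp add: m_def)
      obtain n where "\<bar>y - F 0\<bar> / m < q ^ n" using real_arch_pow[OF q] by blast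
      then have n: "\<bar>y - F 0\<bar> \<le> q ^ n * m" using \<open>m > 0\<close> by (simp add: field_simps)
      also have "\<dots> \<le> q ^ n * \<bar>F 1 - F 0\<bar>" using q by (simp add: m_def)
      also have "\<dots> \<le> \<bar>F (2 ^ n) - F 0\<bar>" using grow_pow[of n 0 1] by simp
      also have "\<dots> = F (2 ^ n) - F 0" using strict_mono_less[OF mono, of 0 "2 ^ n"] by simp
      finally have 1: "y \<le> F (2 ^ n)" by simp
      note n
      also have "q ^ n * m \<le> q ^ n * \<bar>F (-1) - F 0\<bar>" using q by (simp add: m_def)
      also have "\<dots> \<le> \<bar>F (- (2 ^ n)) - F 0\<bar>" using grow_pow[of n 0 "-1"] by simp
      also have "\<dots> = F 0 - F (- (2 ^ n))" using strict_mono_less[OF mono, of "- (2 ^ n)" 0] by simp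
      finally have 2: "F (- (2 ^ n)) \<le> y" by simp
      have "\<exists>x. - (2 ^ n) \<le> x \<and> x \<le> 2 ^ n \<and> F x = y"
        by (rule IVT') (use 1 2 continuous_on_subset[OF cont] in \<open>auto intro: order_trans[of _ 0]\<close>)
      then show ?thesis by blast
    qed
    then show ?thesis by (metis surjI)
  qed
  then obtain G where G: "homeomorphism UNIV UNIV F G"
    using homeomorphism_into_1d[OF _ cont, of UNIV] mono
    by (metis path_connected_UNIV strict_mono_imp_inj_on)
  have "quasisymmetric_on UNIV F"
  proof (rule quasisymmetric_onI[of UNIV F G])
    show "homeomorphism UNIV (range F) F G" using G \<open>surj F\<close> by simp
  next
    fix T :: real
    obtain n where n: "T < 2 ^ n" using real_arch_pow[of 2 T] by auto
    show "\<exists>B. \<forall>x\<in>UNIV. \<forall>a\<in>UNIV. \<forall>b\<in>UNIV. x \<noteq> b \<longrightarrow> dist x a \<le> T * dist x b \<longrightarrow>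
        dist (F x) (F a) \<le> B * dist (F x) (F b)"
    proof (intro exI[of _ "C * (1 + C) ^ n"] ballI impI)
      fix x a b :: real assume *: "x \<noteq> b" "dist x a \<le> T * dist x b"
      have "\<bar>a - x\<bar> \<le> \<bar>2 ^ n * (b - x)\<bar>"
        using *(2) n mult_right_mono[of T "2 ^ n" "\<bar>b - x\<bar>"]
        by (simp add: dist_real_def abs_mult abs_minus_commute)
      from near[OF this, of x] have "\<bar>F a - F x\<bar> \<le> C * \<bar>F (x + 2 ^ n * (b - x)) - F x\<bar>" by simp
      also have "\<dots> \<le> C * ((1 + C) ^ n * \<bar>F b - F x\<bar>)"
        using upper_pow[of x n "b - x"] C by (intro mult_left_mono) auto
      finally show "dist (F x) (F a) \<le> C * (1 + C) ^ n * dist (F x) (F b)"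
        by (simp add: dist_real_def abs_minus_commute mult_ac)
    qed
  next
    fix e :: real assume "e > 0"
    then obtain n where n: "C / q ^ n \<le> e" using small_const[of e 1] by auto
    show "\<exists>d>0. \<forall>x\<in>UNIV. \<forall>a\<in>UNIV. \<forall>b\<in>UNIV. x \<noteq> b \<longrightarrow> dist x a \<le> d * dist x b \<longrightarrow>
        dist (F x) (F a) \<le> e * dist (F x) (F b)"
    proof (intro exI[of _ "1 / 2 ^ n"] conjI ballI impI)
      fix x a b :: real assume *: "x \<noteq> b" "dist x a \<le> 1 / 2 ^ n * dist x b"
      then have "2 ^ n * \<bar>a - x\<bar> \<le> \<bar>b - x\<bar>" by (simp add: dist_real_def field_simps abs_minus_commute)
      from small[OF this, of x]
      have "\<bar>F a - F x\<bar> \<le> C / q ^ n * \<bar>F b - F x\<bar>" by simp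
      also have "\<dots> \<le> e * \<bar>F b - F x\<bar>" by (rule mult_right_mono[OF n]) simp
      finally show "dist (F x) (F a) \<le> e * dist (F x) (F b)"
        by (simp add: dist_real_def abs_minus_commute)
    qed simp
  qed
  with G show ?thesis by blast
qed

section \<open>Power distortion on relatively connected sets\<close>

lemma obtain_power_bracket:
  fixes q u :: real
  assumes "q > 1" "u \<ge> 1"
  obtains n where "q ^ n \<le> u" "u < q ^ Suc n"
proof -
  obtain m where m: "u < q ^ m" using real_arch_pow[OF assms(1)] by blast
  define k where "k = (LEAST m. u < q ^ m)"
  have k: "u < q ^ k" unfolding k_def using m by (rule LeastI)
  then have "k \<noteq> 0" using assms by (intro notI) auto
  then obtain n where n: "k = Suc n" by (cases k) auto
  have "\<not> u < q ^ n" using not_less_Least[of n "\<lambda>m. u < q ^ m"] n by (simp add: k_def)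
  then show ?thesis using k n by (intro that[of n]) auto
qed

text \<open>
  For a large ratio \<open>\<bar>x - y\<bar> / \<bar>x - z\<bar>\<close> relative connectedness supplies a chain from \<open>z\<close> outwards
  whose distances from \<open>x\<close> at least double and grow at most by \<open>2 M\<close>; each step costs a factor
  \<open>H\<close>, and the number of steps is logarithmic in the ratio. For a small ratio the chain runs from
  \<open>y\<close> outwards with steps so large that each one halves the distance of the images.
\<close>

lemma relatively_connected_power_quasisymmetric:
  fixes f :: "'a::metric_space \<Rightarrow> 'b::metric_space"
  assumes rc: "relatively_connected E" and qs: "quasisymmetric_on E f"
  obtains a :: real and b :: nat and C :: real where "0 < a" "a \<le> 1" "1 \<le> b" "1 \<le> C"
    "\<And>x y z. x \<in> E \<Longrightarrow> y \<in> E \<Longrightarrow> z \<in> E \<Longrightarrow> x \<noteq> z \<Longrightarrow>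
       dist (f x) (f y) \<le> C * dist (f x) (f z) * max ((dist x y / dist x z) powr a) ((dist x y / dist x z) ^ b)"
proof -
  obtain M where M: "M > 1" and rcM: "\<And>x r. x \<in> E \<Longrightarrow> r > 0 \<Longrightarrow> cball x r \<inter> E \<noteq> E \<Longrightarrow>
        cball x r \<inter> E = {x} \<or> (cball x r \<inter> E) - (ball x (r / M) \<inter> E) \<noteq> {}"
    using rc unfolding relatively_connected_def M_relatively_connected_def by blast
  have step: "\<exists>w\<in>E. r / M \<le> dist x w \<and> dist x w \<le> r"
    if "x \<in> E" "y \<in> E" "z \<in> E" "x \<noteq> z" "dist x z \<le> r" "r < dist x y" for x y z r
  proof -
    have "r > 0" using that by (meson less_le_trans zero_less_dist_iff)
    have "cball x r \<inter> E \<noteq> E" using that(2,6) by (metis Int_iff mem_cball not_less)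
    moreover have "cball x r \<inter> E \<noteq> {x}" using that(3,4,5) by auto
    ultimately have "(cball x r \<inter> E) - (ball x (r / M) \<inter> E) \<noteq> {}"
      using rcM[OF that(1) \<open>r > 0\<close>] by blast
    then obtain w where "w \<in> cball x r \<inter> E" "w \<notin> ball x (r / M) \<inter> E" by blast
    then show ?thesis by (intro bexI[of _ w]) auto
  qed
  obtain H where H: "H \<ge> 1" "\<And>x a b. x \<in> E \<Longrightarrow> a \<in> E \<Longrightarrow> b \<in> E \<Longrightarrow> x \<noteq> b \<Longrightarrow>
      dist x a \<le> (2 * M) * dist x b \<Longrightarrow> dist (f x) (f a) \<le> H * dist (f x) (f b)"
    using quasisymmetric_on_bounded_ratio[OF qs, of "2 * M"] by blast
  obtain d where d: "d > 0" "\<And>x a b. x \<in> E \<Longrightarrow> a \<in> E \<Longrightarrow> b \<in> E \<Longrightarrow> x \<noteq> b \<Longrightarrow>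
      dist x a \<le> d * dist x b \<Longrightarrow> dist (f x) (f a) \<le> 1/2 * dist (f x) (f b)"
    using quasisymmetric_on_small_ratio[OF qs, of "1/2"] by auto
  \<comment> \<open>The chain is built by induction, replacing \<open>z\<close> by a point of \<open>E\<close> at least twice as far from \<open>x\<close>.\<close>
  have big: "dist (f x) (f y) \<le> H ^ Suc n * dist (f x) (f z)"
    if "x \<in> E" "y \<in> E" "z \<in> E" "x \<noteq> z" "dist x y \<le> 2 ^ n * dist x z" for x y z n
    using that
  proof (induction n arbitrary: z)
    case 0
    have "1 * dist x z \<le> 2 * M * dist x z" using M by (intro mult_right_mono) auto
    moreover have "dist x y \<le> 1 * dist x z" using 0 by simp
    ultimately have "dist x y \<le> 2 * M * dist x z" by (rule order_trans[rotated])
    then show ?case using 0 H(2)[of x y z] by simp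
  next
    case (Suc n)
    show ?case
    proof (cases "dist x y \<le> 2 * M * dist x z")
      case True
      have "H \<le> H ^ Suc (Suc n)" using H(1) by (intro self_le_power) auto
      then have "H * dist (f x) (f z) \<le> H ^ Suc (Suc n) * dist (f x) (f z)" by (intro mult_right_mono) auto
      then show ?thesis using H(2)[of x y z] Suc.prems True by linarith
    next
      case False
      have "1 * dist x z \<le> 2 * M * dist x z" using M by (intro mult_right_mono) auto
      then have le: "dist x z \<le> 2 * M * dist x z" by simp
      obtain w where w: "w \<in> E" "2 * M * dist x z / M \<le> dist x w" "dist x w \<le> 2 * M * dist x z"
        using step[of x y z "2 * M * dist x z"] Suc.prems False le by auto
      have w2: "2 * dist x z \<le> dist x w" using w(2) M by simp
      have "x \<noteq> w" using w2 zero_less_dist_iff[of x z] Suc.prems(4) by force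
      have "dist x y \<le> 2 ^ n * (2 * dist x z)" using Suc.prems(5) by simp
      also have "\<dots> \<le> 2 ^ n * dist x w" using w2 by simp
      finally have "dist (f x) (f y) \<le> H ^ Suc n * dist (f x) (f w)"
        using Suc w \<open>x \<noteq> w\<close> by blast
      also have "\<dots> \<le> H ^ Suc n * (H * dist (f x) (f z))"
        using H Suc.prems w by (intro mult_left_mono H(2)) auto
      finally show ?thesis by (simp add: mult_ac)
    qed
  qed
  \<comment> \<open>A point at distance at most \<open>L \<bar>x - y\<bar>\<close> and at least \<open>L \<bar>x - y\<bar> / M \<ge> \<bar>x - y\<bar> / d\<close> is a step that halves.\<close>
  define L where "L = max 2 (M / d)"
  have L: "L > 1" "L \<ge> M / d" by (auto simp: L_def)
  have small: "dist (f x) (f y) \<le> H * (1/2) ^ n * dist (f x) (f z)"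
    if "x \<in> E" "y \<in> E" "z \<in> E" "x \<noteq> z" "dist x y * L ^ n \<le> dist x z" for x y z n
    using that
  proof (induction n arbitrary: y)
    case 0
    have "1 * dist x z \<le> 2 * M * dist x z" using M by (intro mult_right_mono) auto
    moreover have "dist x y \<le> 1 * dist x z" using 0 by simp
    ultimately have "dist x y \<le> 2 * M * dist x z" by (rule order_trans[rotated])
    then show ?case using H(2)[of x y z] 0 by simp
  next
    case (Suc n)
    show ?case
    proof (cases "x = y")
      case True then show ?thesis using H(1) by simp
    next
      case False
      have dL: "M * dist x y \<le> d * (dist x y * L)"
        using mult_right_mono[OF L(2), of "dist x y"] d(1) by (simp add: field_simps)
      have le: "dist x y \<le> dist x y * L" using L(1) by (simp add: mult_le_cancel_left1)
      have "dist x y * L * 1 \<le> dist x y * L * L ^ n" using L(1) by (intro mult_left_mono) auto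
      then have le2: "dist x y * L \<le> dist x z" using Suc.prems(5) by (simp add: mult_ac)
      consider "dist x y * L = dist x z" | "dist x y * L < dist x z" using le2 by linarith
      then have "\<exists>w\<in>E. dist x y * L / M \<le> dist x w \<and> dist x w * L ^ n \<le> dist x z"
      proof cases
        case 1
        have "dist x y * L / M \<le> dist x y * L / 1" using M L(1) by (intro divide_left_mono) auto
        then have "dist x y * L / M \<le> dist x y * L" by simp
        moreover have "dist x z * L ^ n \<le> dist x z" using Suc.prems(5) unfolding 1[symmetric] by (simp add: mult_ac)
        ultimately show ?thesis using Suc.prems(3) 1 by auto
      next
        case 2
        then obtain w where w: "w \<in> E" "dist x y * L / M \<le> dist x w" "dist x w \<le> dist x y * L"
          using step[of x z y "dist x y * L"] Suc.prems False le by auto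
        have "dist x w * L ^ n \<le> dist x y * L * L ^ n" using w(3) L(1) by (intro mult_right_mono) auto
        then show ?thesis using w Suc.prems(5) by (auto simp: mult_ac)
      qed
      then obtain w where w: "w \<in> E" "dist x y * L / M \<le> dist x w" "dist x w * L ^ n \<le> dist x z" by blast
      have "dist x y * L \<le> M * dist x w" using w(2) M by (simp add: field_simps)
      then have "d * (dist x y * L) \<le> d * (M * dist x w)" using d(1) by simp
      with dL have "M * dist x y \<le> M * (d * dist x w)" by (simp add: mult_ac)
      then have yw: "dist x y \<le> d * dist x w" using M by simp
      then have "x \<noteq> w" using False by auto
      then have "dist (f x) (f y) \<le> 1/2 * dist (f x) (f w)" using d(2) Suc.prems w yw by blast
      also have "\<dots> \<le> 1/2 * (H * (1/2) ^ n * dist (f x) (f z))"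
        using Suc w by (intro mult_left_mono) auto
      finally show ?thesis by simp
    qed
  qed
  obtain b where b: "H < 2 ^ b" "1 \<le> b"
  proof -
    obtain b0 where "H < 2 ^ b0" using real_arch_pow[of 2 H] by auto
    also have "(2::real) ^ b0 \<le> 2 ^ Suc b0" by simp
    finally show ?thesis using that[of "Suc b0"] by simp
  qed
  define a where "a = min 1 (ln 2 / ln L)"
  have a: "0 < a" "a \<le> 1" using L(1) by (auto simp: a_def)
  have La: "L powr a \<le> 2"
  proof -
    have "L powr a \<le> L powr (ln 2 / ln L)" using L(1) by (intro powr_mono) (auto simp: a_def)
    also have "\<dots> = 2" using L(1) by (simp add: powr_def)
    finally show ?thesis .
  qed
  define C where "C = max (4 ^ b) (2 * H)"
  show ?thesis
  proof (rule that[of a b C])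
    show "1 \<le> C" by (simp add: C_def le_max_iff_disj)
    fix x y z assume *: "x \<in> E" "y \<in> E" "z \<in> E" "x \<noteq> z"
    define u where "u = dist x y / dist x z"
    have dz: "dist x z > 0" using * by simp
    have xy: "dist x y = u * dist x z" using dz by (simp add: u_def)
    have "dist (f x) (f y) \<le> C * max (u powr a) (u ^ b) * dist (f x) (f z)"
    proof (cases "u \<ge> 1")
      case True
      obtain n where n: "2 ^ n \<le> u" "u < 2 ^ Suc n" using obtain_power_bracket[of 2 u] True by auto
      have "dist x y \<le> 2 ^ Suc n * dist x z" unfolding xy using n(2) dz by (intro mult_right_mono) auto
      from big[OF * this] have "dist (f x) (f y) \<le> H ^ Suc (Suc n) * dist (f x) (f z)" .
      also have "\<dots> \<le> (C * max (u powr a) (u ^ b)) * dist (f x) (f z)"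
      proof (rule mult_right_mono)
        have "H ^ Suc (Suc n) \<le> (2 ^ b) ^ Suc (Suc n)" using b(1) H(1) by (intro power_mono) auto
        also have "\<dots> = 4 ^ b * (2 ^ n) ^ b"
          by (simp add: power_mult_distrib[symmetric] power_mult[symmetric] mult.commute)
        also have "\<dots> \<le> 4 ^ b * u ^ b" using n(1) by (intro mult_left_mono power_mono) auto
        also have "\<dots> \<le> C * max (u powr a) (u ^ b)" using True by (intro mult_mono) (auto simp: C_def le_max_iff_disj)
        finally show "H ^ Suc (Suc n) \<le> C * max (u powr a) (u ^ b)" .
      qed simp
      finally show ?thesis .
    next
      case False
      show ?thesis
      proof (cases "u = 0")
        case True then show ?thesis using xy b(2) by (simp add: zero_power)
      next
        case u0: False
        then have up: "u > 0" using dz by (simp add: u_def less_le)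
        obtain n where n: "L ^ n \<le> 1 / u" "1 / u < L ^ Suc n"
          using obtain_power_bracket[of L "1/u"] L(1) False up by auto
        have "u * L ^ n \<le> 1" using n(1) up by (simp add: field_simps)
        then have "u * L ^ n * dist x z \<le> 1 * dist x z" using dz by (intro mult_right_mono) auto
        then have "dist x y * L ^ n \<le> dist x z" by (simp add: xy mult_ac)
        from small[OF * this] have "dist (f x) (f y) \<le> H * (1/2) ^ n * dist (f x) (f z)" .
        also have "\<dots> \<le> (C * max (u powr a) (u ^ b)) * dist (f x) (f z)"
        proof (rule mult_right_mono)
          have "(1 / u) powr a \<le> (L ^ Suc n) powr a" using n(2) up a by (intro powr_mono2) auto
          also have "\<dots> = (L powr a) ^ Suc n" using L(1)
            by (simp add: powr_realpow[symmetric] powr_powr mult.commute del: power_Suc)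
          also have "\<dots> \<le> 2 ^ Suc n" using La by (intro power_mono) auto
          finally have "(1/2) ^ n \<le> 2 * u powr a" using up by (simp add: powr_divide field_simps)
          then have "H * (1/2) ^ n \<le> H * (2 * u powr a)" using H(1) by (intro mult_left_mono) auto
          also have "\<dots> = (2 * H) * u powr a" by simp
          also have "\<dots> \<le> C * max (u powr a) (u ^ b)" using H(1) by (intro mult_mono) (auto simp: C_def le_max_iff_disj)
          finally show "H * (1/2) ^ n \<le> C * max (u powr a) (u ^ b)" .
        qed simp
        finally show ?thesis .
      qed
    qed
    then show "dist (f x) (f y) \<le> C * dist (f x) (f z) * max ((dist x y / dist x z) powr a) ((dist x y / dist x z) ^ b)"
      by (simp add: u_def mult_ac)
  qed (use a b in auto)
qed

text \<open>
  A power bound, unlike a bound by an arbitrary control function on \<open>E\<close>, is an explicit inequality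
  between continuous functions of the three points, hence survives limits.
\<close>

lemma power_quasisymmetric_closure:
  fixes f :: "'a::metric_space \<Rightarrow> 'b::metric_space"
  assumes cont: "continuous_on UNIV f" and a: "0 < a"
    and pq: "\<And>x y z. x \<in> E \<Longrightarrow> y \<in> E \<Longrightarrow> z \<in> E \<Longrightarrow> x \<noteq> z \<Longrightarrow>
       dist (f x) (f y) \<le> C * dist (f x) (f z) * max ((dist x y / dist x z) powr a) ((dist x y / dist x z) ^ b)"
    and xyz: "x \<in> closure E" "y \<in> closure E" "z \<in> closure E" "x \<noteq> z"
  shows "dist (f x) (f y) \<le> C * dist (f x) (f z) * max ((dist x y / dist x z) powr a) ((dist x y / dist x z) ^ b)"
proof -
  obtain X Y Z where X: "\<forall>n. X n \<in> E" "X \<longlonglongrightarrow> x" and Y: "\<forall>n. Y n \<in> E" "Y \<longlonglongrightarrow> y"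
    and Z: "\<forall>n. Z n \<in> E" "Z \<longlonglongrightarrow> z"
    using xyz(1-3) unfolding closure_sequential by metis
  have f: "(\<lambda>n. f (W n)) \<longlonglongrightarrow> f w" if "W \<longlonglongrightarrow> w" for W w
    using continuous_on_tendsto_compose[OF cont that] by simp
  have pos: "dist x z > 0" using xyz by simp
  have ev: "\<forall>\<^sub>F n in sequentially. dist (X n) (Z n) > 0"
    using order_tendstoD(1)[OF tendsto_dist[OF X(2) Z(2)] pos] .
  have u: "(\<lambda>n. dist (X n) (Y n) / dist (X n) (Z n)) \<longlonglongrightarrow> dist x y / dist x z"
    using pos by (intro tendsto_intros X Y Z) auto
  have p: "(\<lambda>n. (dist (X n) (Y n) / dist (X n) (Z n)) powr a) \<longlonglongrightarrow> (dist x y / dist x z) powr a"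
    by (rule tendsto_powr'[OF u tendsto_const]) (use a in auto)
  show ?thesis
  proof (rule tendsto_le[OF sequentially_bot])
    show "(\<lambda>n. dist (f (X n)) (f (Y n))) \<longlonglongrightarrow> dist (f x) (f y)"
      by (intro tendsto_intros f X Y)
    show "(\<lambda>n. C * dist (f (X n)) (f (Z n)) * max ((dist (X n) (Y n) / dist (X n) (Z n)) powr a) ((dist (X n) (Y n) / dist (X n) (Z n)) ^ b))
       \<longlonglongrightarrow> C * dist (f x) (f z) * max ((dist x y / dist x z) powr a) ((dist x y / dist x z) ^ b)"
      by (intro tendsto_mult tendsto_const tendsto_dist f X Z tendsto_max p tendsto_power u)
    show "\<forall>\<^sub>F n in sequentially. dist (f (X n)) (f (Y n)) \<le> C * dist (f (X n)) (f (Z n)) *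
        max ((dist (X n) (Y n) / dist (X n) (Z n)) powr a) ((dist (X n) (Y n) / dist (X n) (Z n)) ^ b)"
      using ev by (rule eventually_mono) (use X Y Z in \<open>auto intro: pq\<close>)
  qed
qed

section \<open>Functions between two powers\<close>

text \<open>
  The scale invariant form of \<open>\<phi> r / r powr a\<close> being nondecreasing and \<open>\<phi> r / r ^ b\<close> being
  nonincreasing. This property is stable under suprema and controls increments as well as values.
\<close>

definition bipower :: "real \<Rightarrow> nat \<Rightarrow> (real \<Rightarrow> real) \<Rightarrow> bool" where
  "bipower a b \<phi> \<longleftrightarrow> (\<forall>r>0. \<phi> r > 0) \<and>
     (\<forall>r>0. \<forall>l\<ge>1. l powr a * \<phi> r \<le> \<phi> (l * r) \<and> \<phi> (l * r) \<le> l ^ b * \<phi> r)"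

lemma bipowerD:
  assumes "bipower a b \<phi>" "r > 0"
  shows bipower_pos: "\<phi> r > 0"
    and bipower_lower: "l \<ge> 1 \<Longrightarrow> l powr a * \<phi> r \<le> \<phi> (l * r)"
    and bipower_upper: "l \<ge> 1 \<Longrightarrow> \<phi> (l * r) \<le> l ^ b * \<phi> r"
  using assms unfolding bipower_def by auto

lemma bipower_strict_mono:
  assumes "bipower a b \<phi>" "a > 0" "0 < r" "r < s"
  shows "\<phi> r < \<phi> s"
proof -
  have "1 < (s / r) powr a" using assms by (intro gr_one_powr) auto
  then have "\<phi> r < (s / r) powr a * \<phi> r" using bipower_pos[OF assms(1,3)] by simp
  also have "\<dots> \<le> \<phi> s" using bipower_lower[OF assms(1,3), of "s / r"] assms by simp
  finally show ?thesis .
qed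

lemma bipower_mono:
  assumes "bipower a b \<phi>" "a > 0" "0 < r" "r \<le> s"
  shows "\<phi> r \<le> \<phi> s"
  using bipower_strict_mono[OF assms(1-3), of s] assms(4) by (cases "r = s") auto

lemma bipower_le_mult:
  assumes "bipower a b \<phi>" "a > 0" "0 < r" "r \<le> l * s" "l \<ge> 1" "s > 0"
  shows "\<phi> r \<le> l ^ b * \<phi> s"
  using bipower_mono[OF assms(1-4)] bipower_upper[OF assms(1,6,5)] by linarith

lemma powr_le_affine:
  fixes a x :: real
  assumes "0 < a" "a \<le> 1" "x > 0"
  shows "x powr a \<le> 1 - a * (1 - x)"
  using Youngs_inequality_0[of a "1 - a" x 1] assms by (simp add: algebra_simps)

lemma power_le_chord:
  fixes u :: real
  assumes "0 \<le> u" "u \<le> 1"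
  shows "(1 + u) ^ n \<le> 1 + 2 ^ n * u"
proof (induction n)
  case 0 then show ?case using assms by simp
next
  case (Suc n)
  have "(1 + u) ^ Suc n = (1 + u) ^ n + u * (1 + u) ^ n" by (simp add: algebra_simps)
  also have "\<dots> \<le> (1 + 2 ^ n * u) + u * 2 ^ n"
    using Suc assms by (intro add_mono mult_left_mono power_mono) auto
  also have "\<dots> = 1 + 2 ^ Suc n * u" by simp
  finally show ?case .
qed

text \<open>
  With \<open>u = h / t\<close>, both increments lie between constant multiples of \<open>u * \<phi> t\<close>: the bounds from
  below use the exponent \<open>a\<close> and concavity of \<open>powr a\<close>, those from above the exponent \<open>b\<close> and
  convexity.
\<close>

lemma bipower_increments:
  assumes \<phi>: "bipower a b \<phi>" and a: "0 < a" "a \<le> 1" and b: "1 \<le> b" and h: "0 < h" "h < t"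
  shows "\<phi> (t + h) - \<phi> t \<le> 2 ^ b / a * (\<phi> t - \<phi> (t - h))"
    and "\<phi> t - \<phi> (t - h) \<le> 2 ^ b / a * (\<phi> (t + h) - \<phi> t)"
proof -
  define u where "u = h / t"
  have u: "0 < u" "u < 1" using h by (auto simp: u_def)
  have t: "t > 0" using h by simp
  have tp: "t + h = (1 + u) * t" and tm: "t - h = (1 - u) * t"
    using t by (auto simp: u_def field_simps)
  have pos: "\<phi> t > 0" using bipower_pos[OF \<phi> t] .
  have l1: "(1 / (1 - u)) \<ge> 1" using u by simp
  have r1: "(1 - u) * t > 0" using u t by simp
  have e1: "1 / (1 - u) * ((1 - u) * t) = t" using u by simp
  have inc_up: "\<phi> (t + h) - \<phi> t \<le> 2 ^ b * u * \<phi> t"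
    using bipower_upper[OF \<phi> t, of "1 + u"] u mult_right_mono[OF power_le_chord[of u b], of "\<phi> t"] pos
    unfolding tp by (simp add: algebra_simps)
  have dec_lo: "a * u * \<phi> t \<le> \<phi> t - \<phi> (t - h)"
  proof -
    have "(1 / (1 - u)) powr a * \<phi> ((1 - u) * t) \<le> \<phi> t"
      using bipower_lower[OF \<phi> r1 l1] unfolding e1 .
    then have "\<phi> (t - h) \<le> (1 - u) powr a * \<phi> t" using u by (simp add: powr_divide tm field_simps)
    also have "\<dots> \<le> (1 - a * u) * \<phi> t"
      using powr_le_affine[of a "1 - u"] a u pos by (intro mult_right_mono) auto
    finally show ?thesis by (simp add: algebra_simps)
  qed
  have inc_lo: "a / 2 * u * \<phi> t \<le> \<phi> (t + h) - \<phi> t"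
  proof -
    have "1 / (1 + u) powr a \<le> 1 - a * (1 - 1 / (1 + u))"
      using powr_le_affine[of a "1 / (1 + u)"] a u by (simp add: powr_divide)
    also have "\<dots> = (1 + u - a * u) / (1 + u)" using u by (simp add: field_simps)
    finally have 1: "1 + u \<le> (1 + u - a * u) * (1 + u) powr a"
      using u by (simp add: field_simps)
    have "a * u * u \<le> a * u" using a u by (simp add: mult_le_cancel_left1)
    then have "0 \<le> a * u / 2 * (1 - u + a * u)" using a u by (intro mult_nonneg_nonneg) auto
    then have "(1 + u - a * u) * (1 + a / 2 * u) \<le> 1 + u" by (simp add: algebra_simps)
    with 1 have "(1 + u - a * u) * (1 + a / 2 * u) \<le> (1 + u - a * u) * (1 + u) powr a" by linarith
    moreover have "a * u \<le> u" using a u by simp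
    ultimately have "1 + a / 2 * u \<le> (1 + u) powr a" by (simp add: mult_le_cancel_left)
    then have "(1 + a / 2 * u) * \<phi> t \<le> (1 + u) powr a * \<phi> t" using pos by (intro mult_right_mono) auto
    also have "\<dots> \<le> \<phi> (t + h)" using bipower_lower[OF \<phi> t, of "1 + u"] u by (simp add: tp)
    finally show ?thesis by (simp add: algebra_simps)
  qed
  have dec_up: "\<phi> t - \<phi> (t - h) \<le> b * u * \<phi> t"
  proof -
    have "\<phi> t \<le> (1 / (1 - u)) ^ b * \<phi> ((1 - u) * t)"
      using bipower_upper[OF \<phi> r1 l1] unfolding e1 .
    then have "(1 - u) ^ b * \<phi> t \<le> \<phi> (t - h)" using u by (simp add: power_divide tm field_simps)
    moreover have "(1 - b * u) * \<phi> t \<le> (1 - u) ^ b * \<phi> t"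
      using Bernoulli_inequality[of "- u" b] u pos by (intro mult_right_mono) auto
    ultimately show ?thesis by (simp add: algebra_simps)
  qed
  have "\<phi> (t + h) - \<phi> t \<le> 2 ^ b / a * (a * u * \<phi> t)" using inc_up a by simp
  also have "\<dots> \<le> 2 ^ b / a * (\<phi> t - \<phi> (t - h))" using dec_lo a by (intro mult_left_mono) auto
  finally show "\<phi> (t + h) - \<phi> t \<le> 2 ^ b / a * (\<phi> t - \<phi> (t - h))" .
  have "2 * b \<le> 2 ^ b"
    using b by (induction b rule: dec_induct) auto
  then have b2: "real b \<le> 2 ^ b / 2" using of_nat_mono[of "2 * b" "2 ^ b", where 'a=real] by simp
  have "\<phi> t - \<phi> (t - h) \<le> 2 ^ b / 2 * (u * \<phi> t)"
  proof -
    have "real b * (u * \<phi> t) \<le> 2 ^ b / 2 * (u * \<phi> t)" using b2 u pos by (intro mult_right_mono) auto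
    then show ?thesis using dec_up by (simp add: mult.assoc)
  qed
  also have "\<dots> = 2 ^ b / a * (a / 2 * u * \<phi> t)" using a by simp
  also have "\<dots> \<le> 2 ^ b / a * (\<phi> (t + h) - \<phi> t)" using inc_lo a by (intro mult_left_mono) auto
  finally show "\<phi> t - \<phi> (t - h) \<le> 2 ^ b / a * (\<phi> (t + h) - \<phi> t)" .
qed

text \<open>
  A ratio \<open>\<phi> / (\<phi> + \<psi>)\<close> in which one function increases and the other decreases inherits regular
  growth: over a common denominator its increment is a sum of two products, each of which contains
  exactly one increment of \<open>\<phi>\<close> or of \<open>\<psi>\<close>.
\<close>

lemma bipower_ratio_one_sided:
  assumes \<phi>: "bipower a b \<phi>" and \<psi>: "bipower a b \<psi>" and a: "0 < a" "a \<le> 1" and b: "1 \<le> b"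
    and h: "0 < h" and K: "K \<ge> 1" and t: "h < t" "t \<le> K * (t - h)" and t': "h < t'" "t' \<le> K * (t' - h)"
    and G: "\<And>s. G s = \<phi> (t + s) / (\<phi> (t + s) + \<psi> (t' - s))"
  shows "G h - G 0 \<le> 2 ^ b / a * K ^ b * (2 ^ b * K ^ b) * (G 0 - G (- h))"
proof -
  define P P0 P1 Q Q0 Q1 where "P = \<phi> t" and "P0 = \<phi> (t - h)" and "P1 = \<phi> (t + h)"
    and "Q = \<psi> t'" and "Q0 = \<psi> (t' + h)" and "Q1 = \<psi> (t' - h)"
  note defs = P_def P0_def P1_def Q_def Q0_def Q1_def
  have pos: "P > 0" "P0 > 0" "P1 > 0" "Q > 0" "Q0 > 0" "Q1 > 0"
    unfolding defs using h t t' by (auto intro!: bipower_pos[OF \<phi>] bipower_pos[OF \<psi>])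
  have mono: "P0 \<le> P" "P \<le> P1" "Q1 \<le> Q" "Q \<le> Q0"
    unfolding defs using h t t' a by (auto intro!: bipower_mono[OF \<phi>] bipower_mono[OF \<psi>])
  define k where "k = 2 ^ b / a"
  have k: "k > 0" using a by (simp add: k_def)
  have Kb: "K ^ b \<ge> 1" using K by simp
  have inc1: "P1 - P \<le> k * (P - P0)"
    unfolding defs k_def by (rule bipower_increments(1)[OF \<phi> a b h t(1)])
  have inc2: "Q - Q1 \<le> k * (Q0 - Q)"
    unfolding defs k_def by (rule bipower_increments(2)[OF \<psi> a b h t'(1)])
  have P0: "P \<le> K ^ b * P0"
    unfolding defs using t h K a by (intro bipower_le_mult[OF \<phi>]) auto
  have Q1: "Q \<le> K ^ b * Q1"
    unfolding defs using t' h K a by (intro bipower_le_mult[OF \<psi>]) auto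
  have Q0: "Q0 \<le> 2 ^ b * Q"
    unfolding defs using t' h K a by (intro bipower_le_mult[OF \<psi>]) auto
  define N1 N2 where "N1 = (P1 - P) * Q + P * (Q - Q1)" and "N2 = (P - P0) * Q0 + P0 * (Q0 - Q)"
  have N2: "N2 \<ge> 0" using mono pos by (simp add: N2_def)
  have "N1 \<le> k * (P - P0) * Q0 + (K ^ b * P0) * (k * (Q0 - Q))"
    unfolding N1_def using inc1 inc2 P0 mono pos k K by (intro add_mono mult_mono) auto
  also have "\<dots> \<le> k * K ^ b * ((P - P0) * Q0) + k * K ^ b * (P0 * (Q0 - Q))"
  proof -
    have "k * 1 * ((P - P0) * Q0) \<le> k * K ^ b * ((P - P0) * Q0)"
      using mono pos k Kb by (intro mult_right_mono mult_left_mono) auto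
    then show ?thesis by (simp add: mult_ac)
  qed
  also have "\<dots> = k * K ^ b * N2" by (simp add: N2_def algebra_simps)
  finally have N1: "N1 \<le> k * K ^ b * N2" .
  have S: "P0 + Q0 \<le> 2 ^ b * K ^ b * (P1 + Q1)"
  proof -
    have "P0 \<le> P1" using mono by simp
    also have "\<dots> \<le> 2 ^ b * K ^ b * P1"
      using mult_mono[of 1 "2 ^ b" 1 "K ^ b"] Kb pos by (simp add: mult_le_cancel_right1)
    finally have "P0 \<le> 2 ^ b * K ^ b * P1" .
    moreover have "Q0 \<le> 2 ^ b * (K ^ b * Q1)" using Q0 Q1 by (meson mult_left_mono order_trans zero_le_numeral zero_le_power)
    ultimately show ?thesis by (simp add: algebra_simps)
  qed
  have G1: "G h - G 0 = N1 / ((P1 + Q1) * (P + Q))"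
    using pos by (simp add: G N1_def defs[symmetric] divide_simps) (simp add: algebra_simps)
  have G2: "G 0 - G (- h) = N2 / ((P0 + Q0) * (P + Q))"
    using pos by (simp add: G N2_def defs[symmetric] divide_simps) (simp add: algebra_simps)
  have "N1 / (P1 + Q1) \<le> k * K ^ b * N2 / (P1 + Q1)"
    using N1 pos by (intro divide_right_mono) auto
  also have "\<dots> \<le> k * K ^ b * N2 * (2 ^ b * K ^ b) / (P0 + Q0)"
  proof -
    have "(k * K ^ b * N2) * (P0 + Q0) \<le> (k * K ^ b * N2) * (2 ^ b * K ^ b * (P1 + Q1))"
      using S k Kb N2 by (intro mult_left_mono) auto
    then show ?thesis using pos by (simp add: divide_simps mult_ac)
  qed
  finally have "N1 / (P1 + Q1) / (P + Q) \<le> k * K ^ b * N2 * (2 ^ b * K ^ b) / (P0 + Q0) / (P + Q)"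
    using pos by (intro divide_right_mono) auto
  then show ?thesis unfolding G1 G2 k_def by (simp add: mult_ac)
qed

text \<open>
  Exchanging \<open>\<phi>\<close> and \<open>\<psi>\<close> replaces \<open>G s\<close> by \<open>1 - G (- s)\<close>, so the one-sided estimate also gives the
  opposite one.
\<close>

lemma bipower_ratio_triples:
  assumes \<phi>: "bipower a b \<phi>" and \<psi>: "bipower a b \<psi>" and a: "0 < a" "a \<le> 1" and b: "1 \<le> b"
    and K: "K \<ge> 1" and t: "\<bar>h\<bar> < t" "t \<le> K * (t - \<bar>h\<bar>)" and t': "\<bar>h\<bar> < t'" "t' \<le> K * (t' - \<bar>h\<bar>)"
    and G: "\<And>s. G s = \<phi> (t + s) / (\<phi> (t + s) + \<psi> (t' - s))"
  shows "\<bar>G h - G 0\<bar> \<le> 2 ^ b / a * K ^ b * (2 ^ b * K ^ b) * \<bar>G 0 - G (- h)\<bar>"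
proof -
  define c where "c = 2 ^ b / a * K ^ b * (2 ^ b * K ^ b)"
  have c: "c \<ge> 0" using a K by (simp add: c_def)
  define G' where "G' = (\<lambda>s. \<psi> (t' + s) / (\<psi> (t' + s) + \<phi> (t - s)))"
  have G': "G' s = 1 - G (- s)" if "\<bar>s\<bar> \<le> \<bar>h\<bar>" for s
  proof -
    have "\<psi> (t' + s) > 0" "\<phi> (t - s) > 0"
      using that t t' by (auto intro!: bipower_pos[OF \<phi>] bipower_pos[OF \<psi>])
    then have "\<psi> (t' + s) + \<phi> (t - s) \<noteq> 0" by linarith
    then show ?thesis by (simp add: G'_def G add.commute) (simp add: field_simps)
  qed
  have mono: "G s \<le> G s'" if "s \<le> s'" "\<bar>s\<bar> \<le> \<bar>h\<bar>" "\<bar>s'\<bar> \<le> \<bar>h\<bar>" for s s'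
  proof -
    have pos: "\<phi> (t + s) > 0" "\<phi> (t + s') > 0" "\<psi> (t' - s) > 0" "\<psi> (t' - s') > 0"
      using that t t' by (auto intro!: bipower_pos[OF \<phi>] bipower_pos[OF \<psi>])
    have le: "\<phi> (t + s) \<le> \<phi> (t + s')" "\<psi> (t' - s') \<le> \<psi> (t' - s)"
      using that t t' a by (auto intro!: bipower_mono[OF \<phi>] bipower_mono[OF \<psi>])
    have "\<phi> (t + s) * \<psi> (t' - s') \<le> \<phi> (t + s') * \<psi> (t' - s)"
      using le pos by (intro mult_mono) auto
    then show ?thesis using pos by (simp add: G divide_simps) (simp add: algebra_simps add_pos_pos)
  qed
  show ?thesis
  proof (cases "h = 0")
    case False
    define s where "s = \<bar>h\<bar>"
    have s: "s > 0" "s < t" "s < t'" using False t t' by (auto simp: s_def)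
    have 1: "G s - G 0 \<le> c * (G 0 - G (- s))"
      unfolding c_def by (rule bipower_ratio_one_sided[OF \<phi> \<psi> a b _ K _ _ _ _ G]) (use t t' False in \<open>auto simp: s_def\<close>)
    have "G' s - G' 0 \<le> c * (G' 0 - G' (- s))"
      unfolding c_def by (rule bipower_ratio_one_sided[OF \<psi> \<phi> a b _ K])
        (use t t' False in \<open>auto simp: s_def G'_def\<close>)
    then have 2: "G 0 - G (- s) \<le> c * (G s - G 0)" by (simp add: G' s_def)
    have m: "G 0 \<le> G s" "G (- s) \<le> G 0" using mono[of 0 s] mono[of "- s" 0] by (auto simp: s_def)
    consider "h = s" | "h = - s" unfolding s_def by linarith
    then show ?thesis unfolding c_def[symmetric]
      by cases (use 1 2 m in auto)
  qed simp
qed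

lemma obtain_powr_ge:
  fixes a B :: real
  assumes "a > 0"
  obtains K where "K \<ge> 2" "B \<le> K powr a"
proof -
  define K where "K = max 2 (max 1 B powr (1 / a))"
  have "B \<le> max 1 B" by simp
  also have "\<dots> = (max 1 B powr (1 / a)) powr a" using assms by (simp add: powr_powr)
  also have "\<dots> \<le> K powr a" using assms by (intro powr_mono2) (auto simp: K_def)
  finally show ?thesis by (intro that[of K]) (auto simp: K_def)
qed

section \<open>The size of an embedding at a point and a scale\<close>

definition gauge_lo :: "real \<Rightarrow> nat \<Rightarrow> real \<Rightarrow> real" where
  "gauge_lo a b u = min (u powr a) (u ^ b)"

definition gauge_hi :: "real \<Rightarrow> nat \<Rightarrow> real \<Rightarrow> real" where
  "gauge_hi a b u = max (u powr a) (u ^ b)"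

lemma gauge_lo_scale:
  assumes "0 < a" "a \<le> 1" "1 \<le> b" "1 \<le> l" "0 \<le> u"
  shows "l powr a * gauge_lo a b u \<le> gauge_lo a b (l * u)" "gauge_lo a b (l * u) \<le> l ^ b * gauge_lo a b u"
proof -
  have "l powr a \<le> l powr 1" using assms by (intro powr_mono) auto
  also have "\<dots> \<le> l ^ b" using assms self_le_power[of l b] by simp
  finally have ab: "l powr a \<le> l ^ b" .
  have 1: "(l * u) powr a = l powr a * u powr a" "(l * u) ^ b = l ^ b * u ^ b"
    using assms by (auto simp: powr_mult power_mult_distrib)
  have 2: "l powr a * u ^ b \<le> l ^ b * u ^ b" "l powr a * u powr a \<le> l ^ b * u powr a"
    using ab assms by (auto intro!: mult_right_mono)
  show "l powr a * gauge_lo a b u \<le> gauge_lo a b (l * u)"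
    unfolding gauge_lo_def 1
    by (rule min.boundedI)
       (use 2(1) in \<open>auto intro!: mult_left_mono order_trans[OF mult_left_mono, of _ "u ^ b"]\<close>)
  show "gauge_lo a b (l * u) \<le> l ^ b * gauge_lo a b u"
  proof -
    have "l ^ b * min (u powr a) (u ^ b) = min (l ^ b * u powr a) (l ^ b * u ^ b)"
      using assms by (simp add: min_mult_distrib_left)
    then show ?thesis unfolding gauge_lo_def 1 using 2(2) by (metis min.mono order_refl)
  qed
qed

lemma gauge_lo_mono:
  assumes "0 < a" "0 \<le> u" "u \<le> v"
  shows "gauge_lo a b u \<le> gauge_lo a b v"
  unfolding gauge_lo_def using assms by (intro min.mono powr_mono2 power_mono) auto

lemma gauge_lo_pos: "u > 0 \<Longrightarrow> gauge_lo a b u > 0"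
  by (simp add: gauge_lo_def)

lemma gauge_lo_mult:
  assumes "x \<ge> 0" "y \<ge> 0"
  shows "gauge_lo a b (x * y) \<le> gauge_hi a b x * gauge_lo a b y"
proof -
  have "gauge_lo a b (x * y) \<le> x powr a * y powr a" "gauge_lo a b (x * y) \<le> x ^ b * y ^ b"
    unfolding gauge_lo_def using assms by (auto simp: powr_mult power_mult_distrib)
  moreover have "x powr a * y powr a \<le> gauge_hi a b x * y powr a" "x ^ b * y ^ b \<le> gauge_hi a b x * y ^ b"
    using assms by (auto simp: gauge_hi_def intro!: mult_right_mono)
  ultimately show ?thesis unfolding gauge_lo_def[of a b y] by (simp add: min_def)
qed

lemma gauge_hi_inverse:
  assumes "u > 0"
  shows "gauge_hi a b u * gauge_lo a b (1 / u) = 1"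
proof -
  have "u powr a * (1/u) powr a = 1" "u ^ b * (1/u) ^ b = 1"
    using assms by (auto simp: powr_mult[symmetric] power_mult_distrib[symmetric])
  then show ?thesis using assms
    by (auto simp: gauge_hi_def gauge_lo_def max_def min_def powr_divide power_divide divide_simps split: if_splits)
qed

text \<open>
  The map to be extended is the restriction of \<open>f\<close> to \<open>E\<close>, where \<open>f\<close> is an increasing homeomorphism of the
  line that need not be quasisymmetric off \<open>E\<close>. Its values on \<open>E\<close> determine everything below.
\<close>

locale power_quasisymmetric_embedding =
  fixes E :: "real set" and f :: "real \<Rightarrow> real" and a :: real and b :: nat and C :: real
  assumes closed: "closed E"
    and f_mono: "strict_mono f"
    and a: "0 < a" "a \<le> 1" and b: "1 \<le> b" and C: "1 \<le> C"
    and nontrivial: "\<exists>x\<in>E. \<exists>y\<in>E. x \<noteq> y"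
    and power_qs: "\<And>x y z. x \<in> E \<Longrightarrow> y \<in> E \<Longrightarrow> z \<in> E \<Longrightarrow> x \<noteq> z \<Longrightarrow>
       \<bar>f y - f x\<bar> \<le> C * \<bar>f z - f x\<bar> * gauge_hi a b (\<bar>y - x\<bar> / \<bar>z - x\<bar>)"
begin

text \<open>
  The factor \<open>gauge_lo\<close> discounts a point \<open>y\<close> at the wrong distance by the most that a map of power
  distortion could gain between the scales \<open>\<bar>y - x\<bar>\<close> and \<open>r\<close>. This makes sense for every \<open>r\<close>,
  whether or not \<open>E\<close> has points at distance about \<open>r\<close> from \<open>x\<close>.
\<close>

definition scale :: "real \<Rightarrow> real \<Rightarrow> real" where
  "scale x r = (SUP y\<in>E - {x}. \<bar>f y - f x\<bar> * gauge_lo a b (r / \<bar>y - x\<bar>))"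

lemma f_less: "f x < f y \<longleftrightarrow> x < y"
  using f_mono by (simp add: strict_mono_less)

lemma f_le: "f x \<le> f y \<longleftrightarrow> x \<le> y"
  using f_mono by (simp add: strict_mono_less_eq)

lemma obtain_other: obtains z where "z \<in> E" "z \<noteq> x"
  using nontrivial by metis

text \<open>
  The power bound cancels against the discount: no point \<open>y\<close> contributes more than any given
  reference point \<open>z\<close> would, up to a constant. For \<open>r = \<bar>z - x\<bar>\<close> this shows that \<open>scale\<close> does not
  exceed the actual displacement of \<open>z\<close> by more than the factor \<open>C\<close>.
\<close>

lemma scale_term_le:
  assumes "x \<in> E" "z \<in> E" "z \<noteq> x" "y \<in> E - {x}" "r > 0"
  shows "\<bar>f y - f x\<bar> * gauge_lo a b (r / \<bar>y - x\<bar>) \<le> C * \<bar>f z - f x\<bar> * gauge_hi a b (r / \<bar>z - x\<bar>)"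
proof -
  define u where "u = \<bar>y - x\<bar> / \<bar>z - x\<bar>"
  have u: "u > 0" using assms by (auto simp: u_def)
  have e: "r / \<bar>y - x\<bar> = r / \<bar>z - x\<bar> * (1 / u)" using assms by (auto simp: u_def)
  have "\<bar>f y - f x\<bar> * gauge_lo a b (r / \<bar>y - x\<bar>)
      \<le> (C * \<bar>f z - f x\<bar> * gauge_hi a b u) * (gauge_hi a b (r / \<bar>z - x\<bar>) * gauge_lo a b (1 / u))"
    unfolding e
  proof (rule mult_mono)
    show "\<bar>f y - f x\<bar> \<le> C * \<bar>f z - f x\<bar> * gauge_hi a b u"
      unfolding u_def using assms by (intro power_qs) auto
    show "gauge_lo a b (r / \<bar>z - x\<bar> * (1 / u)) \<le> gauge_hi a b (r / \<bar>z - x\<bar>) * gauge_lo a b (1 / u)"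
      using assms u by (intro gauge_lo_mult) auto
    show "0 \<le> C * \<bar>f z - f x\<bar> * gauge_hi a b u" using C by (auto simp: gauge_hi_def le_max_iff_disj)
    show "0 \<le> gauge_lo a b (r / \<bar>z - x\<bar> * (1 / u))"
      using assms u by (intro less_imp_le[OF gauge_lo_pos]) auto
  qed
  also have "\<dots> = C * \<bar>f z - f x\<bar> * gauge_hi a b (r / \<bar>z - x\<bar>) * (gauge_hi a b u * gauge_lo a b (1 / u))"
    by (simp add: mult_ac)
  also have "\<dots> = C * \<bar>f z - f x\<bar> * gauge_hi a b (r / \<bar>z - x\<bar>)" by (simp add: gauge_hi_inverse[OF u])
  finally show ?thesis .
qed

lemma scale_bdd:
  assumes "x \<in> E" "r > 0"
  shows "bdd_above ((\<lambda>y. \<bar>f y - f x\<bar> * gauge_lo a b (r / \<bar>y - x\<bar>)) ` (E - {x}))"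
proof -
  obtain z where "z \<in> E" "z \<noteq> x" by (rule obtain_other)
  then show ?thesis
    using scale_term_le[OF assms(1) _ _ _ assms(2)] by (intro bdd_aboveI2) blast
qed

lemma scale_upper:
  assumes "x \<in> E" "r > 0" "y \<in> E" "y \<noteq> x"
  shows "\<bar>f y - f x\<bar> * gauge_lo a b (r / \<bar>y - x\<bar>) \<le> scale x r"
  unfolding scale_def using assms by (intro cSUP_upper scale_bdd) auto

lemma scale_least:
  assumes "\<And>y. y \<in> E \<Longrightarrow> y \<noteq> x \<Longrightarrow> \<bar>f y - f x\<bar> * gauge_lo a b (r / \<bar>y - x\<bar>) \<le> B"
  shows "scale x r \<le> B"
  unfolding scale_def using obtain_other[of x] assms by (intro cSUP_least) auto

lemma scale_bipower:
  assumes x: "x \<in> E"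
  shows "bipower a b (scale x)"
  unfolding bipower_def
proof (intro conjI allI impI)
  fix r :: real assume r: "r > 0"
  obtain z where z: "z \<in> E" "z \<noteq> x" by (rule obtain_other)
  have "f z \<noteq> f x" using z f_less[of z x] f_less[of x z] by auto
  then have "0 < \<bar>f z - f x\<bar> * gauge_lo a b (r / \<bar>z - x\<bar>)"
    using z r by (intro mult_pos_pos gauge_lo_pos) auto
  also have "\<dots> \<le> scale x r" using x r z by (intro scale_upper) auto
  finally show "scale x r > 0" .
next
  fix r l :: real assume r: "r > 0" and l: "1 \<le> l"
  have lr: "l * r > 0" using r l by simp
  have "scale x r \<le> scale x (l * r) / l powr a"
  proof (rule scale_least)
    fix y assume y: "y \<in> E" "y \<noteq> x"
    have "l powr a * gauge_lo a b (r / \<bar>y - x\<bar>) \<le> gauge_lo a b (l * r / \<bar>y - x\<bar>)"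
      using gauge_lo_scale(1)[OF a b l, of "r / \<bar>y - x\<bar>"] r by simp
    then have "\<bar>f y - f x\<bar> * (l powr a * gauge_lo a b (r / \<bar>y - x\<bar>)) \<le> \<bar>f y - f x\<bar> * gauge_lo a b (l * r / \<bar>y - x\<bar>)"
      by (rule mult_left_mono) simp
    also have "\<dots> \<le> scale x (l * r)" using x lr y by (intro scale_upper) auto
    finally show "\<bar>f y - f x\<bar> * gauge_lo a b (r / \<bar>y - x\<bar>) \<le> scale x (l * r) / l powr a"
      using l by (simp add: pos_le_divide_eq mult_ac)
  qed
  then show "l powr a * scale x r \<le> scale x (l * r)" using l by (simp add: pos_le_divide_eq mult_ac)
  show "scale x (l * r) \<le> l ^ b * scale x r"
  proof (rule scale_least)
    fix y assume y: "y \<in> E" "y \<noteq> x"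
    have "gauge_lo a b (l * r / \<bar>y - x\<bar>) \<le> l ^ b * gauge_lo a b (r / \<bar>y - x\<bar>)"
      using gauge_lo_scale(2)[OF a b l, of "r / \<bar>y - x\<bar>"] r by simp
    then have "\<bar>f y - f x\<bar> * gauge_lo a b (l * r / \<bar>y - x\<bar>) \<le> \<bar>f y - f x\<bar> * (l ^ b * gauge_lo a b (r / \<bar>y - x\<bar>))"
      by (rule mult_left_mono) simp
    also have "\<dots> = l ^ b * (\<bar>f y - f x\<bar> * gauge_lo a b (r / \<bar>y - x\<bar>))" by simp
    also have "\<dots> \<le> l ^ b * scale x r" using x r y l by (intro mult_left_mono scale_upper) auto
    finally show "\<bar>f y - f x\<bar> * gauge_lo a b (l * r / \<bar>y - x\<bar>) \<le> l ^ b * scale x r" .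
  qed
qed

lemma scale_ge: "x \<in> E \<Longrightarrow> z \<in> E \<Longrightarrow> z \<noteq> x \<Longrightarrow> \<bar>f z - f x\<bar> \<le> scale x \<bar>z - x\<bar>"
  using scale_upper[of x "\<bar>z - x\<bar>" z] by (simp add: gauge_lo_def)

lemma scale_le:
  assumes "x \<in> E" "z \<in> E" "z \<noteq> x"
  shows "scale x \<bar>z - x\<bar> \<le> C * \<bar>f z - f x\<bar>"
proof (rule scale_least)
  fix y assume "y \<in> E" "y \<noteq> x"
  then show "\<bar>f y - f x\<bar> * gauge_lo a b (\<bar>z - x\<bar> / \<bar>y - x\<bar>) \<le> C * \<bar>f z - f x\<bar>"
    using scale_term_le[OF assms, of y "\<bar>z - x\<bar>"] assms by (simp add: gauge_hi_def)
qed

lemmas scale_pos = bipower_pos[OF scale_bipower]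
lemmas scale_mono = bipower_mono[OF scale_bipower a(1)]
lemmas scale_le_mult = bipower_le_mult[OF scale_bipower a(1)]

definition "shift_const = C + 1 + 2 ^ b"

lemma shift_const: "1 \<le> shift_const" "C \<le> shift_const" "1 + 2 ^ b \<le> shift_const" "0 < shift_const"
  using C by (auto simp: shift_const_def add_pos_nonneg)

text \<open>
  Let \<open>y\<close> be a point that competes in the supremum at \<open>x\<close>. If \<open>y\<close> is nearer to \<open>x\<close> than \<open>x'\<close> is, the
  power bound replaces \<open>y\<close> by \<open>x'\<close>, and \<open>x\<close> competes in the supremum at \<open>x'\<close>. Otherwise
  \<open>\<bar>f y - f x\<bar> \<le> \<bar>f y - f x'\<bar> + \<bar>f x - f x'\<bar>\<close>, and both \<open>y\<close> and \<open>x\<close> compete at \<open>x'\<close> with a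
  discount that is not much worse.
\<close>

lemma scale_shift:
  assumes x: "x \<in> E" "x' \<in> E" and r: "\<bar>x - x'\<bar> \<le> r" "r > 0"
  shows "scale x r \<le> shift_const * scale x' r"
proof (cases "x = x'")
  case True
  then show ?thesis using scale_pos[OF x(2) r(2)] shift_const(1) by (simp add: mult_le_cancel_right1)
next
  case ne: False
  define s where "s = \<bar>x - x'\<bar>"
  have s: "0 < s" "s \<le> r" using ne r by (auto simp: s_def)
  have sp: "scale x' r > 0" using scale_pos[OF x(2) r(2)] .
  show ?thesis
  proof (rule scale_least)
    fix y assume y: "y \<in> E" "y \<noteq> x"
    define d where "d = \<bar>y - x\<bar>"
    have d: "d > 0" using y by (simp add: d_def)
    have xx': "\<bar>f x - f x'\<bar> * gauge_lo a b (r / s) \<le> scale x' r"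
      using scale_upper[OF x(2) r(2) x(1) ne] by (simp add: s_def)
    have "\<bar>f y - f x\<bar> * gauge_lo a b (r / d) \<le> shift_const * scale x' r"
    proof (cases "d \<le> s")
      case True
      have u: "gauge_hi a b (d / s) = (d / s) powr a"
      proof -
        have "(d / s) ^ b \<le> (d / s) ^ 1" using True d s b by (intro power_decreasing) auto
        also have "\<dots> = (d / s) powr 1" using d s by simp
        also have "\<dots> \<le> (d / s) powr a" using True d s a by (intro powr_mono') auto
        finally show ?thesis by (simp add: gauge_hi_def)
      qed
      have big: "gauge_lo a b t = t powr a" if "t \<ge> 1" for t
      proof -
        have "t powr a \<le> t powr 1" using that a by (intro powr_mono) auto
        also have "\<dots> \<le> t ^ b" using that b self_le_power[of t b] by simp
        finally show ?thesis by (simp add: gauge_lo_def)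
      qed
      have "\<bar>f y - f x\<bar> \<le> C * \<bar>f x' - f x\<bar> * (d / s) powr a"
        using power_qs[OF x(1) y(1) x(2) ne] u by (simp add: d_def s_def abs_minus_commute)
      then have "\<bar>f y - f x\<bar> * gauge_lo a b (r / d) \<le> C * \<bar>f x' - f x\<bar> * (d / s) powr a * (r / d) powr a"
        using True d s r big[of "r / d"] by (simp add: mult_right_mono)
      also have "\<dots> = C * (\<bar>f x - f x'\<bar> * gauge_lo a b (r / s))"
        using d s r big[of "r / s"] by (simp add: powr_mult[symmetric] abs_minus_commute)
      also have "\<dots> \<le> C * scale x' r" using xx' C by (intro mult_left_mono) auto
      also have "\<dots> \<le> shift_const * scale x' r" using shift_const sp by (intro mult_right_mono) auto
      finally show ?thesis .
    next
      case False
      have g: "gauge_lo a b (r / d) \<le> gauge_lo a b (r / s)"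
        using False s d r a by (intro gauge_lo_mono) (auto intro: divide_left_mono)
      have "\<bar>f x - f x'\<bar> * gauge_lo a b (r / d) \<le> \<bar>f x - f x'\<bar> * gauge_lo a b (r / s)"
        using g by (rule mult_left_mono) simp
      then have 1: "\<bar>f x - f x'\<bar> * gauge_lo a b (r / d) \<le> scale x' r" using xx' by linarith
      have 2: "\<bar>f y - f x'\<bar> * gauge_lo a b (r / d) \<le> 2 ^ b * scale x' r"
      proof (cases "y = x'")
        case True then show ?thesis using sp by simp
      next
        case ne': False
        have "\<bar>y - x'\<bar> \<le> 2 * d" using False abs_triangle_ineq[of "y - x" "x - x'"] unfolding d_def s_def by simp
        then have "r / (2 * d) \<le> r / \<bar>y - x'\<bar>" using ne' r d by (intro divide_left_mono) auto
        then have "gauge_lo a b (2 * (r / (2 * d))) \<le> gauge_lo a b (2 * (r / \<bar>y - x'\<bar>))"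
          using r d a by (intro gauge_lo_mono) auto
        also have "\<dots> \<le> 2 ^ b * gauge_lo a b (r / \<bar>y - x'\<bar>)"
          using r by (intro gauge_lo_scale a b) auto
        finally have "\<bar>f y - f x'\<bar> * gauge_lo a b (r / d) \<le> \<bar>f y - f x'\<bar> * (2 ^ b * gauge_lo a b (r / \<bar>y - x'\<bar>))"
          by (intro mult_left_mono) auto
        also have "\<dots> \<le> 2 ^ b * scale x' r"
          using scale_upper[OF x(2) r(2) y(1) ne'] by (simp add: mult.left_commute)
        finally show ?thesis .
      qed
      have "\<bar>f y - f x\<bar> * gauge_lo a b (r / d) \<le> (\<bar>f y - f x'\<bar> + \<bar>f x - f x'\<bar>) * gauge_lo a b (r / d)"
        using r d by (intro mult_right_mono less_imp_le[OF gauge_lo_pos]) auto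
      also have "\<dots> \<le> (1 + 2 ^ b) * scale x' r" using 1 2 by (simp add: algebra_simps)
      also have "\<dots> \<le> shift_const * scale x' r" using shift_const sp by (intro mult_right_mono) auto
      finally show ?thesis .
    qed
    then show "\<bar>f y - f x\<bar> * gauge_lo a b (r / \<bar>y - x\<bar>) \<le> shift_const * scale x' r" by (simp add: d_def)
  qed
qed

end

section \<open>The extension over the gaps\<close>

context power_quasisymmetric_embedding
begin

definition lower :: "real \<Rightarrow> real" where "lower z = Sup (E \<inter> {..z})"
definition upper :: "real \<Rightarrow> real" where "upper z = Inf (E \<inter> {z..})"

text \<open>
  On a bounded gap the two values of \<open>scale\<close> enter symmetrically, so that the extension follows
  \<open>scale\<close> at both endpoints without being pieced together at the midpoint. On an unbounded gap the
  total increase is not prescribed and \<open>scale\<close> itself serves.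
\<close>

definition extend :: "real \<Rightarrow> real" where
  "extend z =
     (let A = scale (lower z) (z - lower z); B = scale (upper z) (upper z - z) in
      if z \<in> E then f z
      else if E \<inter> {..z} = {} then f (upper z) - B
      else if E \<inter> {z..} = {} then f (lower z) + A
      else f (lower z) + (f (upper z) - f (lower z)) * (A / (A + B)))"

lemma extend_on: "z \<in> E \<Longrightarrow> extend z = f z"
  by (simp add: extend_def)

lemma extend_left_ray:
  assumes "\<beta> \<in> E" "\<forall>y\<in>E. \<beta> \<le> y" "z < \<beta>"
  shows "extend z = f \<beta> - scale \<beta> (\<beta> - z)"
proof -
  have "upper z = \<beta>" unfolding upper_def by (rule cInf_eq_minimum) (use assms in auto)
  moreover have "z \<notin> E" "E \<inter> {..z} = {}" using assms by force+
  ultimately show ?thesis by (simp add: extend_def)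
qed

lemma extend_right_ray:
  assumes "\<alpha> \<in> E" "\<forall>y\<in>E. y \<le> \<alpha>" "\<alpha> < z"
  shows "extend z = f \<alpha> + scale \<alpha> (z - \<alpha>)"
proof -
  have "lower z = \<alpha>" unfolding lower_def by (rule cSup_eq_maximum) (use assms in auto)
  moreover have "z \<notin> E" "E \<inter> {..z} \<noteq> {}" "E \<inter> {z..} = {}" using assms by force+
  ultimately show ?thesis by (simp add: extend_def)
qed

definition gap :: "real \<Rightarrow> real \<Rightarrow> bool" where
  "gap \<alpha> \<beta> \<longleftrightarrow> \<alpha> \<in> E \<and> \<beta> \<in> E \<and> \<alpha> < \<beta> \<and> (\<forall>y\<in>E. y \<le> \<alpha> \<or> \<beta> \<le> y)"

lemma extend_gap:
  assumes "gap \<alpha> \<beta>" "\<alpha> < z" "z < \<beta>"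
  shows "extend z = f \<alpha> + (f \<beta> - f \<alpha>) * (scale \<alpha> (z - \<alpha>) / (scale \<alpha> (z - \<alpha>) + scale \<beta> (\<beta> - z)))"
proof -
  have "lower z = \<alpha>" unfolding lower_def by (rule cSup_eq_maximum) (use assms in \<open>force simp: gap_def\<close>)+
  moreover have "upper z = \<beta>" unfolding upper_def by (rule cInf_eq_minimum) (use assms in \<open>force simp: gap_def\<close>)+
  moreover have "z \<notin> E" "E \<inter> {..z} \<noteq> {}" "E \<inter> {z..} \<noteq> {}" using assms by (force simp: gap_def)+
  ultimately show ?thesis by (simp add: extend_def Let_def)
qed

lemma complement_cases:
  assumes "z \<notin> E"
  obtains (gap) \<alpha> \<beta> where "gap \<alpha> \<beta>" "\<alpha> < z" "z < \<beta>"
  | (left) \<beta> where "\<beta> \<in> E" "\<forall>y\<in>E. \<beta> \<le> y" "z < \<beta>"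
  | (right) \<alpha> where "\<alpha> \<in> E" "\<forall>y\<in>E. y \<le> \<alpha>" "\<alpha> < z"
proof -
  have lo: "lower z \<in> E \<and> lower z < z \<and> (\<forall>y\<in>E. y \<le> z \<longrightarrow> y \<le> lower z)" if "E \<inter> {..z} \<noteq> {}"
  proof -
    have "lower z \<in> E \<inter> {..z}" unfolding lower_def
      using that by (intro closed_contains_Sup closed_Int closed closed_atMost) (auto intro: bdd_aboveI)
    moreover have "y \<le> lower z" if "y \<in> E" "y \<le> z" for y
      unfolding lower_def using that by (intro cSup_upper) (auto intro: bdd_aboveI)
    ultimately show ?thesis using assms by (auto simp: less_le)
  qed
  have up: "upper z \<in> E \<and> z < upper z \<and> (\<forall>y\<in>E. z \<le> y \<longrightarrow> upper z \<le> y)" if "E \<inter> {z..} \<noteq> {}"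
  proof -
    have "upper z \<in> E \<inter> {z..}" unfolding upper_def
      using that by (intro closed_contains_Inf closed_Int closed closed_atLeast) (auto intro: bdd_belowI)
    moreover have "upper z \<le> y" if "y \<in> E" "z \<le> y" for y
      unfolding upper_def using that by (intro cInf_lower) (auto intro: bdd_belowI)
    ultimately show ?thesis using assms by (auto simp: less_le)
  qed
  consider "E \<inter> {..z} = {}" | "E \<inter> {z..} = {}" | "E \<inter> {..z} \<noteq> {}" "E \<inter> {z..} \<noteq> {}" by blast
  then show ?thesis
  proof cases
    case 1
    then have all: "\<forall>y\<in>E. z \<le> y" by force
    obtain e where "e \<in> E" by (rule obtain_other)
    then have "E \<inter> {z..} \<noteq> {}" using all by auto
    from up[OF this] all show ?thesis by (intro left[of "upper z"]) auto
  next
    case 2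
    then have all: "\<forall>y\<in>E. y \<le> z" by force
    obtain e where "e \<in> E" by (rule obtain_other)
    then have "E \<inter> {..z} \<noteq> {}" using all by auto
    from lo[OF this] all show ?thesis by (intro right[of "lower z"]) auto
  next
    case 3
    from lo[OF 3(1)] up[OF 3(2)] show ?thesis
      by (intro gap[of "lower z" "upper z"]) (auto simp: gap_def intro: less_trans le_cases[of _ z])
  qed
qed

text \<open>
  Both values of \<open>scale\<close> are at most of the order of \<open>f \<beta> - f \<alpha>\<close>, and the one at the farther endpoint
  is at least of this order. So near an endpoint the extension moves away from its value there like
  \<open>scale\<close> itself.
\<close>

lemma gap_ratio:
  assumes g: "gap \<alpha> \<beta>" and z: "\<alpha> < z" "z < \<beta>"
  defines "A \<equiv> scale \<alpha> (z - \<alpha>)" and "B \<equiv> scale \<beta> (\<beta> - z)"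
  shows "extend z - f \<alpha> = (f \<beta> - f \<alpha>) * (A / (A + B))"
    and "f \<beta> - extend z = (f \<beta> - f \<alpha>) * (B / (A + B))"
    and "A > 0" "B > 0" "A + B \<le> 2 * C * (f \<beta> - f \<alpha>)" "f \<beta> - f \<alpha> \<le> 2 ^ b * (A + B)"
proof -
  have E: "\<alpha> \<in> E" "\<beta> \<in> E" "\<alpha> < \<beta>" using g by (auto simp: gap_def)
  show pos: "A > 0" "B > 0" unfolding A_def B_def using E z by (auto intro!: scale_pos)
  show 1: "extend z - f \<alpha> = (f \<beta> - f \<alpha>) * (A / (A + B))"
    unfolding extend_gap[OF g z] A_def B_def by simp
  have "A / (A + B) + B / (A + B) = 1" using pos by (simp add: add_divide_distrib[symmetric])
  then have eq: "B / (A + B) = 1 - A / (A + B)" by linarith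
  have "f \<beta> - extend z = (f \<beta> - f \<alpha>) - (f \<beta> - f \<alpha>) * (A / (A + B))" using 1 by linarith
  then show "f \<beta> - extend z = (f \<beta> - f \<alpha>) * (B / (A + B))"
    unfolding eq by (simp only: right_diff_distrib mult_1_right)
  have fl: "f \<alpha> < f \<beta>" using E f_less by simp
  have "A \<le> scale \<alpha> (\<beta> - \<alpha>)" "B \<le> scale \<beta> (\<beta> - \<alpha>)"
    unfolding A_def B_def using E z by (auto intro!: scale_mono)
  moreover have "scale \<alpha> (\<beta> - \<alpha>) \<le> C * (f \<beta> - f \<alpha>)" "scale \<beta> (\<beta> - \<alpha>) \<le> C * (f \<beta> - f \<alpha>)"
    using scale_le[of \<alpha> \<beta>] scale_le[of \<beta> \<alpha>] E fl by (auto simp: abs_minus_commute)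
  ultimately show "A + B \<le> 2 * C * (f \<beta> - f \<alpha>)" by (simp add: algebra_simps)
  have ge: "f \<beta> - f \<alpha> \<le> scale \<alpha> (\<beta> - \<alpha>)" "f \<beta> - f \<alpha> \<le> scale \<beta> (\<beta> - \<alpha>)"
    using scale_ge[of \<alpha> \<beta>] scale_ge[of \<beta> \<alpha>] E fl by (auto simp: abs_minus_commute)
  show "f \<beta> - f \<alpha> \<le> 2 ^ b * (A + B)"
  proof (cases "\<beta> - \<alpha> \<le> 2 * (z - \<alpha>)")
    case True
    then have "scale \<alpha> (\<beta> - \<alpha>) \<le> 2 ^ b * A"
      unfolding A_def using E z by (intro scale_le_mult) auto
    then show ?thesis using ge(1) mult_pos_pos[OF _ pos(2), of "2 ^ b"] by (simp add: distrib_left)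
  next
    case False
    then have "scale \<beta> (\<beta> - \<alpha>) \<le> 2 ^ b * B"
      unfolding B_def using E z by (intro scale_le_mult) auto
    then show ?thesis using ge(2) mult_pos_pos[OF _ pos(1), of "2 ^ b"] by (simp add: distrib_left)
  qed
qed

lemma gap_between:
  assumes "gap \<alpha> \<beta>" "\<alpha> < z" "z < \<beta>"
  shows "f \<alpha> < extend z" "extend z < f \<beta>"
proof -
  have "f \<alpha> < f \<beta>" using assms f_less by simp
  then have "0 < extend z - f \<alpha>" "0 < f \<beta> - extend z"
    using gap_ratio[OF assms] by (auto intro!: mult_pos_pos divide_pos_pos add_pos_pos)
  then show "f \<alpha> < extend z" "extend z < f \<beta>" by auto
qed

lemma extend_less_on:
  assumes e: "e \<in> E"
  shows "z < e \<Longrightarrow> extend z < f e" "e < z \<Longrightarrow> f e < extend z"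
proof -
  have "(z < e \<longrightarrow> extend z < f e) \<and> (e < z \<longrightarrow> f e < extend z)"
  proof (cases "z \<in> E")
    case True then show ?thesis by (simp add: extend_on f_less)
  next
    case False
    then show ?thesis
    proof (cases rule: complement_cases)
      case (gap \<alpha> \<beta>)
      have "e \<le> \<alpha> \<or> \<beta> \<le> e" using gap(1) e by (simp add: gap_def)
      then show ?thesis using gap gap_between[OF gap] f_le[of e \<alpha>] f_le[of \<beta> e] by auto
    next
      case (left \<beta>)
      then have "\<beta> \<le> e" using e by blast
      then show ?thesis using left extend_left_ray[OF left] scale_pos[OF left(1), of "\<beta> - z"] f_le[of \<beta> e] by auto
    next
      case (right \<alpha>)
      then have "e \<le> \<alpha>" using e by blast
      then show ?thesis using right extend_right_ray[OF right] scale_pos[OF right(1), of "z - \<alpha>"] f_le[of e \<alpha>] by auto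
    qed
  qed
  then show "z < e \<Longrightarrow> extend z < f e" "e < z \<Longrightarrow> f e < extend z" by auto
qed

lemma strict_mono_extend: "strict_mono extend"
proof (rule strict_monoI)
  fix u v :: real assume uv: "u < v"
  show "extend u < extend v"
  proof (cases "\<exists>e\<in>E. u \<le> e \<and> e \<le> v")
    case True
    then obtain e where e: "e \<in> E" "u \<le> e" "e \<le> v" by blast
    show ?thesis
      using e uv extend_less_on[OF e(1), of u] extend_less_on[OF e(1), of v] extend_on[OF e(1)]
      by (cases "u = e"; cases "v = e") auto
  next
    case False
    then have "u \<notin> E" using uv by auto
    then show ?thesis
    proof (cases rule: complement_cases)
      case (gap \<alpha> \<beta>)
      have v: "\<alpha> < v" "v < \<beta>" using gap uv False by (auto simp: gap_def not_less)
      have E: "\<alpha> \<in> E" "\<beta> \<in> E" "f \<alpha> < f \<beta>" using gap f_less by (auto simp: gap_def)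
      define A A' B B' where "A = scale \<alpha> (u - \<alpha>)" and "A' = scale \<alpha> (v - \<alpha>)"
        and "B = scale \<beta> (\<beta> - u)" and "B' = scale \<beta> (\<beta> - v)"
      have "A < A'" "B' < B" "0 < A" "0 < B'"
        unfolding A_def A'_def B_def B'_def using gap v uv
        by (auto intro!: bipower_strict_mono[OF scale_bipower a(1)] scale_pos E)
      then have "A * B' < A' * B" by (intro mult_strict_mono) auto
      then have "A / (A + B) < A' / (A' + B')"
        using \<open>0 < A\<close> \<open>0 < B'\<close> \<open>A < A'\<close> \<open>B' < B\<close> by (simp add: divide_simps algebra_simps add_pos_pos)
      then have "(f \<beta> - f \<alpha>) * (A / (A + B)) < (f \<beta> - f \<alpha>) * (A' / (A' + B'))"
        using E by (intro mult_strict_left_mono) auto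
      then show ?thesis unfolding extend_gap[OF gap] extend_gap[OF gap(1) v] A_def A'_def B_def B'_def by simp
    next
      case (left \<beta>)
      have v: "v < \<beta>" using left uv False by (auto simp: not_less)
      have "scale \<beta> (\<beta> - v) < scale \<beta> (\<beta> - u)"
        using left v uv by (intro bipower_strict_mono[OF scale_bipower a(1)]) auto
      then show ?thesis using extend_left_ray[OF left] extend_left_ray[OF left(1,2) v] by simp
    next
      case (right \<alpha>)
      have v: "\<alpha> < v" using right uv by auto
      have "scale \<alpha> (u - \<alpha>) < scale \<alpha> (v - \<alpha>)"
        using right v uv by (intro bipower_strict_mono[OF scale_bipower a(1)]) auto
      then show ?thesis using extend_right_ray[OF right] extend_right_ray[OF right(1,2) v] by simp
    qed
  qed
qed

definition "endpoint_const = 2 * C * 2 ^ b"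

lemma endpoint_const: "1 \<le> endpoint_const"
proof -
  have "1 * 1 \<le> (2 * C) * 2 ^ b" using C by (intro mult_mono) auto
  then show ?thesis by (simp add: endpoint_const_def)
qed

lemma gap_ratio_compare:
  fixes \<Delta> A S X :: real
  assumes X: "X = \<Delta> * (A / S)" and pos: "A > 0" "S > 0" "\<Delta> > 0" and S: "S \<le> 2 * C * \<Delta>" "\<Delta> \<le> 2 ^ b * S"
  shows "A \<le> endpoint_const * X" "X \<le> endpoint_const * A"
proof -
  have X0: "X > 0" using X pos by simp
  have XS: "X * S = \<Delta> * A" using X pos by simp
  have "\<Delta> * A \<le> X * (2 * C * \<Delta>)" using XS mult_left_mono[OF S(1), of X] X0 by simp
  then have "\<Delta> * A \<le> \<Delta> * (2 * C * X)" by (simp add: mult_ac)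
  then have "A \<le> 2 * C * X" using pos by simp
  also have "\<dots> \<le> endpoint_const * X" unfolding endpoint_const_def using C X0 by (intro mult_right_mono) auto
  finally show "A \<le> endpoint_const * X" .
  have "X * S \<le> 2 ^ b * S * A" using XS mult_right_mono[OF S(2), of A] pos by simp
  then have "S * X \<le> S * (2 ^ b * A)" by (simp add: mult_ac)
  then have "X \<le> 2 ^ b * A" using pos by simp
  also have "\<dots> \<le> endpoint_const * A"
  proof -
    have "1 * 2 ^ b \<le> 2 * C * 2 ^ b" using C by (intro mult_right_mono) auto
    then show ?thesis unfolding endpoint_const_def using pos by (intro mult_right_mono) auto
  qed
  finally show "X \<le> endpoint_const * A" .
qed

text \<open>
  From any \<open>e \<in> E\<close>, a point \<open>z\<close> of a gap is reached through the endpoint \<open>p\<close> of the gap on the side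
  of \<open>e\<close>. Stating this with absolute values treats the two sides and all kinds of gaps at once.
\<close>

lemma obtain_endpoint:
  assumes z: "z \<notin> E" and e: "e \<in> E"
  obtains p where "p \<in> E" "p \<noteq> z" "\<bar>z - e\<bar> = \<bar>z - p\<bar> + \<bar>p - e\<bar>"
    "\<bar>extend z - f e\<bar> = \<bar>extend z - f p\<bar> + \<bar>f p - f e\<bar>"
    "scale p \<bar>z - p\<bar> \<le> endpoint_const * \<bar>extend z - f p\<bar>" "\<bar>extend z - f p\<bar> \<le> endpoint_const * scale p \<bar>z - p\<bar>"
  using z
proof (cases rule: complement_cases)
  case (gap \<alpha> \<beta>)
  note E = gap(1)[unfolded gap_def]
  have fl: "f \<beta> - f \<alpha> > 0" using E f_less by simp
  note r = gap_ratio[OF gap]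
  have S: "scale \<alpha> (z - \<alpha>) + scale \<beta> (\<beta> - z) > 0" using r(3,4) by simp
  have 1: "scale \<alpha> \<bar>z - \<alpha>\<bar> \<le> endpoint_const * \<bar>extend z - f \<alpha>\<bar>" "\<bar>extend z - f \<alpha>\<bar> \<le> endpoint_const * scale \<alpha> \<bar>z - \<alpha>\<bar>"
    using gap_ratio_compare[OF r(1,3) S fl r(5,6)] gap gap_between[OF gap] by auto
  have 2: "scale \<beta> \<bar>z - \<beta>\<bar> \<le> endpoint_const * \<bar>extend z - f \<beta>\<bar>" "\<bar>extend z - f \<beta>\<bar> \<le> endpoint_const * scale \<beta> \<bar>z - \<beta>\<bar>"
    using gap_ratio_compare[OF r(2,4) S fl r(5,6)] gap gap_between[OF gap] by (auto simp: abs_if)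
  consider "e \<le> \<alpha>" | "\<beta> \<le> e" using E e by blast
  then show ?thesis
  proof cases
    case 1
    then show ?thesis using E gap gap_between[OF gap] \<open>scale \<alpha> _ \<le> _\<close> \<open>\<bar>extend z - f \<alpha>\<bar> \<le> _\<close> f_le[of e \<alpha>]
      by (intro that[of \<alpha>]) auto
  next
    case 2
    then show ?thesis using E gap gap_between[OF gap] \<open>scale \<beta> _ \<le> _\<close> \<open>\<bar>extend z - f \<beta>\<bar> \<le> _\<close> f_le[of \<beta> e]
      by (intro that[of \<beta>]) auto
  qed
next
  case (left \<beta>)
  have p: "scale \<beta> (\<beta> - z) > 0" using left by (intro scale_pos) auto
  then have "scale \<beta> (\<beta> - z) \<le> endpoint_const * scale \<beta> (\<beta> - z)" using endpoint_const by (simp add: mult_le_cancel_right1)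
  then show ?thesis using left p e extend_left_ray[OF left] f_le[of \<beta> e]
    by (intro that[of \<beta>]) (auto simp: abs_if)
next
  case (right \<alpha>)
  have p: "scale \<alpha> (z - \<alpha>) > 0" using right by (intro scale_pos) auto
  then have "scale \<alpha> (z - \<alpha>) \<le> endpoint_const * scale \<alpha> (z - \<alpha>)" using endpoint_const by (simp add: mult_le_cancel_right1)
  then show ?thesis using right p e extend_right_ray[OF right] f_le[of e \<alpha>]
    by (intro that[of \<alpha>]) auto
qed

definition "compare_const = 1 + 2 ^ b * C * shift_const * endpoint_const"

lemma compare_const_ge: "endpoint_const * shift_const + 1 \<le> compare_const" "2 ^ b * C \<le> compare_const" "2 ^ b * shift_const * endpoint_const \<le> compare_const" "C \<le> compare_const" "1 \<le> compare_const"
proof -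
  have p: "(1::real) \<le> 2 ^ b" by simp
  have pC: "1 \<le> 2 ^ b * C" using mult_mono[OF p C] C by simp
  have DD: "1 \<le> shift_const * endpoint_const" using mult_mono[OF shift_const(1) endpoint_const] shift_const endpoint_const by simp
  have "1 * (shift_const * endpoint_const) \<le> (2 ^ b * C) * (shift_const * endpoint_const)" using pC DD by (intro mult_right_mono) auto
  then show "endpoint_const * shift_const + 1 \<le> compare_const" by (simp add: compare_const_def mult_ac)
  have "(2 ^ b * C) * 1 \<le> (2 ^ b * C) * (shift_const * endpoint_const)" using pC DD by (intro mult_left_mono) auto
  then show 2: "2 ^ b * C \<le> compare_const" by (simp add: compare_const_def mult_ac)
  have "1 * (2 ^ b * shift_const * endpoint_const) \<le> C * (2 ^ b * shift_const * endpoint_const)" using C shift_const endpoint_const by (intro mult_right_mono) auto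
  then show "2 ^ b * shift_const * endpoint_const \<le> compare_const" by (simp add: compare_const_def mult_ac)
  have "1 * C \<le> 2 ^ b * C" using C by (intro mult_right_mono) auto
  then show "C \<le> compare_const" using 2 by simp
  then show "1 \<le> compare_const" using C by simp
qed

text \<open>
  On the way from \<open>e\<close> to \<open>z\<close> through the endpoint \<open>p\<close>, the longer of the two parts determines the size:
  if it is the part inside \<open>E\<close>, compare at \<open>e\<close>; if it is the part in the gap, compare at \<open>p\<close> and shift
  the base point to \<open>e\<close>.
\<close>

lemma extend_compare:
  assumes e: "e \<in> E" and z: "z \<noteq> e"
  shows "\<bar>extend z - f e\<bar> \<le> compare_const * scale e \<bar>z - e\<bar>" "scale e \<bar>z - e\<bar> \<le> compare_const * \<bar>extend z - f e\<bar>"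
proof -
  have sp: "scale e \<bar>z - e\<bar> > 0" using e z by (intro scale_pos) auto
  have "\<bar>extend z - f e\<bar> \<le> compare_const * scale e \<bar>z - e\<bar> \<and> scale e \<bar>z - e\<bar> \<le> compare_const * \<bar>extend z - f e\<bar>"
  proof (cases "z \<in> E")
    case True
    have "1 * scale e \<bar>z - e\<bar> \<le> compare_const * scale e \<bar>z - e\<bar>" "C * \<bar>f z - f e\<bar> \<le> compare_const * \<bar>f z - f e\<bar>"
      using compare_const_ge sp by (auto intro!: mult_right_mono)
    then show ?thesis using scale_ge[OF e True z] scale_le[OF e True z] by (simp add: extend_on[OF True])
  next
    case False
    from False e obtain p where p: "p \<in> E" "p \<noteq> z" "\<bar>z - e\<bar> = \<bar>z - p\<bar> + \<bar>p - e\<bar>"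
      "\<bar>extend z - f e\<bar> = \<bar>extend z - f p\<bar> + \<bar>f p - f e\<bar>"
      "scale p \<bar>z - p\<bar> \<le> endpoint_const * \<bar>extend z - f p\<bar>" "\<bar>extend z - f p\<bar> \<le> endpoint_const * scale p \<bar>z - p\<bar>"
      by (rule obtain_endpoint)
    define r where "r = \<bar>z - e\<bar>"
    have r: "r > 0" "\<bar>z - p\<bar> \<le> r" "\<bar>p - e\<bar> \<le> r" using z p(3) by (auto simp: r_def)
    have up1: "\<bar>f p - f e\<bar> \<le> scale e r"
    proof (cases "p = e")
      case True then show ?thesis using sp by (simp add: r_def)
    next
      case False
      then have "\<bar>f p - f e\<bar> \<le> scale e \<bar>p - e\<bar>" using p e by (intro scale_ge) auto
      also have "\<dots> \<le> scale e r" using e False r by (intro scale_mono) auto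
      finally show ?thesis .
    qed
    have "scale p \<bar>z - p\<bar> \<le> scale p r" using p r by (intro scale_mono) auto
    also have "\<dots> \<le> shift_const * scale e r" using p e r by (intro scale_shift) auto
    finally have "endpoint_const * scale p \<bar>z - p\<bar> \<le> endpoint_const * (shift_const * scale e r)" using endpoint_const by (intro mult_left_mono) auto
    then have "\<bar>extend z - f e\<bar> \<le> (endpoint_const * shift_const + 1) * scale e r" using up1 p(4,6) by (simp add: algebra_simps)
    also have "\<dots> \<le> compare_const * scale e r" using compare_const_ge(1) sp by (intro mult_right_mono) (auto simp: r_def)
    finally have upper: "\<bar>extend z - f e\<bar> \<le> compare_const * scale e r" .
    have lower: "scale e r \<le> compare_const * \<bar>extend z - f e\<bar>"
    proof (cases "\<bar>z - p\<bar> \<le> \<bar>p - e\<bar>")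
      case True
      then have ne: "p \<noteq> e" using p(3) z by auto
      have "scale e r \<le> 2 ^ b * scale e \<bar>p - e\<bar>"
        using e ne r True p(3) by (intro scale_le_mult) (auto simp: r_def)
      also have "\<dots> \<le> 2 ^ b * (C * \<bar>f p - f e\<bar>)" using e p ne by (intro mult_left_mono scale_le) auto
      also have "\<dots> = (2 ^ b * C) * \<bar>f p - f e\<bar>" by simp
      also have "\<dots> \<le> compare_const * \<bar>extend z - f e\<bar>" using compare_const_ge p(4) by (intro mult_mono) auto
      finally show ?thesis .
    next
      case False
      have "scale e r \<le> 2 ^ b * scale e \<bar>z - p\<bar>"
        using e r False p(2,3) by (intro scale_le_mult) (auto simp: r_def)
      also have "\<dots> \<le> 2 ^ b * (shift_const * scale p \<bar>z - p\<bar>)"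
        using e p False by (intro mult_left_mono scale_shift) (auto simp: abs_minus_commute)
      also have "\<dots> \<le> 2 ^ b * (shift_const * (endpoint_const * \<bar>extend z - f p\<bar>))"
        using shift_const p(5) by (intro mult_left_mono) auto
      also have "\<dots> = (2 ^ b * shift_const * endpoint_const) * \<bar>extend z - f p\<bar>" by simp
      also have "\<dots> \<le> compare_const * \<bar>extend z - f e\<bar>" using compare_const_ge p(4) by (intro mult_mono) auto
      finally show ?thesis .
    qed
    show ?thesis using upper lower by (simp add: r_def)
  qed
  then show "\<bar>extend z - f e\<bar> \<le> compare_const * scale e \<bar>z - e\<bar>" "scale e \<bar>z - e\<bar> \<le> compare_const * \<bar>extend z - f e\<bar>" by auto
qed

definition "near_const K = 2 ^ b / a * K ^ b * (2 ^ b * K ^ b)"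

lemma near_const: "K \<ge> 1 \<Longrightarrow> 2 ^ b / a \<le> near_const K" "K \<ge> 1 \<Longrightarrow> 1 \<le> near_const K"
proof -
  assume K: "K \<ge> 1"
  have 1: "1 \<le> K ^ b" "1 \<le> 2 ^ b * K ^ b" using K mult_mono[of 1 "2 ^ b" 1 "K ^ b"] by auto
  then have "1 * 1 \<le> K ^ b * (2 ^ b * K ^ b)" by (intro mult_mono) auto
  then have "2 ^ b / a * 1 \<le> 2 ^ b / a * (K ^ b * (2 ^ b * K ^ b))" using a by (intro mult_left_mono) auto
  then show *: "2 ^ b / a \<le> near_const K" by (simp add: near_const_def)
  have "a \<le> 2 ^ b" using a by (simp add: order_trans[of a 1])
  then have "1 \<le> 2 ^ b / a" using a by simp
  then show "1 \<le> near_const K" using * by linarith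
qed

text \<open>
  The hypothesis says that \<open>z - \<bar>h\<bar>\<close> and \<open>z + \<bar>h\<bar>\<close> lie in the gap of \<open>z\<close> and that their distances from
  \<open>E\<close> are still a definite part \<open>1 / K\<close> of that of \<open>z\<close>.
\<close>

lemma extend_near:
  assumes z: "z \<notin> E" and K: "K \<ge> 1"
    and h: "\<And>e. e \<in> E \<Longrightarrow> \<bar>h\<bar> < \<bar>z - e\<bar> \<and> \<bar>z - e\<bar> \<le> K * (\<bar>z - e\<bar> - \<bar>h\<bar>)"
  shows "\<bar>extend (z + h) - extend z\<bar> \<le> near_const K * \<bar>extend z - extend (z - h)\<bar>"
proof -
  have ray: "\<bar>\<phi> (t + h) - \<phi> t\<bar> \<le> near_const K * \<bar>\<phi> t - \<phi> (t - h)\<bar>"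
    if \<phi>: "bipower a b \<phi>" and t: "\<bar>h\<bar> < t" for \<phi> h t
  proof -
    have "\<bar>\<phi> (t + h) - \<phi> t\<bar> \<le> 2 ^ b / a * \<bar>\<phi> t - \<phi> (t - h)\<bar>"
    proof -
      consider "h = 0" | "h > 0" | "h < 0" by linarith
      then show ?thesis
      proof cases
        case 2
        then show ?thesis using bipower_increments[OF \<phi> a b 2] t
            bipower_mono[OF \<phi> a(1), of t "t + h"] bipower_mono[OF \<phi> a(1), of "t - h" t] by auto
      next
        case 3
        then show ?thesis using bipower_increments[OF \<phi> a b, of "- h" t] t
            bipower_mono[OF \<phi> a(1), of "t + h" t] bipower_mono[OF \<phi> a(1), of t "t - h"] by auto
      qed auto
    qed
    also have "\<dots> \<le> near_const K * \<bar>\<phi> t - \<phi> (t - h)\<bar>" using near_const(1)[OF K] by (intro mult_right_mono) auto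
    finally show ?thesis .
  qed
  from z show ?thesis
  proof (cases rule: complement_cases)
    case (gap \<alpha> \<beta>)
    note E = gap(1)[unfolded gap_def]
    have fl: "f \<beta> - f \<alpha> > 0" using E f_less by simp
    define G where "G s = scale \<alpha> (z - \<alpha> + s) / (scale \<alpha> (z - \<alpha> + s) + scale \<beta> (\<beta> - z - s))" for s
    have hh: "\<bar>h\<bar> < z - \<alpha>" "z - \<alpha> \<le> K * (z - \<alpha> - \<bar>h\<bar>)" "\<bar>h\<bar> < \<beta> - z" "\<beta> - z \<le> K * (\<beta> - z - \<bar>h\<bar>)"
      using h[of \<alpha>] h[of \<beta>] E gap by auto
    have ext: "extend (z + s) = f \<alpha> + (f \<beta> - f \<alpha>) * G s" if "\<bar>s\<bar> \<le> \<bar>h\<bar>" for s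
      using extend_gap[OF gap(1), of "z + s"] hh that by (simp add: G_def algebra_simps)
    have "\<bar>G h - G 0\<bar> \<le> near_const K * \<bar>G 0 - G (- h)\<bar>"
      unfolding near_const_def
      by (rule bipower_ratio_triples[where \<phi> = "scale \<alpha>" and \<psi> = "scale \<beta>", OF _ _ a b K hh])
         (use E in \<open>auto intro: scale_bipower simp: G_def\<close>)
    then have "(f \<beta> - f \<alpha>) * \<bar>G h - G 0\<bar> \<le> (f \<beta> - f \<alpha>) * (near_const K * \<bar>G 0 - G (- h)\<bar>)"
      using fl by (intro mult_left_mono) auto
    moreover have "\<bar>extend (z + h) - extend z\<bar> = (f \<beta> - f \<alpha>) * \<bar>G h - G 0\<bar>"
      using ext[of h] ext[of 0] fl by (simp add: right_diff_distrib[symmetric] abs_mult)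
    moreover have "\<bar>extend z - extend (z - h)\<bar> = (f \<beta> - f \<alpha>) * \<bar>G 0 - G (- h)\<bar>"
      using ext[of "- h"] ext[of 0] fl by (simp add: right_diff_distrib[symmetric] abs_mult)
    ultimately show ?thesis by (simp add: mult_ac)
  next
    case (left \<beta>)
    have hh: "\<bar>h\<bar> < \<beta> - z" using h[of \<beta>] left by auto
    have ext: "extend (z + s) = f \<beta> - scale \<beta> (\<beta> - z - s)" if "\<bar>s\<bar> \<le> \<bar>h\<bar>" for s
      using extend_left_ray[OF left(1,2), of "z + s"] hh that by (simp add: algebra_simps)
    show ?thesis
      using ray[OF scale_bipower[OF left(1)], of "- h" "\<beta> - z"] hh ext[of h] ext[of 0] ext[of "- h"]
      by (simp add: abs_minus_commute)
  next
    case (right \<alpha>)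
    have hh: "\<bar>h\<bar> < z - \<alpha>" using h[of \<alpha>] right by auto
    have ext: "extend (z + s) = f \<alpha> + scale \<alpha> (z - \<alpha> + s)" if "\<bar>s\<bar> \<le> \<bar>h\<bar>" for s
      using extend_right_ray[OF right(1,2), of "z + s"] hh that by (simp add: algebra_simps)
    show ?thesis
      using ray[OF scale_bipower[OF right(1)], of h "z - \<alpha>"] hh ext[of h] ext[of 0] ext[of "- h"] by simp
  qed
qed

text \<open>
  If \<open>\<bar>h\<bar>\<close> is not small compared with the distance of \<open>x\<close> from \<open>E\<close>, the increment of the extension is
  as large as \<open>scale e \<bar>h\<bar>\<close>. For huge \<open>\<bar>h\<bar>\<close> the value at \<open>x\<close> is negligible against that at \<open>x + h\<close>,
  both seen from \<open>e\<close>. For moderate \<open>\<bar>h\<bar>\<close> the increment is compared, inside the gap, with the one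
  towards a point \<open>x + w\<close> so close to \<open>e\<close> that its image is negligibly close to \<open>f e\<close>.
\<close>

lemma extend_far:
  assumes x: "x \<notin> E" and e: "e \<in> E" "\<And>e'. e' \<in> E \<Longrightarrow> \<bar>x - e\<bar> \<le> \<bar>x - e'\<bar>"
    and K: "K \<ge> 2" "2 * compare_const ^ 2 \<le> K powr a" and N: "N \<ge> 2" "2 * compare_const ^ 2 * 2 ^ b \<le> N powr a"
    and h: "(1 - 1 / K) * \<bar>x - e\<bar> < \<bar>h\<bar>"
  shows "scale e \<bar>h\<bar> \<le> 2 * compare_const * 2 ^ b * near_const K * N ^ b * \<bar>extend (x + h) - extend x\<bar>"
proof -
  define d where "d = \<bar>x - e\<bar>"
  define X where "X = \<bar>extend (x + h) - extend x\<bar>"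
  have d: "d > 0" using x e by (auto simp: d_def)
  have compare_const: "compare_const \<ge> 1" by (rule compare_const_ge)
  have k: "0 < (1 - 1 / K) * d" using K d by simp
  then have h0: "h \<noteq> 0" using h by (auto simp: d_def)
  have nc: "near_const K \<ge> 1" using K by (intro near_const) auto
  have Nb: "N ^ b \<ge> 1" using N by simp
  have xe: "\<bar>extend x - f e\<bar> \<le> compare_const * scale e d" "scale e d \<le> compare_const * \<bar>extend x - f e\<bar>"
    using extend_compare[OF e(1), of x] x e unfolding d_def by auto
  show ?thesis
  proof (cases "N * d \<le> \<bar>h\<bar>")
    case True
    have Nd: "2 * d \<le> \<bar>h\<bar>" using True N d by (meson mult_right_mono order_trans less_imp_le)
    then have hd: "\<bar>h\<bar> / 2 \<le> \<bar>x + h - e\<bar>"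
      using abs_triangle_ineq4[of "x + h - e" "x - e"] unfolding d_def by simp
    then have ne: "x + h \<noteq> e" using h0 by auto
    have "scale e \<bar>h\<bar> \<le> 2 ^ b * scale e \<bar>x + h - e\<bar>"
      using e h0 ne hd by (intro scale_le_mult) auto
    also have "\<dots> \<le> 2 ^ b * (compare_const * \<bar>extend (x + h) - f e\<bar>)"
      using e ne by (intro mult_left_mono extend_compare) auto
    finally have 1: "scale e \<bar>h\<bar> \<le> 2 ^ b * compare_const * \<bar>extend (x + h) - f e\<bar>" by simp
    have "N powr a * scale e d \<le> scale e (N * d)"
      using e d N by (intro bipower_lower[OF scale_bipower]) auto
    also have "\<dots> \<le> scale e \<bar>h\<bar>" using e d N True by (intro scale_mono) auto
    finally have "N powr a * scale e d \<le> scale e \<bar>h\<bar>" .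
    moreover have "(2 * compare_const ^ 2 * 2 ^ b) * scale e d \<le> N powr a * scale e d"
      using N scale_pos[OF e(1) d] by (intro mult_right_mono) auto
    ultimately have 2: "(2 * compare_const ^ 2 * 2 ^ b) * scale e d \<le> scale e \<bar>h\<bar>" by linarith
    have "2 * compare_const * 2 ^ b * \<bar>extend x - f e\<bar> \<le> 2 * compare_const * 2 ^ b * (compare_const * scale e d)"
      using xe compare_const by (intro mult_left_mono) auto
    also have "\<dots> \<le> scale e \<bar>h\<bar>" using 2 by (simp add: power2_eq_square mult_ac)
    finally have 3: "2 * compare_const * 2 ^ b * \<bar>extend x - f e\<bar> \<le> scale e \<bar>h\<bar>" .
    have "\<bar>extend (x + h) - f e\<bar> \<le> X + \<bar>extend x - f e\<bar>" unfolding X_def by linarith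
    then have "2 * compare_const * 2 ^ b * \<bar>extend (x + h) - f e\<bar> \<le> 2 * compare_const * 2 ^ b * (X + \<bar>extend x - f e\<bar>)"
      using compare_const by (intro mult_left_mono) auto
    then have "scale e \<bar>h\<bar> \<le> 2 * compare_const * 2 ^ b * X" using 1 3 by (simp add: distrib_left mult_ac)
    also have "\<dots> \<le> (2 * compare_const * 2 ^ b * X) * (near_const K * N ^ b)"
    proof -
      have "1 * 1 \<le> near_const K * N ^ b" using nc Nb by (intro mult_mono) auto
      moreover have "0 \<le> 2 * compare_const * 2 ^ b * X" using compare_const by (simp add: X_def)
      ultimately have "(2 * compare_const * 2 ^ b * X) * (1 * 1) \<le> (2 * compare_const * 2 ^ b * X) * (near_const K * N ^ b)"
        by (rule mult_left_mono)
      then show ?thesis by simp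
    qed
    finally show ?thesis by (simp add: X_def mult_ac)
  next
    case False
    define w where "w = (1 - 1 / K) * (e - x)"
    have aw: "\<bar>w\<bar> = (1 - 1 / K) * d" using K by (simp add: w_def d_def abs_mult abs_minus_commute)
    define y where "y = x + w"
    have ye: "\<bar>y - e\<bar> = d / K"
    proof -
      have "y - e = (x - e) / K" using K by (simp add: y_def w_def field_simps)
      then show ?thesis using K by (simp add: d_def)
    qed
    have yne: "y \<noteq> e" using ye d K by auto
    have dK: "d / K > 0" using d K by simp
    have "K powr a * scale e (d / K) \<le> scale e (K * (d / K))"
      using e dK K by (intro bipower_lower[OF scale_bipower]) auto
    then have "K powr a * scale e (d / K) \<le> scale e d" using K by simp
    moreover have "2 * compare_const ^ 2 * scale e (d / K) \<le> K powr a * scale e (d / K)"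
      using K scale_pos[OF e(1) dK] by (intro mult_right_mono) auto
    ultimately have 1: "2 * compare_const ^ 2 * scale e (d / K) \<le> scale e d" by linarith
    have "2 * compare_const * \<bar>extend y - f e\<bar> \<le> 2 * compare_const * (compare_const * scale e (d / K))"
      using extend_compare(1)[OF e(1) yne] compare_const unfolding ye by (intro mult_left_mono) auto
    also have "\<dots> \<le> scale e d" using 1 by (simp add: power2_eq_square mult_ac)
    finally have 2: "2 * compare_const * \<bar>extend y - f e\<bar> \<le> scale e d" .
    have "\<bar>extend x - f e\<bar> \<le> \<bar>extend y - extend x\<bar> + \<bar>extend y - f e\<bar>" by linarith
    then have "2 * compare_const * \<bar>extend x - f e\<bar> \<le> 2 * compare_const * (\<bar>extend y - extend x\<bar> + \<bar>extend y - f e\<bar>)"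
      using compare_const by (intro mult_left_mono) auto
    then have 3: "scale e d \<le> 2 * compare_const * \<bar>extend (x + w) - extend x\<bar>"
      using 2 xe by (simp add: distrib_left y_def)
    have near: "\<bar>w\<bar> < \<bar>x - e'\<bar> \<and> \<bar>x - e'\<bar> \<le> K * (\<bar>x - e'\<bar> - \<bar>w\<bar>)" if "e' \<in> E" for e'
    proof -
      have le: "d \<le> \<bar>x - e'\<bar>" using e(2)[OF that] by (simp add: d_def)
      have "d / K > 0" using d K by simp
      then have "\<bar>w\<bar> < d" unfolding aw by (simp add: left_diff_distrib)
      moreover have "K * (\<bar>x - e'\<bar> - \<bar>w\<bar>) = \<bar>x - e'\<bar> + (K - 1) * (\<bar>x - e'\<bar> - d)"
        unfolding aw using K by (simp add: field_simps)
      moreover have "0 \<le> (K - 1) * (\<bar>x - e'\<bar> - d)" using K le by (intro mult_nonneg_nonneg) auto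
      ultimately show ?thesis using le by linarith
    qed
    have 4: "\<bar>extend (x + w) - extend x\<bar> \<le> near_const K * \<bar>extend (x + v) - extend x\<bar>"
      if "v = w \<or> v = - w" for v
    proof -
      have "\<bar>extend (x + w) - extend x\<bar> \<le> near_const K * \<bar>extend x - extend (x - w)\<bar>"
        using K near by (intro extend_near[OF x]) auto
      moreover have "1 * \<bar>extend (x + w) - extend x\<bar> \<le> near_const K * \<bar>extend (x + w) - extend x\<bar>"
        using nc by (intro mult_right_mono) auto
      ultimately show ?thesis using that by (auto simp: abs_minus_commute)
    qed
    define v where "v = (if h > 0 then \<bar>w\<bar> else - \<bar>w\<bar>)"
    have hw: "\<bar>w\<bar> < \<bar>h\<bar>" using h aw by (simp add: d_def)
    have "\<bar>extend (x + v) - extend x\<bar> \<le> X"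
    proof (cases "h > 0")
      case True
      then have "extend x \<le> extend (x + v)" "extend (x + v) \<le> extend (x + h)"
        using hw by (auto simp: v_def strict_mono_less_eq[OF strict_mono_extend])
      then show ?thesis by (simp add: X_def)
    next
      case False
      then have "extend (x + v) \<le> extend x" "extend (x + h) \<le> extend (x + v)"
        using hw by (auto simp: v_def strict_mono_less_eq[OF strict_mono_extend])
      then show ?thesis by (simp add: X_def)
    qed
    moreover have "v = w \<or> v = - w" unfolding v_def by (auto simp: abs_if)
    ultimately have "\<bar>extend (x + w) - extend x\<bar> \<le> near_const K * X"
      using 4[of v] nc by (meson mult_left_mono order_trans zero_le_one)
    then have "2 * compare_const * \<bar>extend (x + w) - extend x\<bar> \<le> 2 * compare_const * (near_const K * X)"
      using compare_const by (intro mult_left_mono) auto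
    with 3 have 5: "scale e d \<le> 2 * compare_const * near_const K * X" by simp
    have "scale e \<bar>h\<bar> \<le> N ^ b * scale e d" using False e h0 d N by (intro scale_le_mult) auto
    also have "\<dots> \<le> N ^ b * (2 * compare_const * near_const K * X)" using 5 N by (intro mult_left_mono) auto
    also have "\<dots> \<le> 2 ^ b * (N ^ b * (2 * compare_const * near_const K * X))"
    proof -
      have "1 * (N ^ b * (2 * compare_const * near_const K * X)) \<le> 2 ^ b * (N ^ b * (2 * compare_const * near_const K * X))"
        using N compare_const nc by (intro mult_right_mono) (auto simp: X_def)
      then show ?thesis by simp
    qed
    finally show ?thesis by (simp add: X_def mult_ac)
  qed
qed

text \<open>
  There are three regimes: at points of \<open>E\<close> both increments are comparable with \<open>scale x \<bar>h\<bar>\<close>; at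
  distance from \<open>E\<close> large compared with \<open>\<bar>h\<bar>\<close> the triple stays in one gap; otherwise both increments
  are comparable with \<open>scale e \<bar>h\<bar>\<close> for the nearest point \<open>e\<close>.
\<close>

lemma extend_triples: "\<exists>Q. \<forall>x h. \<bar>extend (x + h) - extend x\<bar> \<le> Q * \<bar>extend x - extend (x - h)\<bar>"
proof -
  obtain K where K: "K \<ge> 2" "2 * compare_const ^ 2 \<le> K powr a" by (rule obtain_powr_ge[OF a(1)])
  obtain N where N: "N \<ge> 2" "2 * compare_const ^ 2 * 2 ^ b \<le> N powr a" by (rule obtain_powr_ge[OF a(1)])
  define c where "c = 2 * compare_const * 2 ^ b * near_const K * N ^ b"
  have compare_const: "compare_const \<ge> 1" by (rule compare_const_ge)
  have nc: "near_const K \<ge> 1" using K by (intro near_const) auto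
  have c: "c \<ge> 0" unfolding c_def using compare_const nc N by simp
  define Q where "Q = compare_const * compare_const + near_const K + 2 * compare_const * 3 ^ b * c"
  have "\<bar>extend (x + h) - extend x\<bar> \<le> Q * \<bar>extend x - extend (x - h)\<bar>" for x h
  proof -
    define Y where "Y = \<bar>extend x - extend (x - h)\<bar>"
    have Y: "Y \<ge> 0" by (simp add: Y_def)
    consider "h = 0" | "x \<in> E" "h \<noteq> 0" | "x \<notin> E" "h \<noteq> 0" by blast
    then have "\<exists>q\<in>{compare_const * compare_const, near_const K, 2 * compare_const * 3 ^ b * c}. \<bar>extend (x + h) - extend x\<bar> \<le> q * Y"
    proof cases
      case 1
      then show ?thesis using compare_const by (intro bexI[of _ "compare_const * compare_const"]) (auto simp: Y_def)
    next
      case 2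
      have "\<bar>extend (x + h) - f x\<bar> \<le> compare_const * scale x \<bar>x + h - x\<bar>" using 2 by (intro extend_compare) auto
      also have "\<dots> \<le> compare_const * (compare_const * \<bar>extend (x - h) - f x\<bar>)"
        using extend_compare(2)[OF 2(1), of "x - h"] 2 compare_const by (intro mult_left_mono) auto
      finally show ?thesis using 2 by (simp add: Y_def extend_on abs_minus_commute mult_ac)
    next
      case 3
      have "E \<noteq> {}" using nontrivial by auto
      obtain e where e: "e \<in> E" "\<And>e'. e' \<in> E \<Longrightarrow> \<bar>x - e\<bar> \<le> \<bar>x - e'\<bar>"
        using distance_attains_inf[OF closed \<open>E \<noteq> {}\<close>, of x] by (auto simp: dist_real_def)
      define d where "d = \<bar>x - e\<bar>"
      have d: "d > 0" using 3 e by (auto simp: d_def)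
      show ?thesis
      proof (cases "\<bar>h\<bar> \<le> (1 - 1 / K) * d")
        case True
        have "\<bar>extend (x + h) - extend x\<bar> \<le> near_const K * \<bar>extend x - extend (x - h)\<bar>"
        proof (rule extend_near[OF 3(1)])
          fix e' assume "e' \<in> E"
          then have le: "d \<le> \<bar>x - e'\<bar>" using e(2) by (simp add: d_def)
          have "d / K > 0" using d K by simp
          then have "\<bar>h\<bar> < d" using True by (simp add: left_diff_distrib)
          moreover have "K * \<bar>h\<bar> \<le> K * ((1 - 1 / K) * d)" using True K by (intro mult_left_mono) auto
          moreover have "K * ((1 - 1 / K) * d) = (K - 1) * d" using K by (simp add: field_simps)
          moreover have "(K - 1) * d \<le> (K - 1) * \<bar>x - e'\<bar>" using le K by (intro mult_left_mono) auto
          ultimately show "\<bar>h\<bar> < \<bar>x - e'\<bar> \<and> \<bar>x - e'\<bar> \<le> K * (\<bar>x - e'\<bar> - \<bar>h\<bar>)"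
            using le by (simp add: algebra_simps)
        qed (use K in simp)
        then show ?thesis by (simp add: Y_def)
      next
        case False
        \<comment> \<open>From here on \<open>e\<close> is so close to \<open>x\<close> that all the points involved are within \<open>3 \<bar>h\<bar>\<close> of it.\<close>
        have "1 / 2 \<le> 1 - 1 / K" using K by (simp add: field_simps)
        then have "1 / 2 * d \<le> (1 - 1 / K) * d" using d by (intro mult_right_mono) auto
        also have "\<dots> < \<bar>h\<bar>" using False by simp
        finally have d2: "d < 2 * \<bar>h\<bar>" by simp
        have sp: "scale e \<bar>h\<bar> > 0" using e 3 by (intro scale_pos) auto
        have bnd: "\<bar>extend z - f e\<bar> \<le> compare_const * 3 ^ b * scale e \<bar>h\<bar>" if "\<bar>z - e\<bar> \<le> 3 * \<bar>h\<bar>" for z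
        proof (cases "z = e")
          case True then show ?thesis using sp compare_const e by (simp add: extend_on)
        next
          case False
          have "\<bar>extend z - f e\<bar> \<le> compare_const * scale e \<bar>z - e\<bar>" using e False by (intro extend_compare) auto
          also have "\<dots> \<le> compare_const * (3 ^ b * scale e \<bar>h\<bar>)"
            using that False e 3 compare_const by (intro mult_left_mono scale_le_mult) auto
          finally show ?thesis by simp
        qed
        have "\<bar>x + h - e\<bar> \<le> 3 * \<bar>h\<bar>" "\<bar>x - e\<bar> \<le> 3 * \<bar>h\<bar>"
          using d2 unfolding d_def by linarith+
        then have "\<bar>extend (x + h) - extend x\<bar> \<le> 2 * (compare_const * 3 ^ b * scale e \<bar>h\<bar>)"
          using bnd[of "x + h"] bnd[of x] by linarith
        also have "scale e \<bar>h\<bar> \<le> c * Y"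
          using extend_far[OF 3(1) e K N, of "- h"] False
          by (simp add: c_def Y_def d_def abs_minus_commute)
        then have "2 * (compare_const * 3 ^ b * scale e \<bar>h\<bar>) \<le> 2 * (compare_const * 3 ^ b * (c * Y))"
          using compare_const by (intro mult_left_mono) auto
        finally show ?thesis by (simp add: mult_ac)
      qed
    qed
    then obtain q where q: "q \<in> {compare_const * compare_const, near_const K, 2 * compare_const * 3 ^ b * c}" "\<bar>extend (x + h) - extend x\<bar> \<le> q * Y" by blast
    have "q \<le> Q" unfolding Q_def using q(1) compare_const nc c by (auto intro!: add_nonneg_nonneg mult_nonneg_nonneg)
    then have "q * Y \<le> Q * Y" using Y by (rule mult_right_mono)
    then show ?thesis using q(2) by (simp add: Y_def)
  qed
  then show ?thesis by blast
qed

end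

section \<open>Extension from relatively connected sets\<close>

lemma quasisymmetric_on_cong:
  assumes "quasisymmetric_on E f" "\<And>x. x \<in> E \<Longrightarrow> f x = g x"
  shows "quasisymmetric_on E g"
proof -
  have im: "f ` E = g ` E" using assms(2) by (rule image_cong[OF refl])
  have "homeomorphism E (g ` E) g h" if "homeomorphism E (f ` E) f h" for h
    by (rule homeomorphism_cong[OF that]) (use assms(2) im in auto)
  then show ?thesis using assms unfolding quasisymmetric_on_def by auto
qed

lemma quasisymmetric_on_uminus:
  fixes f :: "real \<Rightarrow> real"
  assumes "quasisymmetric_on E f"
  shows "quasisymmetric_on E (\<lambda>x. - f x)"
proof -
  obtain h where h: "homeomorphism E (f ` E) f h" using assms unfolding quasisymmetric_on_def by blast
  have "homeomorphism (f ` E) (uminus ` f ` E) uminus uminus"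
    by (auto simp: homeomorphism_def image_image intro!: continuous_intros)
  from homeomorphism_compose[OF h this]
  have "homeomorphism E ((\<lambda>x. - f x) ` E) (\<lambda>x. - f x) (h \<circ> uminus)" by (simp add: o_def image_image)
  then show ?thesis using assms unfolding quasisymmetric_on_def by (auto simp: dist_minus)
qed

lemma increasing_quasisymmetric_extension:
  fixes E :: "real set" and f :: "real \<Rightarrow> real"
  assumes rc: "relatively_connected E" and qs: "quasisymmetric_on E f"
    and f: "strict_mono f" "continuous_on UNIV f"
  shows "\<exists>F. strict_mono F \<and> (\<exists>G. homeomorphism UNIV UNIV F G) \<and> quasisymmetric_on UNIV F \<and> (\<forall>x\<in>E. F x = f x)"
proof (cases "\<exists>x\<in>E. \<exists>y\<in>E. x \<noteq> y")
  case False
  \<comment> \<open>A set with at most one point: a translation extends.\<close>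
  define c where "c = (if E = {} then 0 else f (SOME p. p \<in> E) - (SOME p. p \<in> E))"
  define F where "F x = x + c" for x
  have mono: "strict_mono F" by (simp add: F_def strict_mono_def)
  have "(\<exists>G. homeomorphism UNIV UNIV F G) \<and> quasisymmetric_on UNIV F"
    by (rule quasisymmetric_if_symmetric_triples[OF mono, of 1]) (simp add: F_def)
  moreover have "F x = f x" if "x \<in> E" for x
  proof -
    have "E = {x}" using that False by auto
    then show ?thesis by (simp add: F_def c_def)
  qed
  ultimately show ?thesis using mono by blast
next
  case True
  obtain a :: real and b :: nat and C :: real where abC: "0 < a" "a \<le> 1" "1 \<le> b" "1 \<le> C"
    and pq: "\<And>x y z. x \<in> E \<Longrightarrow> y \<in> E \<Longrightarrow> z \<in> E \<Longrightarrow> x \<noteq> z \<Longrightarrow>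
       dist (f x) (f y) \<le> C * dist (f x) (f z) * max ((dist x y / dist x z) powr a) ((dist x y / dist x z) ^ b)"
    by (rule relatively_connected_power_quasisymmetric[OF rc qs]) blast
  interpret power_quasisymmetric_embedding "closure E" f a b C
  proof
    show "\<exists>x\<in>closure E. \<exists>y\<in>closure E. x \<noteq> y" using True closure_subset by blast
    fix x y z assume "x \<in> closure E" "y \<in> closure E" "z \<in> closure E" "x \<noteq> z"
    from power_quasisymmetric_closure[OF f(2) abC(1) pq this]
    show "\<bar>f y - f x\<bar> \<le> C * \<bar>f z - f x\<bar> * gauge_hi a b (\<bar>y - x\<bar> / \<bar>z - x\<bar>)"
      by (simp add: gauge_hi_def dist_real_def abs_minus_commute)
  qed (use abC f in auto)
  obtain Q where Q: "\<And>x h. \<bar>extend (x + h) - extend x\<bar> \<le> Q * \<bar>extend x - extend (x - h)\<bar>"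
    using extend_triples by blast
  have "\<forall>x\<in>E. extend x = f x" using closure_subset[of E] extend_on by blast
  with quasisymmetric_if_symmetric_triples[OF strict_mono_extend Q] strict_mono_extend show ?thesis by blast
qed

text \<open>
  Betweenness is preserved by an injective continuous function. Comparing both pairs \<open>0, 1\<close> and
  \<open>x, y\<close> with a larger interval \<open>[m, M]\<close> therefore shows that they are ordered in the same way.
\<close>

lemma homeomorphism_real_cases:
  fixes F :: "real \<Rightarrow> real"
  assumes "homeomorphism UNIV UNIV F G"
  shows "strict_mono F \<or> strict_mono (\<lambda>x. - F x)"
proof -
  have cont: "continuous_on UNIV F" and inj: "inj F"
    using assms by (auto simp: homeomorphism_def intro: inj_on_inverseI)
  have btw: "(F a < F x \<and> F x < F b) \<or> (F b < F x \<and> F x < F a)" if "a < x" "x < b" for a x b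
    using that continuous_on_subset[OF cont] inj_on_subset[OF inj] by (intro continuous_inj_imp_mono) auto
  have "F 0 \<noteq> F 1" using inj by (metis injD zero_neq_one)
  then consider "F 0 < F 1" | "F 1 < F 0" by linarith
  then show ?thesis
  proof cases
    case 1
    have "F x < F y" if "x < y" for x y
    proof (rule ccontr)
      assume "\<not> F x < F y"
      then have xy: "F y < F x" using that inj by (metis injD less_irrefl linorder_neqE)
      define m M where "m = min x 0 - 1" and "M = max y 1 + 1"
      have mM: "m < 0" "m < x" "1 < M" "y < M" "m < 1" by (auto simp: m_def M_def)
      have "F m < F M"
        using btw[of m 0 1] btw[of m 1 M] 1 mM by auto
      moreover have "F M < F m"
        using btw[of m x y] btw[of m y M] xy that mM by auto
      ultimately show False by simp
    qed
    then show ?thesis by (auto simp: strict_mono_def)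
  next
    case 2
    have "F y < F x" if "x < y" for x y
    proof (rule ccontr)
      assume "\<not> F y < F x"
      then have xy: "F x < F y" using that inj by (metis injD less_irrefl linorder_neqE)
      define m M where "m = min x 0 - 1" and "M = max y 1 + 1"
      have mM: "m < 0" "m < x" "1 < M" "y < M" "m < 1" by (auto simp: m_def M_def)
      have "F M < F m"
        using btw[of m 0 1] btw[of m 1 M] 2 mM by auto
      moreover have "F m < F M"
        using btw[of m x y] btw[of m y M] xy that mM by auto
      ultimately show False by simp
    qed
    then show ?thesis by (auto simp: strict_mono_def)
  qed
qed

lemma relatively_connected_imp_extension_property:
  fixes E :: "real set"
  assumes rc: "relatively_connected E"
  shows "quasisymmetric_extension_property E"
  unfolding quasisymmetric_extension_property_def
proof (intro allI impI, elim conjE exE)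
  fix f F G :: "real \<Rightarrow> real"
  assume qs: "quasisymmetric_on E f" and F: "homeomorphism UNIV UNIV F G" and Ff: "\<forall>x\<in>E. F x = f x"
  have cont: "continuous_on UNIV F" using F by (simp add: homeomorphism_def)
  have qsF: "quasisymmetric_on E F" using qs Ff by (auto intro: quasisymmetric_on_cong)
  from homeomorphism_real_cases[OF F]
  show "\<exists>F G. homeomorphism UNIV UNIV F G \<and> quasisymmetric_on UNIV F \<and> (\<forall>x\<in>E. F x = f x)"
  proof
    assume "strict_mono F"
    from increasing_quasisymmetric_extension[OF rc qsF this cont] Ff show ?thesis by metis
  next
    assume mono: "strict_mono (\<lambda>x. - F x)"
    obtain H H' where H: "homeomorphism UNIV UNIV H H'" "quasisymmetric_on UNIV H" "\<forall>x\<in>E. H x = - F x"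
      using increasing_quasisymmetric_extension[OF rc quasisymmetric_on_uminus[OF qsF] mono]
        continuous_on_minus[OF cont] by blast
    have "homeomorphism UNIV UNIV (uminus :: real \<Rightarrow> real) uminus"
      by (auto simp: homeomorphism_def intro!: continuous_intros)
    from homeomorphism_compose[OF H(1) this]
    have "homeomorphism UNIV UNIV (\<lambda>x. - H x) (H' \<circ> uminus)" by (simp add: o_def)
    then show ?thesis using quasisymmetric_on_uminus[OF H(2)] H(3) Ff by (metis minus_minus)
  qed
qed

section \<open>Shrinking clusters between widening gaps\<close>

text \<open>
  \<open>s n\<close> is the geometric mean of the radii \<open>s n / K n\<close> and \<open>K n * s n\<close> of an annulus that misses \<open>E\<close>,
  so that there is room on both sides of the sphere of radius \<open>s n\<close>. The points \<open>p\<close> and \<open>q\<close> serve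
  to normalise the infinite product of the factors \<open>lam n\<close>.
\<close>

locale widening_gaps =
  fixes E :: "real set" and x s K lam :: "nat \<Rightarrow> real" and p q :: real
  assumes x: "\<And>n. x n \<in> E" and s: "\<And>n. 0 < s n" and K: "\<And>n. 4 ^ (n + 3) \<le> K n"
    and lam: "\<And>n. 0 < lam n" "\<And>n. lam n \<le> 1"
    and gap: "\<And>n y. y \<in> E \<Longrightarrow> \<bar>y - x n\<bar> < s n / K n \<or> K n * s n < \<bar>y - x n\<bar>"
    and pq: "p \<in> E" "q \<in> E" "p \<noteq> q"
begin

definition inside :: "nat \<Rightarrow> real \<Rightarrow> bool" where
  "inside n t \<longleftrightarrow> \<bar>t - x n\<bar> \<le> s n"

lemma K_bounds: "64 \<le> K n" "32 * 4 ^ n \<le> K n - 1" "0 < K n" "real n < K n"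
proof -
  have *: "64 * (4::real) ^ n \<le> K n" using K[of n] by (simp add: power_add)
  have 1: "(1::real) \<le> 4 ^ n" by simp
  show "64 \<le> K n" "32 * 4 ^ n \<le> K n - 1" "0 < K n" using * 1 by linarith+
  have "real n < 2 ^ n" by (rule of_nat_less_two_power)
  also have "(2::real) ^ n \<le> 4 ^ n" by (intro power_mono) auto
  finally show "real n < K n" using * 1 by linarith
qed

lemma inside_iff:
  assumes "y \<in> E"
  shows "inside n y \<longleftrightarrow> \<bar>y - x n\<bar> < s n / K n" "\<not> inside n y \<longleftrightarrow> K n * s n < \<bar>y - x n\<bar>"
proof -
  have "s n / K n \<le> s n / 1" using K_bounds[of n] s[of n] by (intro divide_left_mono) auto
  moreover have "1 * s n \<le> K n * s n" using K_bounds[of n] s[of n] by (intro mult_right_mono) auto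
  ultimately show "inside n y \<longleftrightarrow> \<bar>y - x n\<bar> < s n / K n" "\<not> inside n y \<longleftrightarrow> K n * s n < \<bar>y - x n\<bar>"
    using gap[OF assms, of n] unfolding inside_def by auto
qed

lemma inside_x: "inside n (x n)"
  using s[of n] by (simp add: inside_def)

lemma inside_convex: "inside n u \<Longrightarrow> inside n v \<Longrightarrow> u \<le> t \<Longrightarrow> t \<le> v \<Longrightarrow> inside n t"
  unfolding inside_def by linarith

lemma outside_far:
  assumes "y \<in> E" "\<not> inside n y" "inside n t"
  shows "32 * 4 ^ n * s n \<le> \<bar>y - t\<bar>"
proof -
  have "K n * s n < \<bar>y - x n\<bar>" using inside_iff(2)[OF assms(1)] assms(2) by blast
  moreover have "\<bar>t - x n\<bar> \<le> s n" using assms(3) by (simp add: inside_def)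
  moreover have "32 * 4 ^ n * s n \<le> (K n - 1) * s n" using K_bounds[of n] s[of n] by (intro mult_right_mono) auto
  moreover have "\<bar>y - x n\<bar> \<le> \<bar>y - t\<bar> + \<bar>t - x n\<bar>" by linarith
  ultimately show ?thesis by (simp add: algebra_simps)
qed

lemma inside_close:
  assumes "y \<in> E" "z \<in> E" "inside n y" "inside n z"
  shows "\<bar>y - z\<bar> * K n \<le> 2 * s n"
proof -
  have "\<bar>y - z\<bar> \<le> \<bar>y - x n\<bar> + \<bar>z - x n\<bar>" by linarith
  also have "\<dots> \<le> 2 * (s n / K n)" using inside_iff(1)[OF assms(1)] inside_iff(1)[OF assms(2)] assms(3,4) by fastforce
  finally show ?thesis using K_bounds[of n] by (simp add: field_simps)
qed

text \<open>
  Infinitely many of the balls may contain a given pair of points, and then the product of their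
  factors may vanish. But two pairs of distinct points of \<open>E\<close> lie in the same balls up to finitely many, so the
  product converges to a positive limit after division by its value at the base pair \<open>p, q\<close>: a ball
  that contains the base pair dilates its exterior instead of shrinking its interior.
\<close>

definition engulfs_base :: "nat \<Rightarrow> bool" where "engulfs_base n \<longleftrightarrow> inside n p \<and> inside n q"

definition weight :: "nat \<Rightarrow> bool \<Rightarrow> real" where
  "weight n c = (if engulfs_base n then (if c then 1 else 1 / lam n) else (if c then lam n else 1))"

lemma weight_bounds: "0 < weight n c" "lam n \<le> weight n c" "weight n c \<le> 1 / lam n" "weight n True \<le> weight n False"
  "weight n True = lam n * weight n False"
  using lam[of n] by (auto simp: weight_def field_simps mult_le_one intro: order_trans)

definition density :: "nat \<Rightarrow> real \<Rightarrow> real" where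
  "density N t = (\<Prod>n<N. weight n (inside n t))"

definition mass :: "nat \<Rightarrow> real \<Rightarrow> real \<Rightarrow> real" where
  "mass N u v = integral {u..v} (density N)"

lemma density_pos: "0 < density N t"
  unfolding density_def by (intro prod_pos) (simp add: weight_bounds)

lemma density_le: "density N t \<le> (\<Prod>n<N. 1 / lam n)"
  unfolding density_def by (intro prod_mono) (auto simp: weight_bounds less_imp_le)

lemma density_integrable: "density N integrable_on {u..v}"
proof (rule measurable_bounded_by_integrable_imp_integrable)
  have m: "(\<lambda>t. weight n (inside n t)) \<in> borel_measurable borel" for n
  proof -
    have "(\<lambda>t. weight n (inside n t)) = (\<lambda>t. weight n False + (weight n True - weight n False) * indicat_real {x n - s n..x n + s n} t)"
      by (auto simp: fun_eq_iff inside_def abs_le_iff split: split_indicator)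
    also have "\<dots> \<in> borel_measurable borel" by measurable
    finally show ?thesis .
  qed
  have "density N \<in> borel_measurable borel"
    unfolding density_def by (intro borel_measurable_prod m)
  then have "density N \<in> borel_measurable lborel" by simp
  then show "density N \<in> borel_measurable (lebesgue_on {u..v})"
    by (intro measurable_restrict_space1 measurable_completion)
  show "(\<lambda>_. \<Prod>n<N. 1 / lam n) integrable_on {u..v}" by (rule integrable_const_ivl)
  show "norm (density N t) \<le> (\<Prod>n<N. 1 / lam n)" for t
    using density_le[of N t] density_pos[of N t] by simp
qed simp

lemma mass_add: "u \<le> v \<Longrightarrow> v \<le> w \<Longrightarrow> mass N u v + mass N v w = mass N u w"
  unfolding mass_def by (rule Henstock_Kurzweil_Integration.integral_combine) (auto intro: density_integrable)

lemma mass_nonneg: "0 \<le> mass N u v"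
  unfolding mass_def by (intro integral_nonneg density_integrable) (simp add: density_pos less_imp_le)

lemma mass_le:
  assumes "u \<le> v" "\<And>t. u \<le> t \<Longrightarrow> t \<le> v \<Longrightarrow> density N t \<le> c"
  shows "mass N u v \<le> c * (v - u)"
proof -
  have "mass N u v \<le> integral {u..v} (\<lambda>_. c)"
    unfolding mass_def by (intro integral_le density_integrable) (auto intro: assms)
  then show ?thesis using assms(1) by (simp add: mult.commute)
qed

lemma half_power_sum: "(\<Sum>n<N. (1/2::real) ^ (n + 2)) \<le> 1/2"
proof -
  have "(\<Sum>n<N. (1/2::real) ^ (n + 2)) = 1/2 - (1/2) ^ (N + 1)" by (induction N) auto
  then show ?thesis by simp
qed

text \<open>
  The balls with index in \<open>S\<close> that meet \<open>[u, v]\<close> cover at most half of the interval; elsewhere the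
  density is at least the product of the lower bounds \<open>g n\<close>. As an inequality of functions this reads
  \<open>density \<ge> G * (1 - sum of indicators)\<close>, since the right-hand side is not positive on the balls.
\<close>

lemma mass_ge:
  assumes uv: "u < v" and g: "\<And>n. 0 < g n"
    and ge: "\<And>n t. u \<le> t \<Longrightarrow> t \<le> v \<Longrightarrow> \<not> (S n \<and> inside n t) \<Longrightarrow> g n \<le> weight n (inside n t)"
    and small: "\<And>n t. u \<le> t \<Longrightarrow> t \<le> v \<Longrightarrow> S n \<Longrightarrow> inside n t \<Longrightarrow> 2 * s n \<le> (v - u) * (1/2) ^ (n + 2)"
  shows "(\<Prod>n<N. g n) * (v - u) / 2 \<le> mass N u v"
proof -
  define G where "G = (\<Prod>n<N. g n)"
  have G: "G > 0" unfolding G_def using g by (intro prod_pos) auto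
  define J where "J = {n. n < N \<and> S n \<and> (\<exists>t\<ge>u. t \<le> v \<and> inside n t)}"
  have J: "finite J" "J \<subseteq> {..<N}" by (auto simp: J_def)
  define B where "B n = {x n - s n..x n + s n}" for n
  define h where "h t = G * (1 - (\<Sum>n\<in>J. indicat_real (B n) t))" for t
  have B: "inside n t \<longleftrightarrow> t \<in> B n" for n t by (auto simp: inside_def B_def abs_le_iff)
  have ind: "(indicat_real (B n) has_integral 2 * s n) UNIV" for n
  proof -
    have "((\<lambda>_. 1) has_integral 2 * s n) {x n - s n..x n + s n}"
      using has_integral_const_real[of "1::real" "x n - s n" "x n + s n"] s[of n] by simp
    moreover have "indicat_real (B n) = (\<lambda>t. if t \<in> {x n - s n..x n + s n} then 1 else 0)"
      by (auto simp: fun_eq_iff B_def split: split_indicator)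
    ultimately show ?thesis by (simp only: has_integral_restrict_UNIV)
  qed
  have ind_on: "indicat_real (B n) integrable_on {u..v}" for n
    using ind[of n] by (intro integrable_on_subinterval[of _ UNIV]) auto
  have ind_le: "integral {u..v} (indicat_real (B n)) \<le> 2 * s n" for n
  proof -
    have "integral {u..v} (indicat_real (B n)) \<le> integral UNIV (indicat_real (B n))"
      using ind[of n] by (intro integral_subset_le ind_on) auto
    then show ?thesis using integral_unique[OF ind[of n]] by simp
  qed
  have h_int: "h integrable_on {u..v}"
    unfolding h_def using J by (intro integrable_on_mult_right integrable_diff integrable_sum ind_on integrable_const_ivl) auto
  have h_le: "h t \<le> density N t" if "t \<in> {u..v}" for t
  proof (cases "\<exists>n\<in>J. t \<in> B n")
    case True
    then obtain n where n: "n \<in> J" "t \<in> B n" by blast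
    have "indicat_real (B n) t \<le> (\<Sum>n\<in>J. indicat_real (B n) t)"
      using J n by (intro member_le_sum) auto
    then have "h t \<le> 0" unfolding h_def using n G by (simp add: mult_le_0_iff)
    then show ?thesis using density_pos[of N t] by linarith
  next
    case False
    then have "(\<Sum>n\<in>J. indicat_real (B n) t) = 0" by (intro sum.neutral) auto
    moreover have "G \<le> density N t" unfolding G_def density_def
    proof (intro prod_mono conjI)
      fix n assume "n \<in> {..<N}"
      then show "g n \<le> weight n (inside n t)"
        using that False by (intro ge) (auto simp: J_def B)
    qed (simp add: g less_imp_le)
    ultimately show ?thesis by (simp add: h_def)
  qed
  have "(\<Sum>n\<in>J. integral {u..v} (indicat_real (B n))) \<le> (\<Sum>n\<in>J. (v - u) * (1/2) ^ (n + 2))"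
  proof (rule sum_mono)
    fix n assume "n \<in> J"
    then have "2 * s n \<le> (v - u) * (1/2) ^ (n + 2)" using small by (auto simp: J_def)
    then show "integral {u..v} (indicat_real (B n)) \<le> (v - u) * (1/2) ^ (n + 2)" using ind_le[of n] by linarith
  qed
  also have "\<dots> \<le> (\<Sum>n<N. (v - u) * (1/2) ^ (n + 2))" using J uv by (intro sum_mono2) auto
  also have "\<dots> = (v - u) * (\<Sum>n<N. (1/2) ^ (n + 2))" by (simp only: sum_distrib_left)
  also have "\<dots> \<le> (v - u) * (1/2)" using uv half_power_sum[of N] by (intro mult_left_mono) auto
  finally have le: "(\<Sum>n\<in>J. integral {u..v} (indicat_real (B n))) \<le> (v - u) / 2" by simp
  have "((\<lambda>_. 1) has_integral (v - u)) {u..v}" using has_integral_const_real[of "1::real" u v] uv by simp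
  then have "(h has_integral G * ((v - u) - (\<Sum>n\<in>J. integral {u..v} (indicat_real (B n))))) {u..v}"
    unfolding h_def
    by (intro has_integral_mult_right has_integral_diff has_integral_sum integrable_integral ind_on J)
  then have "integral {u..v} h = G * ((v - u) - (\<Sum>n\<in>J. integral {u..v} (indicat_real (B n))))"
    by (rule integral_unique)
  then have "G * ((v - u) / 2) \<le> integral {u..v} h" using le G by simp
  also have "\<dots> \<le> mass N u v" unfolding mass_def by (intro integral_le h_int density_integrable h_le)
  finally show ?thesis by (simp add: G_def)
qed

text \<open>
  A ball that contains the base pair has radius at least \<open>K n * \<bar>p - q\<bar> / 2\<close>, so all but finitely many
  of them contain \<open>[- R, R]\<close>, where they have weight 1. Hence the densities eventually decrease on
  bounded intervals, and the masses converge.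
\<close>

lemma eventually_weight_le_1:
  obtains N0 where "\<And>n t. N0 \<le> n \<Longrightarrow> \<bar>t\<bar> \<le> R \<Longrightarrow> weight n (inside n t) \<le> 1"
proof -
  have pq0: "\<bar>p - q\<bar> > 0" using pq by simp
  obtain N0 where N0: "4 * (R + \<bar>p\<bar>) / \<bar>p - q\<bar> < 2 ^ N0" using real_arch_pow[of 2] by auto
  show ?thesis
  proof (rule that[of N0])
    fix n t assume n: "N0 \<le> n" and t: "\<bar>t\<bar> \<le> R"
    show "weight n (inside n t) \<le> 1"
    proof (cases "engulfs_base n")
      case False then show ?thesis using lam[of n] by (simp add: weight_def)
    next
      case True
      then have pi: "inside n p" "inside n q" by (auto simp: engulfs_base_def)
      have "(2::real) ^ N0 \<le> 4 ^ n"
        using order_trans[OF power_increasing[OF n, of "2::real"] power_mono[of "2::real" 4 n]] by simp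
      also have "\<dots> \<le> K n" using K_bounds(2)[of n] zero_less_power[of "4::real" n] by linarith
      finally have "4 * (R + \<bar>p\<bar>) / \<bar>p - q\<bar> \<le> K n" using N0 by linarith
      then have "4 * (R + \<bar>p\<bar>) \<le> \<bar>p - q\<bar> * K n" using pq0 by (simp add: field_simps)
      then have big: "2 * (R + \<bar>p\<bar>) \<le> s n" using inside_close[OF pq(1,2) pi] by linarith
      have "s n / K n \<le> s n / 2" using K_bounds[of n] s[of n] by (intro divide_left_mono) auto
      then have "\<bar>p - x n\<bar> \<le> s n / 2" using inside_iff(1)[OF pq(1), of n] pi by linarith
      have "\<bar>t - x n\<bar> \<le> (\<bar>t\<bar> + \<bar>p\<bar>) + \<bar>p - x n\<bar>" by linarith
      also have "\<dots> \<le> (R + \<bar>p\<bar>) + s n / 2"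
        using t \<open>\<bar>p - x n\<bar> \<le> s n / 2\<close> by (intro add_mono) auto
      also have "\<dots> \<le> s n" using big by simp
      finally have "inside n t" by (simp add: inside_def)
      then show ?thesis using True by (simp add: weight_def)
    qed
  qed
qed

lemma eventually_density_bound:
  obtains N0 c where "c > 0"
    "\<And>N t. N0 \<le> N \<Longrightarrow> \<bar>t\<bar> \<le> R \<Longrightarrow> density N t \<le> c"
    "\<And>N t. N0 \<le> N \<Longrightarrow> \<bar>t\<bar> \<le> R \<Longrightarrow> density (Suc N) t \<le> density N t"
proof -
  obtain N0 where N0: "\<And>n t. N0 \<le> n \<Longrightarrow> \<bar>t\<bar> \<le> R \<Longrightarrow> weight n (inside n t) \<le> 1"
    by (rule eventually_weight_le_1) blast
  have dec: "density (Suc N) t \<le> density N t" if "N0 \<le> N" "\<bar>t\<bar> \<le> R" for N t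
  proof -
    have "density (Suc N) t = density N t * weight N (inside N t)" by (simp add: density_def)
    also have "\<dots> \<le> density N t * 1" using N0[OF that] density_pos[of N t] by (intro mult_left_mono) auto
    finally show ?thesis by simp
  qed
  define c where "c = (\<Prod>n<N0. 1 / lam n)"
  have "density N t \<le> c" if "N0 \<le> N" "\<bar>t\<bar> \<le> R" for N t
    using that(1)
  proof (induction N rule: dec_induct)
    case base then show ?case unfolding c_def by (rule density_le)
  next
    case (step N) then show ?case using dec[of N t] that by simp
  qed
  moreover have "c > 0" unfolding c_def using lam by (intro prod_pos) auto
  ultimately show ?thesis using that dec by blast
qed

lemma mass_convergent:
  assumes "u \<le> v"
  shows "convergent (\<lambda>N. mass N u v)"
proof -
  obtain N0 c where N0: "\<And>N t. N0 \<le> N \<Longrightarrow> \<bar>t\<bar> \<le> \<bar>u\<bar> + \<bar>v\<bar> \<Longrightarrow> density (Suc N) t \<le> density N t"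
    by (rule eventually_density_bound) blast
  have "decseq (\<lambda>N. mass (N + N0) u v)"
    unfolding decseq_Suc_iff mass_def
    by (auto intro!: integral_le density_integrable N0)
  then have "convergent (\<lambda>N. mass (N + N0) u v)"
    by (rule decseq_convergent[of _ 0]) (auto simp: mass_nonneg convergent_def)
  then show ?thesis using convergent_ignore_initial_segment[of "\<lambda>N. mass N u v" N0] by simp
qed

definition stretch :: "real \<Rightarrow> real" where
  "stretch t = (if 0 \<le> t then lim (\<lambda>N. mass N 0 t) else - lim (\<lambda>N. mass N t 0))"

lemma mass_tendsto:
  assumes "u \<le> v"
  shows "(\<lambda>N. mass N u v) \<longlonglongrightarrow> stretch v - stretch u"
proof -
  have l: "(\<lambda>N. mass N a b) \<longlonglongrightarrow> lim (\<lambda>N. mass N a b)" if "a \<le> b" for a b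
    using mass_convergent[OF that] by (simp add: convergent_LIMSEQ_iff)
  consider "0 \<le> u" | "u < 0" "0 \<le> v" | "v < 0" by linarith
  then show ?thesis
  proof cases
    case 1
    have "(\<lambda>N. mass N 0 v - mass N 0 u) \<longlonglongrightarrow> stretch v - stretch u"
      using 1 assms by (auto simp: stretch_def intro!: tendsto_diff l)
    moreover have "mass N 0 v - mass N 0 u = mass N u v" for N using mass_add[of 0 u v N] 1 assms by simp
    ultimately show ?thesis by simp
  next
    case 2
    have "(\<lambda>N. mass N 0 v + mass N u 0) \<longlonglongrightarrow> stretch v - stretch u"
      using 2 l[of 0 v] l[of u 0] tendsto_add[OF l[of 0 v] l[of u 0]] by (simp add: stretch_def)
    moreover have "mass N 0 v + mass N u 0 = mass N u v" for N using mass_add[of u 0 v N] 2 by simp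
    ultimately show ?thesis by simp
  next
    case 3
    have "(\<lambda>N. mass N u 0 - mass N v 0) \<longlonglongrightarrow> stretch v - stretch u"
      using 3 assms tendsto_diff[OF l[of u 0] l[of v 0]] by (simp add: stretch_def)
    moreover have "mass N u 0 - mass N v 0 = mass N u v" for N using mass_add[of u v 0 N] 3 assms by simp
    ultimately show ?thesis by simp
  qed
qed

lemma stretch_mono: "u \<le> v \<Longrightarrow> stretch u \<le> stretch v"
  using LIMSEQ_le_const[OF mass_tendsto, of u v 0] mass_nonneg by auto

lemma stretch_continuous: "continuous_on UNIV stretch"
proof -
  have "isCont stretch t" for t
  proof -
    define R where "R = \<bar>t\<bar> + 1"
    obtain N0 c where c: "c > 0" "\<And>N t. N0 \<le> N \<Longrightarrow> \<bar>t\<bar> \<le> R \<Longrightarrow> density N t \<le> c"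
      by (rule eventually_density_bound[of R]) blast
    have le: "stretch v - stretch u \<le> c * (v - u)" if "u \<le> v" "\<bar>u\<bar> \<le> R" "\<bar>v\<bar> \<le> R" for u v
    proof (rule LIMSEQ_le_const2[OF mass_tendsto[OF that(1)]])
      show "\<exists>N. \<forall>n\<ge>N. mass n u v \<le> c * (v - u)"
        using that by (intro exI[of _ N0] allI impI mass_le c(2)) auto
    qed
    have lip: "\<bar>stretch v - stretch t\<bar> \<le> c * \<bar>v - t\<bar>" if "\<bar>v - t\<bar> < 1" for v
      using le[of t v] le[of v t] that stretch_mono[of t v] stretch_mono[of v t]
      by (cases "t \<le> v") (auto simp: R_def abs_if[of "stretch _ - _"])
    show ?thesis
      unfolding continuous_at_eps_delta
    proof (intro allI impI)
      fix e :: real assume e: "e > 0"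
      show "\<exists>d>0. \<forall>v. dist v t < d \<longrightarrow> dist (stretch v) (stretch t) < e"
      proof (intro exI[of _ "min 1 (e / c)"] conjI allI impI)
        fix v assume "dist v t < min 1 (e / c)"
        then have "\<bar>v - t\<bar> < 1" "c * \<bar>v - t\<bar> < e" using c(1) by (auto simp: dist_real_def field_simps)
        then show "dist (stretch v) (stretch t) < e" using lip[of v] by (simp add: dist_real_def)
      qed (use e c in auto)
    qed
  qed
  then show ?thesis by (simp add: continuous_on_eq_continuous_at)
qed

lemma outside_base_small:
  assumes "\<not> engulfs_base n" "inside n t" "\<bar>p - t\<bar> \<le> R" "\<bar>q - t\<bar> \<le> R"
  shows "2 * s n \<le> R / (16 * 4 ^ n)"
proof -
  have "32 * 4 ^ n * s n \<le> R"
    using assms outside_far[OF pq(1), of n t] outside_far[OF pq(2), of n t] unfolding engulfs_base_def by linarith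
  then show ?thesis by (simp add: field_simps)
qed

text \<open>
  Strict monotonicity on all of the line is needed for a homeomorphism, although the limiting density
  may vanish at points that belong to infinitely many balls. Balls that meet \<open>[u, v]\<close> without containing
  the base pair have summable lengths, so those with index at least some \<open>N1\<close> cover at most half of
  the interval, and finitely many factors remain.
\<close>

lemma stretch_strict_mono: "strict_mono stretch"
proof (rule strict_monoI)
  fix u v :: real assume uv: "u < v"
  define R where "R = \<bar>p\<bar> + \<bar>q\<bar> + \<bar>u\<bar> + \<bar>v\<bar>"
  obtain N1 where N1: "R / (v - u) < 2 ^ N1" using real_arch_pow[of 2] by auto
  define c where "c = (\<Prod>n<N1. lam n)"
  have c: "c > 0" unfolding c_def using lam by (intro prod_pos) auto
  have "c * (v - u) / 2 \<le> mass N u v" if N: "N1 \<le> N" for N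
  proof -
    define g where "g n = (if n < N1 then lam n else 1)" for n
    have "(\<Prod>n<N. g n) = (\<Prod>n<N1. g n)"
      using N by (intro prod.mono_neutral_right) (auto simp: g_def)
    also have "\<dots> = c" unfolding c_def by (intro prod.cong) (auto simp: g_def)
    finally have "(\<Prod>n<N. g n) = c" .
    moreover have "(\<Prod>n<N. g n) * (v - u) / 2 \<le> mass N u v"
    proof (rule mass_ge[OF uv, where S = "\<lambda>n. N1 \<le> n \<and> \<not> engulfs_base n"])
      show "0 < g n" for n using lam by (simp add: g_def)
    next
      fix n t assume "\<not> ((N1 \<le> n \<and> \<not> engulfs_base n) \<and> inside n t)"
      then show "g n \<le> weight n (inside n t)"
        using weight_bounds(2)[of n "inside n t"] lam[of n] by (auto simp: g_def weight_def)
    next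
      fix n t assume t: "u \<le> t" "t \<le> v" "N1 \<le> n \<and> \<not> engulfs_base n" "inside n t"
      have "2 * s n \<le> R / (16 * 4 ^ n)"
        by (rule outside_base_small) (use t in \<open>auto simp: R_def\<close>)
      also have "R \<le> (v - u) * 2 ^ n"
      proof -
        have "R < (v - u) * 2 ^ N1" using N1 uv by (simp add: field_simps)
        also have "\<dots> \<le> (v - u) * 2 ^ n" using t uv by (intro mult_left_mono power_increasing) auto
        finally show ?thesis by simp
      qed
      then have "R / (16 * 4 ^ n) \<le> (v - u) * 2 ^ n / (16 * 4 ^ n)" by (intro divide_right_mono) auto
      also have "\<dots> = (v - u) * (1/2) ^ n / 16"
        proof -
          have "(4::real) ^ n = 2 ^ n * 2 ^ n" by (simp add: power_mult_distrib[symmetric])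
          then show ?thesis by (simp add: power_divide)
        qed
      also have "\<dots> \<le> (v - u) * (1/2) ^ (n + 2)" using uv by simp
      finally show "2 * s n \<le> (v - u) * (1/2) ^ (n + 2)" .
    qed
    ultimately show ?thesis by simp
  qed
  then have "c * (v - u) / 2 \<le> stretch v - stretch u"
    using uv by (intro LIMSEQ_le_const[OF mass_tendsto]) auto
  moreover have "c * (v - u) / 2 > 0" using c uv by simp
  ultimately show "stretch u < stretch v" by linarith
qed

text \<open>
  Balls that contain the base pair have weight at least 1 everywhere, and the others are short when
  seen from an interval whose length dominates its distance from the base pair. This gives linear
  growth, hence surjectivity.
\<close>

lemma stretch_increment_ge:
  assumes uv: "u < v" and base: "\<And>t. u \<le> t \<Longrightarrow> t \<le> v \<Longrightarrow> \<bar>p - t\<bar> \<le> 2 * (v - u) \<and> \<bar>q - t\<bar> \<le> 2 * (v - u)"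
  shows "(v - u) / 2 \<le> stretch v - stretch u"
proof -
  have "(\<Prod>n<N. 1) * (v - u) / 2 \<le> mass N u v" for N
  proof (rule mass_ge[OF uv, where S = "\<lambda>n. \<not> engulfs_base n"])
    fix n t assume "\<not> (\<not> engulfs_base n \<and> inside n t)"
    then show "1 \<le> weight n (inside n t)" using lam[of n] by (auto simp: weight_def)
  next
    fix n t assume t: "u \<le> t" "t \<le> v" "\<not> engulfs_base n" "inside n t"
    have "2 * s n \<le> 2 * (v - u) / (16 * 4 ^ n)"
      by (rule outside_base_small) (use t base in auto)
    also have "\<dots> \<le> 2 * (v - u) / (16 * 2 ^ n)"
      using uv by (intro divide_left_mono mult_left_mono power_mono) auto
    also have "\<dots> \<le> (v - u) * (1/2) ^ (n + 2)" using uv by (simp add: power_divide field_simps)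
    finally show "2 * s n \<le> (v - u) * (1/2) ^ (n + 2)" .
  qed simp
  then show ?thesis using uv by (intro LIMSEQ_le_const[OF mass_tendsto]) auto
qed

lemma stretch_homeomorphism: "\<exists>G. homeomorphism UNIV UNIV stretch G"
proof -
  have "\<exists>t. stretch t = y" for y
  proof -
    define R where "R = \<bar>p\<bar> + \<bar>q\<bar> + 2 * \<bar>y - stretch 0\<bar> + 1"
    have R: "R > 0" by (simp add: R_def add_nonneg_pos)
    have base: "\<bar>p - t\<bar> \<le> 2 * R \<and> \<bar>q - t\<bar> \<le> 2 * R" if "\<bar>t\<bar> \<le> R" for t
    proof -
      have "\<bar>p\<bar> \<le> R" "\<bar>q\<bar> \<le> R" by (auto simp: R_def)
      then show ?thesis using that abs_triangle_ineq4[of p t] abs_triangle_ineq4[of q t] by auto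
    qed
    have "(R - 0) / 2 \<le> stretch R - stretch 0"
      by (rule stretch_increment_ge) (use R base in auto)
    moreover have "(0 - (- R)) / 2 \<le> stretch 0 - stretch (- R)"
      by (rule stretch_increment_ge) (use R base in auto)
    moreover have "\<bar>y - stretch 0\<bar> \<le> R / 2" by (simp add: R_def)
    then have "y - stretch 0 \<le> R / 2" "stretch 0 - y \<le> R / 2" by (simp_all only: abs_le_iff) auto
    ultimately have "stretch (- R) \<le> y" "y \<le> stretch R" by simp_all
    then have "\<exists>t. - R \<le> t \<and> t \<le> R \<and> stretch t = y"
      using R by (intro IVT' continuous_on_subset[OF stretch_continuous]) auto
    then show ?thesis by blast
  qed
  then have "surj stretch" by (metis surjI)
  then show ?thesis
    using homeomorphism_into_1d[OF path_connected_UNIV stretch_continuous]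
      strict_mono_imp_inj_on[OF stretch_strict_mono] by blast
qed

text \<open>
  The factor by which stage \<open>n\<close> changes the distance of two points of \<open>E\<close>.
\<close>

definition pair_weight :: "nat \<Rightarrow> real \<Rightarrow> real \<Rightarrow> real" where
  "pair_weight n y z = weight n (inside n y \<and> inside n z)"

definition dist_mass :: "nat \<Rightarrow> real \<Rightarrow> real \<Rightarrow> real" where
  "dist_mass N y z = mass N (min y z) (max y z)"

lemma dist_mass_tendsto: "(\<lambda>N. dist_mass N y z) \<longlonglongrightarrow> \<bar>stretch y - stretch z\<bar>"
proof -
  have "\<bar>stretch y - stretch z\<bar> = stretch (max y z) - stretch (min y z)"
    using stretch_mono[of y z] stretch_mono[of z y] by (cases "y \<le> z") (auto simp: max_def min_def)
  then show ?thesis unfolding dist_mass_def using mass_tendsto[of "min y z" "max y z"] by simp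
qed

text \<open>
  A ball that contains both points contains the interval between them, and this gives the upper
  bound. A ball that meets the interval without containing both points is separated from one of them
  by its annulus and is therefore much shorter than the interval; all these balls together cover at
  most half of it.
\<close>

lemma dist_mass_bounds:
  assumes "y \<in> E" "z \<in> E"
  shows "dist_mass N y z \<le> (\<Prod>n<N. pair_weight n y z) * \<bar>y - z\<bar>"
    and "(\<Prod>n<N. pair_weight n y z) * \<bar>y - z\<bar> \<le> 2 * dist_mass N y z"
proof -
  define u v where "u = min y z" and "v = max y z"
  have uv: "u \<le> v" "v - u = \<bar>y - z\<bar>" "u \<in> E" "v \<in> E" using assms by (auto simp: u_def v_def min_def max_def)
  have pw: "pair_weight n y z = weight n (inside n u \<and> inside n v)" for n
    by (auto simp: pair_weight_def u_def v_def min_def max_def conj_commute)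
  have "mass N u v \<le> (\<Prod>n<N. pair_weight n y z) * (v - u)"
  proof (rule mass_le[OF uv(1)])
    fix t assume t: "u \<le> t" "t \<le> v"
    show "density N t \<le> (\<Prod>n<N. pair_weight n y z)" unfolding density_def
    proof (intro prod_mono conjI)
      fix n
      show "0 \<le> weight n (inside n t)" by (simp add: weight_bounds less_imp_le)
      have "inside n u \<and> inside n v \<longrightarrow> inside n t" using inside_convex[of n u v t] t by blast
      then show "weight n (inside n t) \<le> pair_weight n y z"
        unfolding pw using weight_bounds(4)[of n]
        by (cases "inside n u \<and> inside n v"; cases "inside n t") auto
    qed
  qed
  then show "dist_mass N y z \<le> (\<Prod>n<N. pair_weight n y z) * \<bar>y - z\<bar>"
    by (simp add: dist_mass_def u_def[symmetric] v_def[symmetric] uv(2))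
  show "(\<Prod>n<N. pair_weight n y z) * \<bar>y - z\<bar> \<le> 2 * dist_mass N y z"
  proof (cases "u = v")
    case True
    then have "\<bar>y - z\<bar> = 0" using uv(2) by simp
    then show ?thesis using mass_nonneg by (simp add: dist_mass_def)
  next
    case False
    then have lt: "u < v" using uv by simp
    have "(\<Prod>n<N. pair_weight n y z) * (v - u) / 2 \<le> mass N u v"
    proof (rule mass_ge[OF lt, where S = "\<lambda>n. \<not> (inside n u \<and> inside n v)"])
      show "0 < pair_weight n y z" for n by (simp add: pw weight_bounds)
    next
      fix n t assume t: "u \<le> t" "t \<le> v" "\<not> (\<not> (inside n u \<and> inside n v) \<and> inside n t)"
      then have "inside n t \<longleftrightarrow> inside n u \<and> inside n v" using inside_convex[of n u v t] by blast
      then show "pair_weight n y z \<le> weight n (inside n t)" by (simp add: pw)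
    next
      fix n t assume t: "u \<le> t" "t \<le> v" "\<not> (inside n u \<and> inside n v)" "inside n t"
      have "32 * 4 ^ n * s n \<le> v - u"
        using outside_far[OF uv(3), of n t] outside_far[OF uv(4), of n t] t by fastforce
      then have "2 * s n \<le> (v - u) / (16 * 4 ^ n)" by (simp add: field_simps)
      also have "\<dots> \<le> (v - u) / (16 * 2 ^ n)"
        using lt by (intro divide_left_mono mult_left_mono power_mono) auto
      also have "\<dots> \<le> (v - u) * (1/2) ^ (n + 2)" using lt by (simp add: power_divide field_simps)
      finally show "2 * s n \<le> (v - u) * (1/2) ^ (n + 2)" .
    qed
    then show ?thesis by (simp add: dist_mass_def u_def[symmetric] v_def[symmetric] uv(2))
  qed
qed

lemma pair_weight_pos: "0 < pair_weight n y z"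
  by (simp add: pair_weight_def weight_bounds)

lemma dist_mass_ratio:
  assumes E: "y \<in> E" "a \<in> E" "b \<in> E" and w: "(\<Prod>n<N. pair_weight n y a) \<le> w * (\<Prod>n<N. pair_weight n y b)" "w \<ge> 0"
  shows "dist_mass N y a * \<bar>y - b\<bar> \<le> 2 * w * \<bar>y - a\<bar> * dist_mass N y b"
proof -
  have "dist_mass N y a \<le> (w * (\<Prod>n<N. pair_weight n y b)) * \<bar>y - a\<bar>"
    using dist_mass_bounds(1)[OF E(1,2), of N] mult_right_mono[OF w(1), of "\<bar>y - a\<bar>"] by linarith
  then have "dist_mass N y a * \<bar>y - b\<bar> \<le> (w * (\<Prod>n<N. pair_weight n y b)) * \<bar>y - a\<bar> * \<bar>y - b\<bar>"
    by (rule mult_right_mono) simp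
  also have "\<dots> = w * \<bar>y - a\<bar> * ((\<Prod>n<N. pair_weight n y b) * \<bar>y - b\<bar>)" by simp
  also have "\<dots> \<le> w * \<bar>y - a\<bar> * (2 * dist_mass N y b)"
    using w(2) dist_mass_bounds(2)[OF E(1,3), of N] by (intro mult_left_mono) auto
  finally show ?thesis by simp
qed

definition loss :: "nat \<Rightarrow> real" where "loss T = (\<Prod>n<T. 1 / lam n)"

lemma loss_ge_1: "1 \<le> loss T"
  unfolding loss_def using lam by (intro prod_ge_1) auto

text \<open>
  Stage \<open>n\<close> can worsen the ratio only if its ball contains \<open>y\<close> and \<open>b\<close> but not \<open>a\<close>. Then
  \<open>\<bar>y - a\<bar>\<close> exceeds \<open>s n\<close> while \<open>\<bar>y - b\<bar>\<close> is at most \<open>2 * s n / K n\<close>, so \<open>T\<close> exceeds \<open>n\<close>. The total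
  loss is thus bounded by finitely many factors, whose size does not matter.
\<close>

lemma stretch_ratio:
  assumes E: "y \<in> E" "a \<in> E" "b \<in> E" "y \<noteq> b" and T: "\<bar>y - a\<bar> \<le> real T * \<bar>y - b\<bar>"
  shows "\<bar>stretch y - stretch a\<bar> * \<bar>y - b\<bar> \<le> 2 * loss T * \<bar>y - a\<bar> * \<bar>stretch y - stretch b\<bar>"
proof (rule LIMSEQ_le)
  show "(\<lambda>N. dist_mass N y a * \<bar>y - b\<bar>) \<longlonglongrightarrow> \<bar>stretch y - stretch a\<bar> * \<bar>y - b\<bar>"
    by (intro tendsto_intros dist_mass_tendsto)
  show "(\<lambda>N. 2 * loss T * \<bar>y - a\<bar> * dist_mass N y b) \<longlonglongrightarrow> 2 * loss T * \<bar>y - a\<bar> * \<bar>stretch y - stretch b\<bar>"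
    by (intro tendsto_intros dist_mass_tendsto)
  have "(\<Prod>n<N. pair_weight n y a) \<le> loss T * (\<Prod>n<N. pair_weight n y b)" for N
  proof -
    have "pair_weight n y a \<le> (if n < T then 1 / lam n else 1) * pair_weight n y b" for n
    proof (cases "n < T")
      case True
      have "pair_weight n y a \<le> 1 / lam n * weight n True"
        using weight_bounds(4,5)[of n] lam[of n] by (cases "inside n y \<and> inside n a") (auto simp: pair_weight_def)
      also have "weight n True \<le> pair_weight n y b"
        using weight_bounds(4)[of n] by (cases "inside n y \<and> inside n b") (auto simp: pair_weight_def)
      then have "1 / lam n * weight n True \<le> 1 / lam n * pair_weight n y b"
        using lam[of n] by (intro mult_left_mono) auto
      finally show ?thesis using True by simp
    next
      case False
      have "inside n a" if i: "inside n y" "inside n b"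
      proof (rule ccontr)
        assume "\<not> inside n a"
        then have "32 * 4 ^ n * s n \<le> \<bar>y - a\<bar>" using outside_far[OF E(2) _ i(1)] by (simp add: abs_minus_commute)
        moreover have "1 * s n \<le> 4 ^ n * s n" using s[of n] by (intro mult_right_mono) auto
        ultimately have "32 * s n \<le> real T * \<bar>y - b\<bar>" using T by simp
        also have "\<dots> \<le> K n * \<bar>y - b\<bar>" using False K_bounds(4)[of n] by (intro mult_right_mono) auto
        also have "\<dots> \<le> 2 * s n" using inside_close[OF E(1,3) i] by (simp add: mult.commute)
        finally show False using s[of n] by simp
      qed
      then show ?thesis using False weight_bounds(4)[of n]
        by (cases "inside n y \<and> inside n b"; cases "inside n y \<and> inside n a") (auto simp: pair_weight_def)
    qed
    then have "(\<Prod>n<N. pair_weight n y a) \<le> (\<Prod>n<N. (if n < T then 1 / lam n else 1) * pair_weight n y b)"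
      by (intro prod_mono) (auto simp: pair_weight_pos less_imp_le)
    also have "\<dots> = (\<Prod>n<N. if n < T then 1 / lam n else 1) * (\<Prod>n<N. pair_weight n y b)"
      by (simp add: prod.distrib)
    also have "\<dots> \<le> loss T * (\<Prod>n<N. pair_weight n y b)"
    proof (rule mult_right_mono)
      have "(\<Prod>n<N. if n < T then 1 / lam n else 1) = (\<Prod>n\<in>{..<N} \<inter> {..<T}. 1 / lam n)"
        by (simp add: prod.inter_restrict)
      also have "\<dots> \<le> loss T" unfolding loss_def
        using lam by (intro prod_mono2) (auto simp: less_imp_le)
      finally show "(\<Prod>n<N. if n < T then 1 / lam n else 1) \<le> loss T" .
    qed (simp add: prod_nonneg pair_weight_pos less_imp_le)
    finally show ?thesis .
  qed
  then show "\<exists>N. \<forall>n\<ge>N. dist_mass n y a * \<bar>y - b\<bar> \<le> 2 * loss T * \<bar>y - a\<bar> * dist_mass n y b"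
    using dist_mass_ratio[OF E(1-3)] loss_ge_1[of T] by (auto simp: order_trans[OF zero_le_one])
qed

lemma stretch_quasisymmetric: "quasisymmetric_on E stretch"
proof -
  obtain G where G: "homeomorphism UNIV UNIV stretch G" using stretch_homeomorphism by blast
  have ratio: "dist (stretch y) (stretch a) \<le> 2 * loss T * t * dist (stretch y) (stretch b)"
    if "y \<in> E" "a \<in> E" "b \<in> E" "y \<noteq> b" "dist y a \<le> t * dist y b" "t \<le> real T" for y a b t T
  proof -
    have yb: "\<bar>y - b\<bar> > 0" using that by simp
    have "\<bar>y - a\<bar> \<le> t * \<bar>y - b\<bar>" using that by (simp add: dist_real_def)
    also have "\<dots> \<le> real T * \<bar>y - b\<bar>" using that by (intro mult_right_mono) auto
    finally have "\<bar>stretch y - stretch a\<bar> * \<bar>y - b\<bar> \<le> 2 * loss T * \<bar>y - a\<bar> * \<bar>stretch y - stretch b\<bar>"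
      using that by (intro stretch_ratio) auto
    also have "\<dots> \<le> 2 * loss T * (t * \<bar>y - b\<bar>) * \<bar>stretch y - stretch b\<bar>"
      using that loss_ge_1[of T] by (intro mult_right_mono mult_left_mono) (auto simp: dist_real_def)
    finally have "\<bar>stretch y - stretch a\<bar> * \<bar>y - b\<bar> \<le> (2 * loss T * t * \<bar>stretch y - stretch b\<bar>) * \<bar>y - b\<bar>"
      by (simp add: mult_ac)
    then show ?thesis using yb by (simp add: dist_real_def)
  qed
  show ?thesis
  proof (rule quasisymmetric_onI)
    show "homeomorphism E (stretch ` E) stretch G"
      by (rule homeomorphism_of_subsets[OF G]) auto
    fix T :: real assume "T > 0"
    obtain n where "T < real n" using reals_Archimedean2 by blast
    then show "\<exists>B. \<forall>x\<in>E. \<forall>a\<in>E. \<forall>b\<in>E. x \<noteq> b \<longrightarrow> dist x a \<le> T * dist x b \<longrightarrow>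
        dist (stretch x) (stretch a) \<le> B * dist (stretch x) (stretch b)"
      using ratio[of _ _ _ T n] by (intro exI[of _ "2 * loss n * T"]) auto
  next
    fix e :: real assume e: "e > 0"
    define d where "d = min 1 (e / (2 * loss 1))"
    have d: "d > 0" "d \<le> 1" "2 * loss 1 * d \<le> e"
      using e loss_ge_1[of 1] by (auto simp: d_def min_def field_simps)
    show "\<exists>d>0. \<forall>x\<in>E. \<forall>a\<in>E. \<forall>b\<in>E. x \<noteq> b \<longrightarrow> dist x a \<le> d * dist x b \<longrightarrow>
        dist (stretch x) (stretch a) \<le> e * dist (stretch x) (stretch b)"
    proof (intro exI[of _ d] conjI ballI impI)
      fix y a b assume "y \<in> E" "a \<in> E" "b \<in> E" "y \<noteq> b" "dist y a \<le> d * dist y b"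
      then have "dist (stretch y) (stretch a) \<le> 2 * loss 1 * d * dist (stretch y) (stretch b)"
        using d by (intro ratio) auto
      also have "\<dots> \<le> e * dist (stretch y) (stretch b)" using d by (intro mult_right_mono) auto
      finally show "dist (stretch y) (stretch a) \<le> e * dist (stretch y) (stretch b)" .
    qed (use d in auto)
  qed
qed

text \<open>
  Stage \<open>n\<close> contributes exactly \<open>lam n\<close>. No other stage can make up for it: its ball would have to
  contain \<open>x n\<close> and \<open>b\<close> but not \<open>a\<close>, although \<open>a\<close> is closer to \<open>x n\<close> than \<open>b\<close> is.
\<close>

lemma stretch_shrinks:
  assumes E: "a \<in> E" "b \<in> E" and ab: "inside n a" "\<not> inside n b"
  shows "\<bar>stretch (x n) - stretch a\<bar> \<le> lam n * \<bar>stretch (x n) - stretch b\<bar>"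
proof -
  have a: "\<bar>x n - a\<bar> < s n / K n" using inside_iff(1)[OF E(1), of n] ab by (simp add: abs_minus_commute)
  have b: "K n * s n < \<bar>x n - b\<bar>" using inside_iff(2)[OF E(2), of n] ab by (simp add: abs_minus_commute)
  have "s n / K n \<le> s n / 1" using K_bounds[of n] s[of n] by (intro divide_left_mono) auto
  moreover have "64 * s n \<le> K n * s n" using K_bounds[of n] s[of n] by (intro mult_right_mono) auto
  ultimately have "\<bar>x n - a\<bar> < s n" "64 * s n < \<bar>x n - b\<bar>" using a b by auto
  then have ab2: "2 * \<bar>x n - a\<bar> < \<bar>x n - b\<bar>" using s[of n] by auto
  have "(\<Prod>m<N. pair_weight m (x n) a) \<le> lam n * (\<Prod>m<N. pair_weight m (x n) b)" if N: "n < N" for N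
  proof -
    have "pair_weight m (x n) a \<le> (if m = n then lam n else 1) * pair_weight m (x n) b" for m
    proof (cases "m = n")
      case True
      then show ?thesis using ab inside_x[of n] weight_bounds(5)[of n] by (simp add: pair_weight_def)
    next
      case False
      have "inside m a" if i: "inside m (x n)" "inside m b"
      proof (rule ccontr)
        assume "\<not> inside m a"
        then have "32 * 4 ^ m * s m \<le> \<bar>x n - a\<bar>" using outside_far[OF E(1) _ i(1)] by (simp add: abs_minus_commute)
        moreover have "1 * s m \<le> 4 ^ m * s m" using s[of m] by (intro mult_right_mono) auto
        ultimately have 1: "32 * s m \<le> \<bar>x n - a\<bar>" by simp
        have "\<bar>x n - b\<bar> * 1 \<le> \<bar>x n - b\<bar> * K m" using K_bounds[of m] by (intro mult_left_mono) auto
        then have "\<bar>x n - b\<bar> \<le> 2 * s m" using inside_close[OF x E(2) i] by simp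
        also have "\<dots> \<le> 2 * (32 * s m)" using s[of m] by simp
        also have "\<dots> \<le> 2 * \<bar>x n - a\<bar>" using 1 by (intro mult_left_mono) auto
        finally show False using ab2 by simp
      qed
      then show ?thesis using False weight_bounds(4)[of m]
        by (cases "inside m (x n) \<and> inside m b"; cases "inside m (x n) \<and> inside m a") (auto simp: pair_weight_def)
    qed
    then have "(\<Prod>m<N. pair_weight m (x n) a) \<le> (\<Prod>m<N. (if m = n then lam n else 1) * pair_weight m (x n) b)"
      by (intro prod_mono) (auto simp: pair_weight_pos less_imp_le)
    also have "\<dots> = (\<Prod>m<N. if m = n then lam n else 1) * (\<Prod>m<N. pair_weight m (x n) b)"
      by (simp add: prod.distrib)
    also have "(\<Prod>m<N. if m = n then lam n else 1) = lam n" using N by (simp add: prod.delta)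
    finally show ?thesis .
  qed
  then have "dist_mass N (x n) a * \<bar>x n - b\<bar> \<le> 2 * lam n * \<bar>x n - a\<bar> * dist_mass N (x n) b" if "n < N" for N
    using that lam[of n] E by (intro dist_mass_ratio x) auto
  then have "\<bar>stretch (x n) - stretch a\<bar> * \<bar>x n - b\<bar> \<le> 2 * lam n * \<bar>x n - a\<bar> * \<bar>stretch (x n) - stretch b\<bar>"
    by (intro LIMSEQ_le[of "\<lambda>N. dist_mass N (x n) a * \<bar>x n - b\<bar>" _ "\<lambda>N. 2 * lam n * \<bar>x n - a\<bar> * dist_mass N (x n) b"]
          tendsto_intros dist_mass_tendsto exI[of _ "Suc n"]) auto
  also have "\<dots> = (2 * \<bar>x n - a\<bar>) * (lam n * \<bar>stretch (x n) - stretch b\<bar>)" by simp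
  also have "\<dots> \<le> \<bar>x n - b\<bar> * (lam n * \<bar>stretch (x n) - stretch b\<bar>)"
    using ab2 lam[of n] by (intro mult_right_mono) auto
  finally have "\<bar>x n - b\<bar> * \<bar>stretch (x n) - stretch a\<bar> \<le> \<bar>x n - b\<bar> * (lam n * \<bar>stretch (x n) - stretch b\<bar>)"
    by (simp add: mult_ac)
  moreover have "0 < \<bar>x n - b\<bar>" using ab2 by (rule le_less_trans[rotated]) simp
  ultimately show ?thesis by (simp only: mult_le_cancel_left_pos)
qed

end

text \<open>
  The line is connected, so intermediate points at distances \<open>2 ^ i * \<bar>x - a\<bar>\<close> from \<open>x\<close> exist, and
  quasisymmetry with ratio 2 can be iterated.
\<close>

lemma quasisymmetric_power_growth:
  fixes H :: "real \<Rightarrow> real"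
  assumes "quasisymmetric_on UNIV H"
  obtains L where "L \<ge> 1"
    "\<And>k x a b. x \<noteq> a \<Longrightarrow> \<bar>x - b\<bar> \<le> 2 ^ k * \<bar>x - a\<bar> \<Longrightarrow> \<bar>H x - H b\<bar> \<le> L ^ Suc k * \<bar>H x - H a\<bar>"
proof -
  obtain L where L: "L \<ge> 1" "\<And>x a b. x \<noteq> b \<Longrightarrow> \<bar>x - a\<bar> \<le> 2 * \<bar>x - b\<bar> \<Longrightarrow> \<bar>H x - H a\<bar> \<le> L * \<bar>H x - H b\<bar>"
    by (rule quasisymmetric_on_bounded_ratio[OF assms, of 2]) (auto simp: dist_real_def)
  have "\<bar>H x - H b\<bar> \<le> L ^ Suc k * \<bar>H x - H a\<bar>" if "x \<noteq> a" "\<bar>x - b\<bar> \<le> 2 ^ k * \<bar>x - a\<bar>" for k x a b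
    using that
  proof (induction k arbitrary: a)
    case 0
    then have "\<bar>x - b\<bar> \<le> 1 * \<bar>x - a\<bar>" by simp
    also have "\<dots> \<le> 2 * \<bar>x - a\<bar>" by (intro mult_right_mono) auto
    finally have "\<bar>x - b\<bar> \<le> 2 * \<bar>x - a\<bar>" .
    then show ?case using L(2)[of x a b] 0 by simp
  next
    case (Suc k)
    define a' where "a' = x + 2 * (a - x)"
    have "x - a' = 2 * (x - a)" by (simp add: a'_def)
    then have a'1: "\<bar>x - a'\<bar> = 2 * \<bar>x - a\<bar>" by (simp only: abs_mult abs_numeral)
    moreover have "x \<noteq> a'" using a'1 Suc.prems(1) by auto
    ultimately have a': "\<bar>x - a'\<bar> = 2 * \<bar>x - a\<bar>" "x \<noteq> a'" by auto
    have "\<bar>H x - H b\<bar> \<le> L ^ Suc k * \<bar>H x - H a'\<bar>" using Suc a' by (intro Suc.IH) auto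
    also have "\<dots> \<le> L ^ Suc k * (L * \<bar>H x - H a\<bar>)" using L a' Suc.prems by (intro mult_left_mono) auto
    finally show ?case by (simp add: mult_ac)
  qed
  with L(1) show ?thesis by (rule that)
qed

text \<open>
  The ratio of radii of an empty annulus is taken to be a square \<open>K n ^ 2\<close>, so that its geometric
  mean radius is at distance ratio \<open>K n\<close> from both of its boundary spheres.
\<close>

lemma extension_property_imp_relatively_connected:
  fixes E :: "real set"
  assumes ext: "quasisymmetric_extension_property E"
  shows "relatively_connected E"
proof (rule ccontr)
  assume not_rc: "\<not> relatively_connected E"
  define K :: "nat \<Rightarrow> real" where "K n = 4 ^ (n + 3)" for n
  have K1: "1 < K n" for n unfolding K_def by (intro one_less_power) auto
  have "\<exists>x s a b. x \<in> E \<and> 0 < s \<and> (\<forall>y\<in>E. \<bar>y - x\<bar> < s / K n \<or> K n * s < \<bar>y - x\<bar>) \<and>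
      a \<in> E \<and> b \<in> E \<and> a \<noteq> x \<and> \<bar>a - x\<bar> \<le> s \<and> \<not> \<bar>b - x\<bar> \<le> s" for n
  proof -
    have "\<not> M_relatively_connected (K n ^ 2) E" using not_rc by (auto simp: relatively_connected_def)
    moreover have "K n ^ 2 > 1" using K1[of n] by (intro one_less_power) auto
    ultimately obtain x r where xr: "x \<in> E" "r > 0" "cball x r \<inter> E \<noteq> E" "cball x r \<inter> E \<noteq> {x}"
      "(cball x r \<inter> E) - (ball x (r / K n ^ 2) \<inter> E) = {}"
      unfolding M_relatively_connected_def by blast
    define s where "s = r / K n"
    have s: "s > 0" "s / K n = r / K n ^ 2" "K n * s = r" using xr K1[of n] by (auto simp: s_def power2_eq_square)
    have sr: "s \<le> r" using s K1[of n] mult_right_mono[of 1 "K n" s] by simp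
    have gap: "\<bar>y - x\<bar> < s / K n \<or> K n * s < \<bar>y - x\<bar>" if "y \<in> E" for y
    proof -
      have "y \<in> cball x r \<Longrightarrow> y \<in> ball x (r / K n ^ 2)" using xr(5) that by blast
      then show ?thesis unfolding s(2,3) by (auto simp: dist_real_def abs_minus_commute)
    qed
    obtain a where a: "a \<in> E" "a \<in> cball x r" "a \<noteq> x" using xr by force
    obtain b where b: "b \<in> E" "b \<notin> cball x r" using xr(3) by blast
    have "s / K n \<le> s / 1" using s K1[of n] by (intro divide_left_mono) auto
    then have "\<bar>a - x\<bar> \<le> s" using gap[OF a(1)] a(2) s(3) by (auto simp: dist_real_def abs_minus_commute)
    moreover have "\<not> \<bar>b - x\<bar> \<le> s" using b(2) sr by (auto simp: dist_real_def abs_minus_commute)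
    ultimately show ?thesis using xr(1) s(1) gap a b(1) by blast
  qed
  then obtain x s a b where *: "\<And>n. x n \<in> E" "\<And>n. 0 < s n"
    "\<And>n y. y \<in> E \<Longrightarrow> \<bar>y - x n\<bar> < s n / K n \<or> K n * s n < \<bar>y - x n\<bar>"
    "\<And>n. a n \<in> E" "\<And>n. b n \<in> E" "\<And>n. a n \<noteq> x n" "\<And>n. \<bar>a n - x n\<bar> \<le> s n" "\<And>n. \<not> \<bar>b n - x n\<bar> \<le> s n"
    by metis
  have "\<exists>k. \<bar>x n - b n\<bar> \<le> 2 ^ k * \<bar>x n - a n\<bar>" for n
  proof -
    obtain k where "\<bar>x n - b n\<bar> / \<bar>x n - a n\<bar> < 2 ^ k" using real_arch_pow[of 2] by auto
    then show ?thesis using *(6)[of n] by (intro exI[of _ k]) (simp add: field_simps)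
  qed
  then obtain k where k: "\<And>n. \<bar>x n - b n\<bar> \<le> 2 ^ k n * \<bar>x n - a n\<bar>" by metis
  \<comment> \<open>Chosen against the growth \<open>L ^ Suc (k n)\<close> of any extension: \<open>real n + 2\<close> eventually exceeds \<open>L\<close>.\<close>
  define lam where "lam n = 1 / (real n + 2) ^ Suc (k n)" for n
  \<comment> \<open>The base pair may be any two distinct points of \<open>E\<close>.\<close>
  interpret widening_gaps E x s K lam "x 0" "a 0"
  proof
    show "lam n \<le> 1" for n unfolding lam_def by (simp add: divide_le_eq_1 one_le_power del: power_Suc)
    show "0 < lam n" for n unfolding lam_def by (intro divide_pos_pos zero_less_power) auto
  qed (use * in \<open>auto simp: K_def, metis\<close>)
  obtain G where G: "homeomorphism UNIV UNIV stretch G" using stretch_homeomorphism by blast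
  then obtain H H' where H: "quasisymmetric_on UNIV H" "\<And>y. y \<in> E \<Longrightarrow> H y = stretch y"
    using ext stretch_quasisymmetric unfolding quasisymmetric_extension_property_def by blast
  obtain L where L: "L \<ge> 1"
    "\<And>k x a b. x \<noteq> a \<Longrightarrow> \<bar>x - b\<bar> \<le> 2 ^ k * \<bar>x - a\<bar> \<Longrightarrow> \<bar>H x - H b\<bar> \<le> L ^ Suc k * \<bar>H x - H a\<bar>"
    by (rule quasisymmetric_power_growth[OF H(1)]) blast
  obtain n where n: "L < real n" using reals_Archimedean2 by blast
  define A B where "A = \<bar>stretch (x n) - stretch (a n)\<bar>" and "B = \<bar>stretch (x n) - stretch (b n)\<bar>"
  have "stretch (x n) \<noteq> stretch (a n)" using *(6)[of n] stretch_strict_mono by (metis strict_mono_eq)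
  then have A: "A > 0" by (simp add: A_def)
  have "A \<le> lam n * B" unfolding A_def B_def
    by (rule stretch_shrinks) (use * in \<open>auto simp: inside_def\<close>)
  moreover have "B \<le> L ^ Suc (k n) * A"
    using L(2)[OF _ k[of n]] *(1,4,5,6)[of n] by (simp add: A_def B_def H)
  ultimately have "A \<le> lam n * (L ^ Suc (k n) * A)"
    using lam(1)[of n] by (meson mult_left_mono order_trans less_imp_le)
  then have "(real n + 2) ^ Suc (k n) \<le> L ^ Suc (k n)"
    using A by (simp add: lam_def field_simps del: power_Suc)
  then have "real n + 2 \<le> L" using L(1) by (meson power_le_imp_le_base order_trans zero_le_one)
  then show False using n by simp
qed

theorem theorem1p2:
  fixes E :: "real set"
  shows "quasisymmetric_extension_property E \<longleftrightarrow> relatively_connected E"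
  using extension_property_imp_relatively_connected relatively_connected_imp_extension_property by blast

end
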